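(* Let $H_0:\mathbb T^N\times[0,T]\times\mathbb R^N\to\mathbb R$ be continuous, convex in $p$, and superlinear in $p$ uniformly for $(x,t)\in\mathbb T^N\times[0,T]$. For a measure $\xi\in\mathbb P(\Gamma)$ the following statements are equivalent: (i) $\xi$ is $g_0$-optimal for some continuous function $g_0:\mathbb T^N\to\mathbb R$; (ii) for some continuous function $g_0:\mathbb T^N\to\mathbb R$, denoting by $v$ the Lax–Oleinik solution with final datum $g_0$, $$\int A_{L_0}(\zeta)\,d\xi(\zeta)=\langle\xi(0),v(\cdot,0)\rangle-\langle\xi(T),g_0\rangle .$$
   Context: $\mathbb T^N$ is the $N$-dimensional flat torus, $T>0$, $\Gamma=C([0,T];\mathbb T^N)$ with the uniform topology, $\mathbb P(\Gamma)$ the Borel probability measures on $\Gamma$. Uniform superlinearity means $H_0(x,t,p)/|p|\to+\infty$ as $|p|\to+\infty$ uniformly in $(x,t)$. $L_0(x,t,q)=\sup_{p}(p\cdot q-H_0(x,t,p))$. For $\zeta\in\Gamma$, $A_{L_0}(\zeta)=\int_0^TL_0(\zeta,t,\dot\zeta)\,dt$ if $\zeta$ is absolutely continuous and $+\infty$ otherwise; it is bounded below and lower semicontinuous. $\langle\mu,f\rangle=\int f\,d\mu$; $\xi(t)=\mathrm{ev}_t\#\xi$ with $\mathrm{ev}_t(\zeta)=\zeta(t)$. The Lax–Oleinik solution with final datum $g_0$ is $v(x,t)=\min\{g_0(\zeta(T))+\int_t^TL_0(\zeta,s,\dot\zeta)\,ds:\ \zeta:[t,T]\to\mathbb T^N\text{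 absolutely continuous},\ \zeta(t)=x\}$ for $t<T$, $v(x,T)=g_0(x)$. A curve $\zeta_0\in\Gamma$ is $g_0$-optimal if $g_0(\zeta_0(T))+A_{L_0}(\zeta_0)=\min\{g_0(\zeta(T))+A_{L_0}(\zeta):\zeta\in\Gamma,\zeta(0)=\zeta_0(0)\}$, equivalently $A_{L_0}(\zeta_0)=v(\zeta_0(0),0)-g_0(\zeta_0(T))$. A measure $\xi\in\mathbb P(\Gamma)$ is $g_0$-optimal if it is supported on $g_0$-optimal curves, i.e. the set of $g_0$-optimal curves has full $\xi$-measure. *)

theory Defs
  imports "HOL-Probability.Probability"
begin

text \<open>The flat torus: the quotient of Euclidean space by the lattice of integer vectors,
  with the quotient metric.\<close>

quotient_type 'n torus = "real ^ 'n" / "\<lambda>x y :: real ^ 'n. \<forall>i. x $ i - y $ i \<in> \<int>"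
  morphisms rep_torus to_torus
proof (rule equivpI)
  show "reflp (\<lambda>x y :: real ^ 'n. \<forall>i. x $ i - y $ i \<in> \<int>)"
    by (auto intro: reflpI)
  show "symp (\<lambda>x y :: real ^ 'n. \<forall>i. x $ i - y $ i \<in> \<int>)"
    by (rule sympI) (metis Ints_minus minus_diff_eq)
  show "transp (\<lambda>x y :: real ^ 'n. \<forall>i. x $ i - y $ i \<in> \<int>)"
  proof (rule transpI, rule allI)
    fix x y z :: "real ^ 'n" and i
    assume "\<forall>i. x $ i - y $ i \<in> \<int>" "\<forall>i. y $ i - z $ i \<in> \<int>"
    then have "(x $ i - y $ i) + (y $ i - z $ i) \<in> \<int>"
      by (blast intro: Ints_add)
    then show "x $ i - z $ i \<in> \<int>" by simp
  qed
qed

lemma to_torus_eq_iff: "to_torus x = to_torus y \<longleftrightarrow> (\<forall>i. x $ i - y $ i \<in> \<int>)"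
  by (rule torus.abs_eq_iff)

lemma to_torus_surj: "\<exists>a. to_torus a = x"
  by (rule exI[of _ "rep_torus x"]) (rule Quotient_abs_rep[OF Quotient_torus])

lift_definition torus_translate :: "'n::finite torus \<Rightarrow> real ^ 'n \<Rightarrow> 'n torus"
  is "\<lambda>x v. x + v"
  by simp

instantiation torus :: (finite) metric_space
begin

definition dist_torus :: "'a torus \<Rightarrow> 'a torus \<Rightarrow> real" where
  "dist_torus x y = Inf {dist a b | a b. to_torus a = x \<and> to_torus b = y}"

definition uniformity_torus :: "('a torus \<times> 'a torus) filter" where
  "uniformity_torus = (INF e\<in>{0<..}. principal {(x, y). dist x y < e})"

definition open_torus :: "'a torus set \<Rightarrow> bool" where
  "open_torus U \<longleftrightarrow> (\<forall>x\<in>U. eventually (\<lambda>(x', y). x' = x \<longrightarrow> y \<in> U) uniformity)"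

instance
proof
  have bdd: "bdd_below {dist a b | a b. to_torus a = x \<and> to_torus b = y}" for x y :: "'a torus"
    by (rule bdd_belowI[of _ 0]) auto
  have ne: "{dist a b | a b. to_torus a = x \<and> to_torus b = y} \<noteq> {}" for x y :: "'a torus"
    using to_torus_surj[of x] to_torus_surj[of y] by auto
  have le: "dist (to_torus a) (to_torus b) \<le> dist a b" for a b :: "real ^ 'a"
    unfolding dist_torus_def by (rule cInf_lower[OF _ bdd]) auto
  have near: "\<exists>a b. to_torus a = x \<and> to_torus b = y \<and> dist a b < dist x y + e"
    if "e > 0" for x y :: "'a torus" and e
    using cInf_lessD[OF ne[of x y], of "dist x y + e"] that
    unfolding dist_torus_def by auto
  show "uniformity = (INF e\<in>{0<..}. principal {(x :: 'a torus, y). dist x y < e})"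
    by (rule uniformity_torus_def)
  show "open U \<longleftrightarrow> (\<forall>x\<in>U. \<forall>\<^sub>F (x', y) in uniformity. x' = x \<longrightarrow> y \<in> U)" for U :: "'a torus set"
    by (rule open_torus_def)
  show "dist x y = 0 \<longleftrightarrow> x = y" for x y :: "'a torus"
  proof
    assume "x = y"
    moreover obtain a where "to_torus a = x" using to_torus_surj by blast
    ultimately have "dist x y \<le> 0" using le[of a a] by simp
    moreover have "0 \<le> dist x y"
      unfolding dist_torus_def by (rule cInf_greatest[OF ne]) auto
    ultimately show "dist x y = 0" by simp
  next
    assume 0: "dist x y = 0"
    obtain a b where ab: "to_torus a = x" "to_torus b = y" using to_torus_surj by metis
    have "a $ i - b $ i \<in> closure \<int>" for i
      unfolding closure_approachable
    proof (intro allI impI)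
      fix e :: real assume "e > 0"
      then obtain a' b' where *: "to_torus a' = x" "to_torus b' = y" "dist a' b' < e"
        using near[of e x y] 0 by auto
      have "a $ i - a' $ i \<in> \<int>" "b $ i - b' $ i \<in> \<int>"
        using ab * to_torus_eq_iff by metis+
      then have "(a $ i - a' $ i) - (b $ i - b' $ i) \<in> \<int>" by (rule Ints_diff)
      moreover have "\<bar>a' $ i - b' $ i\<bar> \<le> dist a' b'"
        using component_le_norm_cart[of "a' - b'" i] by (simp add: dist_norm)
      then have "dist ((a $ i - a' $ i) - (b $ i - b' $ i)) (a $ i - b $ i) < e"
        using * by (simp add: dist_real_def)
      ultimately show "\<exists>z\<in>\<int>. dist z (a $ i - b $ i) < e" by blast
    qed
    then show "x = y" using ab to_torus_eq_iff[of a b] by simp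
  qed
  show "dist x y \<le> dist x z + dist y z" for x y z :: "'a torus"
  proof (rule field_le_epsilon)
    fix e :: real assume "e > 0"
    then obtain a c b c' where *: "to_torus a = x" "to_torus c = z" "dist a c < dist x z + e/2"
      "to_torus b = y" "to_torus c' = z" "dist b c' < dist y z + e/2"
      using near[of "e/2" x z] near[of "e/2" y z] by auto
    have "c $ i - c' $ i \<in> \<int>" for i using * to_torus_eq_iff by metis
    then have "to_torus (b + (c - c')) = to_torus b" by (simp add: to_torus_eq_iff)
    then have "dist x y \<le> dist a (b + (c - c'))" using le[of a "b + (c - c')"] * by simp
    also have "\<dots> \<le> dist a c + dist c (b + (c - c'))" by (rule dist_triangle)
    also have "dist c (b + (c - c')) = dist b c'" by (simp add: dist_norm norm_minus_commute)
    finally show "dist x y \<le> dist x z + dist y z + e" using * by simp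
  qed
qed

end

lemma dist_to_torus_le: "dist (to_torus a) (to_torus b) \<le> dist a b"
proof -
  have "bdd_below {dist a' b' | a' b'. to_torus a' = to_torus a \<and> to_torus b' = to_torus b}"
    by (rule bdd_belowI[of _ 0]) auto
  then show ?thesis
    unfolding dist_torus_def by (rule cInf_lower[rotated]) blast
qed

text \<open>Derivatives of torus-valued curves: all tangent spaces are identified with Euclidean space,
  and the velocity is the \<open>q\<close> with \<open>\<zeta> s = \<zeta> t + (s - t) q + o(s - t)\<close>.\<close>

definition has_torus_velocity ::
  "(real \<Rightarrow> 'n::finite torus) \<Rightarrow> real ^ 'n \<Rightarrow> real set \<Rightarrow> real \<Rightarrow> bool" where
  "has_torus_velocity \<zeta> q S t \<longleftrightarrow>
     ((\<lambda>s. dist (\<zeta> s) (torus_translate (\<zeta> t) ((s - t) *\<^sub>R q)) / \<bar>s - t\<bar>) \<longlongrightarrow> 0) (at t within S)"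

definition torus_velocity :: "(real \<Rightarrow> 'n::finite torus) \<Rightarrow> real set \<Rightarrow> real \<Rightarrow> real ^ 'n" where
  "torus_velocity \<zeta> S t = (THE q. has_torus_velocity \<zeta> q S t)"

lemma has_torus_velocity_to_torus:
  assumes "(c has_vector_derivative q) (at t within S)"
  shows "has_torus_velocity (\<lambda>s. to_torus (c s)) q S t"
  unfolding has_torus_velocity_def
proof (rule tendsto_sandwich[OF _ _ tendsto_const])
  show "((\<lambda>s. norm ((c s - c t - (s - t) *\<^sub>R q) /\<^sub>R norm (s - t))) \<longlongrightarrow> 0) (at t within S)"
    using assms unfolding has_vector_derivative_def has_derivative_at_within
    by (intro tendsto_norm_zero) (simp add: divide_inverse)
  show "\<forall>\<^sub>F s in at t within S.
      dist (to_torus (c s)) (torus_translate (to_torus (c t)) ((s - t) *\<^sub>R q)) / \<bar>s - t\<bar>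
      \<le> norm ((c s - c t - (s - t) *\<^sub>R q) /\<^sub>R norm (s - t))"
  proof (rule always_eventually, rule allI)
    fix s
    have "dist (to_torus (c s)) (torus_translate (to_torus (c t)) ((s - t) *\<^sub>R q))
        \<le> norm (c s - c t - (s - t) *\<^sub>R q)"
      using dist_to_torus_le[of "c s" "c t + (s - t) *\<^sub>R q"]
      by (simp add: torus_translate.abs_eq dist_norm diff_diff_eq)
    then show "dist (to_torus (c s)) (torus_translate (to_torus (c t)) ((s - t) *\<^sub>R q)) / \<bar>s - t\<bar>
        \<le> norm ((c s - c t - (s - t) *\<^sub>R q) /\<^sub>R norm (s - t))"
      by (simp add: divide_inverse mult.commute mult_left_mono)
  qed
qed simp

definition abs_continuous_on :: "real \<Rightarrow> real \<Rightarrow> (real \<Rightarrow> 'a::metric_space) \<Rightarrow> bool" where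
  "abs_continuous_on a b \<zeta> \<longleftrightarrow>
     (\<forall>\<epsilon>>0. \<exists>\<delta>>0. \<forall>I. finite I \<and> (\<forall>(s, t)\<in>I. a \<le> s \<and> s \<le> t \<and> t \<le> b) \<and>
        disjoint_family_on (\<lambda>(s, t). {s<..<t}) I \<and> (\<Sum>(s, t)\<in>I. t - s) < \<delta> \<longrightarrow>
        (\<Sum>(s, t)\<in>I. dist (\<zeta> s) (\<zeta> t)) < \<epsilon>)"

text \<open>Integral of an extended-real function, as integral of the positive part minus integral of
  the negative part; meaningful for measurable functions for which one of the two is finite.\<close>

definition ereal_integral :: "'a measure \<Rightarrow> ('a \<Rightarrow> ereal) \<Rightarrow> ereal" where
  "ereal_integral M f =
     enn2ereal (\<integral>\<^sup>+ x. e2ennreal (f x) \<partial>M) - enn2ereal (\<integral>\<^sup>+ x. e2ennreal (- f x) \<partial>M)"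

text \<open>For Hamiltonians that are superlinear in \<open>p\<close> the supremum is over a set bounded above,
  so the real-valued \<open>SUP\<close> is the true one.\<close>

definition lagrangian ::
  "('n::finite torus \<Rightarrow> real \<Rightarrow> real ^ 'n \<Rightarrow> real) \<Rightarrow> 'n torus \<Rightarrow> real \<Rightarrow> real ^ 'n \<Rightarrow> real" where
  "lagrangian H x t q = (SUP p. p \<bullet> q - H x t p)"

text \<open>The completed measure makes the values chosen by \<open>torus_velocity\<close> on the null set of
  non-differentiability irrelevant.\<close>

definition action_integral ::
  "('n::finite torus \<Rightarrow> real \<Rightarrow> real ^ 'n \<Rightarrow> real) \<Rightarrow> real \<Rightarrow> real \<Rightarrow> (real \<Rightarrow> 'n torus) \<Rightarrow> ereal" where
  "action_integral L a b \<zeta> =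
     ereal_integral (lebesgue_on {a..b}) (\<lambda>s. ereal (L (\<zeta> s) s (torus_velocity \<zeta> {a..b} s)))"

definition action ::
  "('n::finite torus \<Rightarrow> real \<Rightarrow> real ^ 'n \<Rightarrow> real) \<Rightarrow> real \<Rightarrow> (real \<Rightarrow> 'n torus) \<Rightarrow> ereal" where
  "action L T \<zeta> = (if abs_continuous_on 0 T \<zeta> then action_integral L 0 T \<zeta> else \<infinity>)"

text \<open>The minimum defining the Lax-Oleinik solution is written literally, as a least element.\<close>

definition lax_oleinik ::
  "('n::finite torus \<Rightarrow> real \<Rightarrow> real ^ 'n \<Rightarrow> real) \<Rightarrow> real \<Rightarrow> ('n torus \<Rightarrow> real) \<Rightarrow>
    'n torus \<Rightarrow> real \<Rightarrow> real" where
  "lax_oleinik L T g x t =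
     (if t < T
      then real_of_ereal (LEAST m. m \<in> {ereal (g (\<zeta> T)) + action_integral L t T \<zeta> | \<zeta>.
             abs_continuous_on t T \<zeta> \<and> \<zeta> t = x})
      else g x)"

definition curve_metric :: "real \<Rightarrow> (real \<Rightarrow> 'n::finite torus) metric" where
  "curve_metric T = cfunspace (top_of_set {0..T}) euclidean_metric"

abbreviation curves :: "real \<Rightarrow> (real \<Rightarrow> 'n::finite torus) set" where
  "curves T \<equiv> mspace (curve_metric T)"

definition borel_curves :: "real \<Rightarrow> (real \<Rightarrow> 'n::finite torus) measure" where
  "borel_curves T = sigma (curves T) {U. openin (mtopology_of (curve_metric T)) U}"

lemma mem_curves_iff:
  "\<zeta> \<in> curves T \<longleftrightarrow> \<zeta> \<in> extensional {0..T} \<and> continuous_on {0..T} \<zeta>"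
proof -
  have "bounded (\<zeta> ` {0..T})" if "continuous_on {0..T} \<zeta>"
    using compact_continuous_image[OF that] compact_imp_bounded by auto
  then show ?thesis
    by (auto simp: curve_metric_def)
qed

definition optimal_curve ::
  "('n::finite torus \<Rightarrow> real \<Rightarrow> real ^ 'n \<Rightarrow> real) \<Rightarrow> real \<Rightarrow> ('n torus \<Rightarrow> real) \<Rightarrow>
    (real \<Rightarrow> 'n torus) \<Rightarrow> bool" where
  "optimal_curve L T g \<zeta>\<^sub>0 \<longleftrightarrow>
     is_arg_min (\<lambda>\<zeta>. ereal (g (\<zeta> T)) + action L T \<zeta>) (\<lambda>\<zeta>. \<zeta> \<in> curves T \<and> \<zeta> 0 = \<zeta>\<^sub>0 0) \<zeta>\<^sub>0"

definition optimal_measure ::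
  "('n::finite torus \<Rightarrow> real \<Rightarrow> real ^ 'n \<Rightarrow> real) \<Rightarrow> real \<Rightarrow> ('n torus \<Rightarrow> real) \<Rightarrow>
    (real \<Rightarrow> 'n torus) measure \<Rightarrow> bool" where
  "optimal_measure L T g \<xi> \<longleftrightarrow> (AE \<zeta> in \<xi>. optimal_curve L T g \<zeta>)"

definition marginal ::
  "(real \<Rightarrow> 'n::finite torus) measure \<Rightarrow> real \<Rightarrow> 'n torus measure" where
  "marginal \<xi> t = distr \<xi> borel (\<lambda>\<zeta>. \<zeta> t)"

end

theory Submission
  imports Defs "HOL-Complex_Analysis.Great_Picard"
begin

text \<open>For a fixed final datum \<open>g\<close> every curve satisfies
  \<open>v (\<zeta> 0) 0 \<le> g (\<zeta> T) + action \<zeta>\<close>, with equality exactly for the optimal curves; integrating against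
  \<open>\<xi>\<close>, the integrals agree iff equality holds almost everywhere. This requires the minimum that defines
  \<open>v\<close> to be attained, and \<open>v\<close> and the action to be Borel measurable, i.e. Tonelli's theory.

  All of it rests on a dual description of the action: up to an additive constant it is the supremum, over
  finite families of disjoint intervals \<open>{s..t}\<close> with slopes \<open>p\<close>, of the sums of
  \<open>p \<bullet> (\<zeta> t - \<zeta> s) - \<integral> H (\<zeta> \<tau>, \<tau>, p)\<close>. These sums are continuous in \<open>\<zeta>\<close>, so the action is lower
  semicontinuous, and slopes of large norm show that curves of bounded action are equicontinuous. The duality
  in turn needs absolutely continuous functions to be differentiable almost everywhere and to be
  integrals of their derivatives, which is obtained from Vitali's covering theorem and a gauge argument.\<close>


subsection \<open>Differentiability of monotone functions\<close>

text \<open>Lower semicontinuity and compactness, usually drawn from weak L1 convergence of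
  velocities, come here from the shape of \<open>defect\<close>: the velocity enters only through
  increments of the curve, so pointwise convergence of lifts suffices. Two growth properties share
  the work. Continuity of the Hamiltonian bounds it on balls of slopes, which makes the action
  coercive and gives equicontinuity; superlinearity bounds the Lagrangian on balls of velocities,
  which gives every point a competitor of bounded action and keeps the value function finite.
  Increments \<open>p \<bullet> (\<zeta> t - \<zeta> s)\<close> have no meaning on the torus, so the
  duality is carried out for lifts to Euclidean space, whose small distances agree with those on the
  torus. The additive constant is \<open>K * T\<close>, where \<open>K\<close> bounds the
  Hamiltonian at slope 0; it makes the shifted action an integral with values in
  \<open>ennreal\<close>. In the last step the value minus the datum is bounded, so comparing it
  with a possibly infinite action creates no difference of infinities.\<close>

lemma lmeasurable_outer_open:
  fixes E :: "'a::euclidean_space set"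
  assumes E: "E \<in> lmeasurable" and e: "0 < e"
  obtains U where "open U" "E \<subseteq> U" "U \<in> lmeasurable" "measure lebesgue U < measure lebesgue E + e"
proof -
  obtain U where U: "open U" "E \<subseteq> U" "U - E \<in> lmeasurable" "emeasure lebesgue (U - E) < ennreal e"
    using sets_lebesgue_outer_open[of E e] E e by (metis fmeasurableD)
  have eq: "E \<union> (U - E) = U" using U(2) by blast
  have "U \<in> lmeasurable" using fmeasurable.Un[OF E U(3)] eq by simp
  moreover have "measure lebesgue (U - E) < e"
    using U(3,4) e by (simp add: emeasure_eq_measure2 ennreal_less_iff)
  moreover have "measure lebesgue U \<le> measure lebesgue E + measure lebesgue (U - E)"
    using measure_Un_le[of E lebesgue "U - E"] E U(3) eq by (simp add: fmeasurableD)
  ultimately show thesis using U(1,2) by (intro that[of U]) auto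
qed

text \<open>The points around which \<open>g\<close> has arbitrarily small intervals of slope above \<open>q\<close>, so that
  its upper derivate there is at least \<open>q\<close>. Open intervals make it a \<open>G\<^sub>\<delta>\<close> set, and
  lower derivates are those of \<open>- g\<close>.\<close>

definition steep :: "(real \<Rightarrow> real) \<Rightarrow> real \<Rightarrow> real set" where
  "steep g q = (\<Inter>n::nat. \<Union>{ball a r | a r. 0 < r \<and> r < 1 / real (Suc n) \<and> 2 * q * r < g (a + r) - g (a - r)})"

lemma steepD:
  assumes "x \<in> steep g q" "0 < d"
  obtains a r where "0 < r" "r < d" "x \<in> ball a r" "2 * q * r < g (a + r) - g (a - r)"
proof -
  obtain n where n: "1 / real (Suc n) < d"
    using assms(2) nat_approx_posE by blast
  from assms(1) have "x \<in> \<Union>{ball a r | a r. 0 < r \<and> r < 1 / real (Suc n) \<and> 2 * q * r < g (a + r) - g (a - r)}"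
    unfolding steep_def by blast
  then obtain a r where "0 < r" "r < 1 / real (Suc n)" "x \<in> ball a r" "2 * q * r < g (a + r) - g (a - r)"
    by blast
  with n that show thesis by force
qed

lemma steepI:
  assumes "\<And>d. 0 < d \<Longrightarrow> \<exists>a r. 0 < r \<and> r < d \<and> x \<in> ball a r \<and> 2 * q * r < g (a + r) - g (a - r)"
  shows "x \<in> steep g q"
  unfolding steep_def
proof
  fix n :: nat
  obtain a r where "0 < r" "r < 1 / real (Suc n)" "x \<in> ball a r" "2 * q * r < g (a + r) - g (a - r)"
    using assms[of "1 / real (Suc n)"] by auto
  then show "x \<in> \<Union>{ball a r | a r. 0 < r \<and> r < 1 / real (Suc n) \<and> 2 * q * r < g (a + r) - g (a - r)}"
    by blast
qed

lemma steep_borel [measurable]: "steep g q \<in> sets borel"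
  unfolding steep_def by (rule sets.countable_INT'; force intro!: borel_open open_Union)

lemma steep_lebesgue: "steep g q \<in> sets lebesgue"
  using steep_borel by (metis sets_lborel sets_completionI_sets)

text \<open>The intervals \<open>{g (a - r)<..<g (a + r)}\<close> in the range are disjoint again; this needs no
  continuity of \<open>g\<close>.\<close>

lemma mono_disjoint_increments:
  fixes g :: "real \<Rightarrow> real"
  assumes g: "mono g" and C: "countable C" "\<And>i. i \<in> C \<Longrightarrow> 0 < r i"
    and disj: "pairwise (\<lambda>i j. disjnt (ball (a i) (r i)) (ball (a j) (r j))) C"
    and sub: "\<And>i. i \<in> C \<Longrightarrow> ball (a i) (r i) \<subseteq> {s<..<t}" and "s \<le> t"
  shows "(\<integral>\<^sup>+i. ennreal (g (a i + r i) - g (a i - r i)) \<partial>count_space C) \<le> ennreal (g t - g s)"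
proof -
  let ?J = "\<lambda>i. {g (a i - r i)<..<g (a i + r i)}"
  have le: "s \<le> a i - r i \<and> a i + r i \<le> t" if "i \<in> C" for i
  proof -
    have "{a i - r i<..<a i + r i} \<subseteq> {s<..<t}" using sub[OF that] by (simp add: ball_eq_greaterThanLessThan)
    then show ?thesis using C(2)[OF that] by (simp add: greaterThanLessThan_subseteq_greaterThanLessThan)
  qed
  have dj: "disjoint_family_on ?J C"
    unfolding disjoint_family_on_def
  proof (intro ballI impI)
    fix i j assume ij: "i \<in> C" "j \<in> C" "i \<noteq> j"
    then have d: "disjnt (ball (a i) (r i)) (ball (a j) (r j))" using disj by (auto simp: pairwise_def)
    have "a i + r i \<le> a j - r j \<or> a j + r j \<le> a i - r i"
    proof (rule ccontr)
      assume "\<not> ?thesis"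
      then have "max (a i - r i) (a j - r j) < min (a i + r i) (a j + r j)"
        using C(2)[OF ij(1)] C(2)[OF ij(2)] by auto
      then obtain z where "max (a i - r i) (a j - r j) < z" "z < min (a i + r i) (a j + r j)"
        using dense by blast
      then have "z \<in> ball (a i) (r i) \<inter> ball (a j) (r j)" by (auto simp: dist_real_def)
      with d show False by (auto simp: disjnt_def)
    qed
    then have "g (a i + r i) \<le> g (a j - r j) \<or> g (a j + r j) \<le> g (a i - r i)"
      using g by (auto simp: mono_def)
    then show "?J i \<inter> ?J j = {}" by auto
  qed
  have "(\<integral>\<^sup>+i. ennreal (g (a i + r i) - g (a i - r i)) \<partial>count_space C)
      = (\<integral>\<^sup>+i. emeasure lborel (?J i) \<partial>count_space C)"
    by (rule nn_integral_cong) (use C(2) g in \<open>force simp: mono_def\<close>)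
  also have "\<dots> = emeasure lborel (\<Union>i\<in>C. ?J i)"
    by (rule emeasure_UN_countable[symmetric]) (use C dj in auto)
  also have "\<dots> \<le> emeasure lborel {g s..g t}"
    using le g by (intro emeasure_mono) (fastforce simp: mono_def)+
  also have "\<dots> = ennreal (g t - g s)" using g \<open>s \<le> t\<close> by (simp add: mono_def)
  finally show ?thesis .
qed

lemma emeasure_Union_balls:
  fixes a :: "'i \<Rightarrow> real"
  assumes "countable C" "\<And>i. i \<in> C \<Longrightarrow> 0 < r i"
    and "pairwise (\<lambda>i j. disjnt (ball (a i) (r i)) (ball (a j) (r j))) C"
  shows "emeasure lebesgue (\<Union>i\<in>C. ball (a i) (r i)) = (\<integral>\<^sup>+i. ennreal (2 * r i) \<partial>count_space C)"
proof -
  have "disjoint_family_on (\<lambda>i. ball (a i) (r i)) C"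
    using assms(3) by (auto simp: disjoint_family_on_def pairwise_def disjnt_def)
  then have "emeasure lebesgue (\<Union>i\<in>C. ball (a i) (r i)) = (\<integral>\<^sup>+i. emeasure lebesgue (ball (a i) (r i)) \<partial>count_space C)"
    using assms(1) by (intro emeasure_UN_countable) auto
  also have "\<dots> = (\<integral>\<^sup>+i. ennreal (2 * r i) \<partial>count_space C)"
    by (rule nn_integral_cong) (use assms(2) in \<open>force simp: ball_eq_greaterThanLessThan\<close>)
  finally show ?thesis .
qed

text \<open>Steep intervals inside \<open>{s<..<t}\<close> form a fine cover of \<open>E\<close>,
  and Vitali extracts a disjoint countable family covering it up to a null set. On each interval
  \<open>q\<close> times the length is below the increment of \<open>g\<close>, and disjoint
  increments add up to at most \<open>g t - g s\<close>.\<close>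

lemma emeasure_steep_le:
  fixes g :: "real \<Rightarrow> real"
  assumes g: "mono g" and "0 < q" "s \<le> t" and E: "E \<in> sets lebesgue" "E \<subseteq> steep g q" "E \<subseteq> {s<..<t}"
  shows "ennreal q * emeasure lebesgue E \<le> ennreal (g t - g s)"
proof -
  define K where "K = {(a, r). 0 < r \<and> ball a r \<subseteq> {s<..<t} \<and> 2 * q * r < g (a + r) - g (a - r)}"
  have cov: "\<exists>i. i \<in> K \<and> x \<in> ball (fst i) (snd i) \<and> snd i < d" if x: "x \<in> E" and d: "0 < d" for x d
  proof -
    obtain e where e: "0 < e" "ball x e \<subseteq> {s<..<t}"
      using x E(3) open_greaterThanLessThan openE by (metis subsetD)
    \<comment> \<open>A ball of radius below e/2 that contains \<open>x\<close> lies in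
      \<open>ball x e\<close>, hence in \<open>{s<..<t}\<close>.\<close>
    obtain a r where ar: "0 < r" "r < min d (e/2)" "x \<in> ball a r" "2 * q * r < g (a + r) - g (a - r)"
      by (rule steepD[of x g q "min d (e/2)"]) (use x E(2) d e in auto)
    have "ball a r \<subseteq> ball x e"
    proof
      fix y assume "y \<in> ball a r"
      then show "y \<in> ball x e" using ar(2,3) dist_triangle[of x y a] by (simp add: dist_commute)
    qed
    then have "(a, r) \<in> K" using e ar by (auto simp: K_def)
    then show ?thesis using ar by auto
  qed
  obtain C where C: "countable C" "C \<subseteq> K"
      "pairwise (\<lambda>i j. disjnt (ball (fst i) (snd i)) (ball (fst j) (snd j))) C"
      "negligible (E - (\<Union>i\<in>C. ball (fst i) (snd i)))"
    using Vitali_covering_theorem_balls[of E K fst snd] cov by blast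
  have pos: "0 < snd i" if "i \<in> C" for i using C(2) that by (auto simp: K_def)
  have sub: "ball (fst i) (snd i) \<subseteq> {s<..<t}" if "i \<in> C" for i
  using subsetD[OF C(2) that] by (simp add: K_def case_prod_beta)
  have "emeasure lebesgue E \<le> emeasure lebesgue ((\<Union>i\<in>C. ball (fst i) (snd i)) \<union> (E - (\<Union>i\<in>C. ball (fst i) (snd i))))"
    using C(1) by (intro emeasure_mono sets.Un sets.Diff sets.countable_UN' E(1)) auto
  also have "\<dots> = emeasure lebesgue (\<Union>i\<in>C. ball (fst i) (snd i))"
    using C(1,4) E(1) by (intro emeasure_Un_null_set) (auto simp: negligible_iff_null_sets)
  also have "\<dots> = (\<integral>\<^sup>+i. ennreal (2 * snd i) \<partial>count_space C)"
    by (rule emeasure_Union_balls[OF C(1) pos C(3)])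
  finally have "ennreal q * emeasure lebesgue E \<le> ennreal q * (\<integral>\<^sup>+i. ennreal (2 * snd i) \<partial>count_space C)"
    by (rule mult_left_mono) simp
  also have "\<dots> = (\<integral>\<^sup>+i. ennreal (2 * q * snd i) \<partial>count_space C)"
    using \<open>0 < q\<close> by (subst nn_integral_cmult[symmetric])
      (auto simp: ennreal_mult'[symmetric] ac_simps intro!: nn_integral_cong)
  also have "\<dots> \<le> (\<integral>\<^sup>+i. ennreal (g (fst i + snd i) - g (fst i - snd i)) \<partial>count_space C)"
    using C(2) by (intro nn_integral_mono ennreal_leI) (auto simp: K_def)
  also have "\<dots> \<le> ennreal (g t - g s)"
    by (rule mono_disjoint_increments[OF g C(1) pos C(3) sub \<open>s \<le> t\<close>])
  finally show ?thesis .
qed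

text \<open>Intervals of slope below \<open>p\<close> inside an open \<open>U\<close> barely larger
  than the set cover it up to a null set; within each of them \<open>emeasure_steep_le\<close>
  bounds \<open>q\<close> times the measure of the set by the increment. Summation gives
  \<open>q\<close> times the measure of the set at most \<open>p\<close> times that of
  \<open>U\<close>, and p < q forces measure zero.\<close>

lemma negligible_steep_gap:
  fixes g :: "real \<Rightarrow> real"
  assumes g: "mono g" and pq: "0 < p" "p < q"
  shows "negligible (steep g q \<inter> steep (\<lambda>x. - g x) (- p) \<inter> {s<..<t})" (is "negligible ?E")
proof -
  have E: "?E \<in> lmeasurable"
  proof (rule bounded_set_imp_lmeasurable)
    show "bounded ?E" by (rule bounded_subset[of "{s<..<t}"]) auto
    show "?E \<in> sets lebesgue" by (intro sets.Int steep_lebesgue) auto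
  qed
  have *: "q * measure lebesgue ?E \<le> p * (measure lebesgue ?E + e)" if e: "0 < e" for e
  proof -
    obtain U where U: "open U" "?E \<subseteq> U" "U \<in> lmeasurable" "measure lebesgue U < measure lebesgue ?E + e"
      using lmeasurable_outer_open[OF E e] by blast
    define K where "K = {(a, r). 0 < r \<and> ball a r \<subseteq> U \<and> g (a + r) - g (a - r) < 2 * p * r}"
    have cov: "\<exists>i. i \<in> K \<and> x \<in> ball (fst i) (snd i) \<and> snd i < d" if x: "x \<in> ?E" and d: "0 < d" for x d
    proof -
      obtain e where e: "0 < e" "ball x e \<subseteq> U" using x U openE by blast
      obtain a r where ar: "0 < r" "r < min d (e/2)" "x \<in> ball a r" "g (a + r) - g (a - r) < 2 * p * r"
        by (rule steepD[of x "\<lambda>x. - g x" "- p" "min d (e/2)"]) (use x d e in auto)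
      have "ball a r \<subseteq> ball x e"
      proof
        fix y assume "y \<in> ball a r"
        then show "y \<in> ball x e" using ar(2,3) dist_triangle[of x y a] by (simp add: dist_commute)
      qed
      then have "(a, r) \<in> K" using e ar by (auto simp: K_def)
      then show ?thesis using ar by auto
    qed
    obtain C where C: "countable C" "C \<subseteq> K"
        "pairwise (\<lambda>i j. disjnt (ball (fst i) (snd i)) (ball (fst j) (snd j))) C"
        "negligible (?E - (\<Union>i\<in>C. ball (fst i) (snd i)))"
      using Vitali_covering_theorem_balls[of ?E K fst snd] cov by blast
    have pos: "0 < snd i" if "i \<in> C" for i using C(2) that by (auto simp: K_def)
    have sub: "ball (fst i) (snd i) \<subseteq> U" if "i \<in> C" for i
  using subsetD[OF C(2) that] by (simp add: K_def case_prod_beta)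
    let ?B = "\<lambda>i. ball (fst i) (snd i)"
    have Elb: "?E \<in> sets lebesgue" by simp
    have "emeasure lebesgue ?E \<le> emeasure lebesgue ((\<Union>i\<in>C. ?E \<inter> ?B i) \<union> (?E - (\<Union>i\<in>C. ?B i)))"
      using C(1) by (intro emeasure_mono sets.Un sets.Diff sets.countable_UN' sets.Int[OF Elb] Elb) auto
    also have "\<dots> = emeasure lebesgue (\<Union>i\<in>C. ?E \<inter> ?B i)"
      using C(1,4) by (intro emeasure_Un_null_set) (auto simp: negligible_iff_null_sets intro!: sets.countable_UN')
    also have "\<dots> = (\<integral>\<^sup>+i. emeasure lebesgue (?E \<inter> ?B i) \<partial>count_space C)"
    proof (rule emeasure_UN_countable)
      show "disjoint_family_on (\<lambda>i. ?E \<inter> ?B i) C"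
        using C(3) unfolding disjoint_family_on_def pairwise_def disjnt_def by blast
    qed (use C(1) in auto)
    finally have "ennreal q * emeasure lebesgue ?E
        \<le> ennreal q * (\<integral>\<^sup>+i. emeasure lebesgue (?E \<inter> ?B i) \<partial>count_space C)"
      by (rule mult_left_mono) simp
    also have "\<dots> = (\<integral>\<^sup>+i. ennreal q * emeasure lebesgue (?E \<inter> ?B i) \<partial>count_space C)"
      by (subst nn_integral_cmult) auto
    also have "\<dots> \<le> (\<integral>\<^sup>+i. ennreal (2 * p * snd i) \<partial>count_space C)"
    proof (rule nn_integral_mono)
      fix i assume "i \<in> space (count_space C)"
      then have i: "0 < snd i" "g (fst i + snd i) - g (fst i - snd i) < 2 * p * snd i"
        using C(2) by (auto simp: K_def)
      have "ennreal q * emeasure lebesgue (?E \<inter> ?B i) \<le> ennreal (g (fst i + snd i) - g (fst i - snd i))"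
        by (rule emeasure_steep_le[OF g]) (use pq i in \<open>auto simp: dist_real_def\<close>)
      also have "\<dots> \<le> ennreal (2 * p * snd i)" using i by (intro ennreal_leI) simp
      finally show "ennreal q * emeasure lebesgue (?E \<inter> ?B i) \<le> ennreal (2 * p * snd i)" .
    qed
    also have "\<dots> = ennreal p * (\<integral>\<^sup>+i. ennreal (2 * snd i) \<partial>count_space C)"
      using \<open>0 < p\<close> by (subst nn_integral_cmult[symmetric])
        (auto simp: ennreal_mult'[symmetric] ac_simps intro!: nn_integral_cong)
    also have "\<dots> = ennreal p * emeasure lebesgue (\<Union>i\<in>C. ?B i)"
      by (subst emeasure_Union_balls[OF C(1) pos C(3)]) auto
    also have "\<dots> \<le> ennreal p * emeasure lebesgue U"
    proof (intro mult_left_mono emeasure_mono)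
      show "(\<Union>i\<in>C. ?B i) \<subseteq> U" using sub by blast
    qed (use U(3) fmeasurableD in auto)
    finally have "ennreal (q * measure lebesgue ?E) \<le> ennreal (p * measure lebesgue U)"
      using E U(3) pq by (simp add: emeasure_eq_measure2 ennreal_mult'[symmetric])
    then have "q * measure lebesgue ?E \<le> p * measure lebesgue U"
      using pq by (subst (asm) ennreal_le_iff) auto
    also have "\<dots> \<le> p * (measure lebesgue ?E + e)" using U pq by simp
    finally show ?thesis .
  qed
  have "q * measure lebesgue ?E \<le> p * measure lebesgue ?E"
  proof (rule field_le_epsilon)
    fix e :: real assume "0 < e"
    then show "q * measure lebesgue ?E \<le> p * measure lebesgue ?E + e"
      using *[of "e / p"] pq by (simp add: distrib_left)
  qed
  then have "measure lebesgue ?E = 0"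
    using pq measure_nonneg[of lebesgue ?E]
    by (smt (verit) mult_less_cancel_right)
  then show ?thesis using E by (simp add: negligible_iff_measure)
qed

text \<open>Each slope k + 1 bounds (k + 1) times the measure by the fixed number
  \<open>g t - g s\<close>.\<close>

lemma negligible_steep_all:
  fixes g :: "real \<Rightarrow> real"
  assumes g: "mono g"
  shows "negligible ((\<Inter>k::nat. steep g (real (Suc k))) \<inter> {s<..<t})" (is "negligible ?E")
proof (cases "s \<le> t")
  case True
  have E: "?E \<in> lmeasurable"
  proof (rule bounded_set_imp_lmeasurable)
    show "bounded ?E" by (rule bounded_subset[of "{s<..<t}"]) auto
    show "?E \<in> sets lebesgue" by (intro sets.Int sets.countable_INT' steep_lebesgue) auto
  qed
  have *: "real (Suc k) * measure lebesgue ?E \<le> g t - g s" for k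
  proof -
    have "ennreal (real (Suc k)) * emeasure lebesgue ?E \<le> ennreal (g t - g s)"
      using E True by (intro emeasure_steep_le[OF g]) auto
    then have "ennreal (real (Suc k) * measure lebesgue ?E) \<le> ennreal (g t - g s)"
      using E by (simp only: emeasure_eq_measure2 ennreal_mult' of_nat_0_le_iff measure_nonneg)
    then show ?thesis using g True by (subst (asm) ennreal_le_iff) (auto simp: mono_def)
  qed
  have "measure lebesgue ?E = 0"
  proof (rule ccontr)
    assume "measure lebesgue ?E \<noteq> 0"
    then have "0 < measure lebesgue ?E" using measure_nonneg[of lebesgue ?E] by linarith
    then obtain k where "g t - g s < real k * measure lebesgue ?E"
      using reals_Archimedean3 by blast
    with *[of k] \<open>0 < measure lebesgue ?E\<close> show False by (simp add: distrib_right)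
  qed
  then show ?thesis using E by (simp add: negligible_iff_measure)
qed auto

section \<open>From the steep sets to pointwise derivatives\<close>

text \<open>\<open>steep\<close> tests only intervals with \<open>x\<close> strictly inside. A chord
  ending at \<open>x\<close> is the limit of such intervals as its endpoint is pushed by
  \<open>e\<close> beyond \<open>x\<close>, and continuity of \<open>g\<close> at \<open>x\<close>
  lets \<open>e\<close> tend to 0.\<close>

lemma not_steep_bound:
  fixes g :: "real \<Rightarrow> real"
  assumes cont: "isCont g x" and x: "x \<notin> steep g q"
  obtains d where "0 < d" "\<And>y. x \<le> y \<Longrightarrow> y < x + d \<Longrightarrow> g y - g x \<le> q * (y - x)"
    "\<And>y. y \<le> x \<Longrightarrow> x - d < y \<Longrightarrow> g x - g y \<le> q * (x - y)"
proof -
  obtain d where d: "0 < d"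
      and *: "\<And>a r. 0 < r \<Longrightarrow> r < d \<Longrightarrow> x \<in> ball a r \<Longrightarrow> g (a + r) - g (a - r) \<le> 2 * q * r"
    using x steepI[of x q g] by (metis linorder_not_less)
  have **: "g v - g u \<le> q * (v - u)" if "u < x" "x < v" "v < u + d" for u v
  proof -
    define a r where "a = (u + v) / 2" and "r = (v - u) / 2"
    have eq: "a + r = v" "a - r = u" by (simp_all add: a_def r_def field_simps)
    have "x \<in> ball a r" unfolding ball_eq_greaterThanLessThan eq using that by simp
    moreover have "0 < r" "r < d" using that by (simp_all add: r_def)
    ultimately have "g (a + r) - g (a - r) \<le> 2 * q * r" by (rule *[rotated 2])
    moreover have "2 * q * r = q * (v - u)" by (simp add: r_def)
    ultimately show ?thesis by (simp add: eq)
  qed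
  have lim: "((\<lambda>e. g (x - e)) \<longlongrightarrow> g x) (at_right 0)" "((\<lambda>e. g (x + e)) \<longlongrightarrow> g x) (at_right 0)"
    by (rule isCont_tendsto_compose[OF cont], (rule tendsto_eq_intros | simp)+)+
  show thesis
  proof (rule that[OF d])
    fix y assume y: "x \<le> y" "y < x + d"
    show "g y - g x \<le> q * (y - x)"
    proof (cases "y = x")
      case False
      have "((\<lambda>e. q * (y - (x - e)) - (g y - g (x - e))) \<longlongrightarrow> q * (y - (x - 0)) - (g y - g x)) (at_right 0)"
        by (intro tendsto_intros lim)
      moreover have "\<forall>\<^sub>F e in at_right 0. 0 \<le> q * (y - (x - e)) - (g y - g (x - e))"
        unfolding eventually_at_right_field
        using y False by (intro exI[of _ "x + d - y"]) (auto intro!: **)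
      ultimately show ?thesis
        using tendsto_lowerbound[of _ _ "at_right (0::real)" 0] by fastforce
    qed simp
  next
    fix y assume y: "y \<le> x" "x - d < y"
    show "g x - g y \<le> q * (x - y)"
    proof (cases "y = x")
      case False
      have "((\<lambda>e. q * ((x + e) - y) - (g (x + e) - g y)) \<longlongrightarrow> q * ((x + 0) - y) - (g x - g y)) (at_right 0)"
        by (intro tendsto_intros lim)
      moreover have "\<forall>\<^sub>F e in at_right 0. 0 \<le> q * ((x + e) - y) - (g (x + e) - g y)"
        unfolding eventually_at_right_field
        using y False by (intro exI[of _ "d - x + y"]) (auto intro!: **)
      ultimately show ?thesis
        using tendsto_lowerbound[of _ _ "at_right (0::real)" 0] by fastforce
    qed simp
  qed
qed

text \<open>The derivative is the infimum \<open>D\<close> of the positive slopes at which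
  \<open>x\<close> is not steep. Slopes close to \<open>D\<close> in this set bound chords from
  above. From below, either \<open>D - e\<close> is nonpositive and monotonicity suffices, or
  \<open>x\<close> is steep for a slope below \<open>D\<close> and the gap hypothesis turns this
  into a lower bound for chords.\<close>

lemma mono_differentiable_if_not_steep:
  fixes g :: "real \<Rightarrow> real"
  assumes g: "mono g" and cont: "isCont g x" and k: "x \<notin> steep g (real (Suc k))"
    and pq: "\<And>p q. p \<in> \<rat> \<Longrightarrow> q \<in> \<rat> \<Longrightarrow> 0 < p \<Longrightarrow> p < q \<Longrightarrow> x \<notin> steep g q \<or> x \<notin> steep (\<lambda>x. - g x) (- p)"
  shows "g differentiable (at x)"
proof -
  define S where "S = {q. 0 < q \<and> x \<notin> steep g q}"
  define D where "D = Inf S"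
  have ne: "S \<noteq> {}" using k by (auto simp: S_def intro!: exI[of _ "real (Suc k)"])
  have bdd: "bdd_below S" by (rule bdd_belowI[of _ 0]) (auto simp: S_def)
  have D0: "0 \<le> D" unfolding D_def by (rule cInf_greatest[OF ne]) (auto simp: S_def)
  have "(g has_derivative (\<lambda>h. D * h)) (at x)"
    unfolding has_derivative_within_alt
  proof (intro conjI allI impI)
    show "bounded_linear (\<lambda>h. D * h)" by (rule bounded_linear_mult_right)
    fix e :: real assume e: "0 < e"
    obtain q where q: "q < D + e" "x \<notin> steep g q"
      using cInf_lessD[OF ne, of "D + e"] e by (auto simp: S_def D_def)
    obtain d1 where d1: "0 < d1" "\<And>y. x \<le> y \<Longrightarrow> y < x + d1 \<Longrightarrow> g y - g x \<le> q * (y - x)"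
      "\<And>y. y \<le> x \<Longrightarrow> x - d1 < y \<Longrightarrow> g x - g y \<le> q * (x - y)"
      by (rule not_steep_bound[OF cont q(2)]) blast
    have "\<exists>d2>0. (\<forall>y. x \<le> y \<and> y < x + d2 \<longrightarrow> (D - e) * (y - x) \<le> g y - g x) \<and>
       (\<forall>y. y \<le> x \<and> x - d2 < y \<longrightarrow> (D - e) * (x - y) \<le> g x - g y)"
    proof (cases "D \<le> e")
      case True
      have "(D - e) * (v - u) \<le> g v - g u" if "u \<le> v" for u v
        using True that g mult_nonpos_nonneg[of "D - e" "v - u"] by (auto simp: mono_def) (smt (verit))
      then show ?thesis by (intro exI[of _ 1]) auto
    next
      case False
      \<comment> \<open>Two rationals are needed: steepness holds at \<open>p'\<close>, below the
        infimum, and the gap hypothesis compares it only with a strictly smaller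
        \<open>p\<close>.\<close>
      obtain p' where p': "p' \<in> \<rat>" "D - e < p'" "p' < D" using Rats_dense_in_real[of "D - e" D] e by auto
      obtain p where p: "p \<in> \<rat>" "D - e < p" "p < p'" using Rats_dense_in_real[of "D - e" p'] p' by auto
      have "p' \<notin> S" using cInf_lower[OF _ bdd, of p'] p' by (auto simp: D_def)
      then have "x \<in> steep g p'" using False p' by (auto simp: S_def)
      then have ns: "x \<notin> steep (\<lambda>x. - g x) (- p)" using pq[of p p'] p p' False by auto
      have cont': "isCont (\<lambda>x. - g x) x" using cont by (intro continuous_intros)
      obtain d2 where d2: "0 < d2" "\<And>y. x \<le> y \<Longrightarrow> y < x + d2 \<Longrightarrow> - g y - - g x \<le> - p * (y - x)"
        "\<And>y. y \<le> x \<Longrightarrow> x - d2 < y \<Longrightarrow> - g x - - g y \<le> - p * (x - y)"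
        by (rule not_steep_bound[OF cont' ns]) blast
      have "(D - e) * (y - x) \<le> p * (y - x)" if "x \<le> y" for y using p that by (intro mult_right_mono) auto
      moreover have "(D - e) * (x - y) \<le> p * (x - y)" if "y \<le> x" for y using p that by (intro mult_right_mono) auto
      ultimately show ?thesis using d2 by (intro exI[of _ d2]) fastforce
    qed
    then obtain d2 where d2: "0 < d2" "\<And>y. x \<le> y \<Longrightarrow> y < x + d2 \<Longrightarrow> (D - e) * (y - x) \<le> g y - g x"
       "\<And>y. y \<le> x \<Longrightarrow> x - d2 < y \<Longrightarrow> (D - e) * (x - y) \<le> g x - g y" by blast
    show "\<exists>d>0. \<forall>y\<in>UNIV. norm (y - x) < d \<longrightarrow> norm (g y - g x - D * (y - x)) \<le> e * norm (y - x)"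
    proof (intro exI[of _ "min d1 d2"] conjI ballI impI)
      show "0 < min d1 d2" using d1(1) d2(1) by simp
      fix y assume y: "norm (y - x) < min d1 d2"
      show "norm (g y - g x - D * (y - x)) \<le> e * norm (y - x)"
      proof (cases "x \<le> y")
        case True
        have "q * (y - x) \<le> (D + e) * (y - x)" using q True by (intro mult_right_mono) auto
        then have "g y - g x \<le> (D + e) * (y - x)" using d1(2)[of y] True y by auto
        moreover have "(D - e) * (y - x) \<le> g y - g x" using d2(2)[of y] True y by auto
        ultimately show ?thesis using True by (simp add: algebra_simps abs_le_iff)
      next
        case False
        have "q * (x - y) \<le> (D + e) * (x - y)" using q False by (intro mult_right_mono) auto
        then have "g x - g y \<le> (D + e) * (x - y)" using order_trans[OF d1(3)[of y]] False y by auto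
        moreover have "(D - e) * (x - y) \<le> g x - g y" using d2(3)[of y] False y by auto
        ultimately show ?thesis using False by (simp add: algebra_simps abs_le_iff)
      qed
    qed
  qed
  then show ?thesis unfolding differentiable_def by blast
qed

lemma mono_differentiable_ae:
  fixes g :: "real \<Rightarrow> real"
  assumes g: "mono g"
  shows "negligible {x\<in>{s<..<t}. \<not> g differentiable (at x)}"
proof -
  let ?I = "{s<..<t}"
  define A where "A = {x. \<not> isCont g x}"
  define B where "B = (\<Inter>k::nat. steep g (real (Suc k))) \<inter> ?I"
  define R where "R = {(p, q). p \<in> \<rat> \<and> q \<in> \<rat> \<and> 0 < p \<and> p < (q::real)}"
  define C where "C = (\<Union>(p, q)\<in>R. steep g q \<inter> steep (\<lambda>x. - g x) (- p) \<inter> ?I)"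
  have "countable R" unfolding R_def
    by (rule countable_subset[of _ "\<rat> \<times> \<rat>"]) (auto intro!: countable_SIGMA countable_rat)
  then have "negligible C" unfolding C_def
    by (intro negligible_countable_Union) (auto simp: R_def intro!: negligible_steep_gap[OF g])
  moreover have "negligible A" unfolding A_def
    using countable_imp_null_set_lborel[OF mono_ctble_discont[OF g]]
    by (auto simp: negligible_iff_null_sets intro: null_sets_completionI)
  moreover have "negligible B" unfolding B_def by (rule negligible_steep_all[OF g])
  moreover have "{x\<in>?I. \<not> g differentiable (at x)} \<subseteq> A \<union> B \<union> C"
  proof
    fix x assume x: "x \<in> {x\<in>?I. \<not> g differentiable (at x)}"
    show "x \<in> A \<union> B \<union> C"
    proof (rule ccontr)
      assume n: "x \<notin> A \<union> B \<union> C"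
      then have "isCont g x" by (simp add: A_def)
      moreover obtain k where "x \<notin> steep g (real (Suc k))" using n x by (auto simp: B_def)
      ultimately have "g differentiable (at x)"
      proof (rule mono_differentiable_if_not_steep[OF g])
        fix p q :: real assume "p \<in> \<rat>" "q \<in> \<rat>" "0 < p" "p < q"
        then have "(p, q) \<in> R" by (simp add: R_def)
        then show "x \<notin> steep g q \<or> x \<notin> steep (\<lambda>x. - g x) (- p)" using n x by (auto simp: C_def)
      qed
      with x show False by simp
    qed
  qed
  ultimately show ?thesis by (meson negligible_Un negligible_subset)
qed



subsection \<open>Absolutely continuous functions\<close>

text \<open>Only the open intervals are disjoint: neighbours may share endpoints, so cells of a
  partition or of a tagged division qualify, and degenerate pairs are allowed.\<close>

definition intervals :: "real \<Rightarrow> real \<Rightarrow> (real \<times> real) set \<Rightarrow> bool" where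
  "intervals a b I \<longleftrightarrow> finite I \<and> (\<forall>(s, t)\<in>I. a \<le> s \<and> s \<le> t \<and> t \<le> b) \<and>
     disjoint_family_on (\<lambda>(s, t). {s<..<t}) I"

lemma intervalsD:
  assumes "intervals a b I"
  shows "finite I" "(s, t) \<in> I \<Longrightarrow> a \<le> s" "(s, t) \<in> I \<Longrightarrow> s \<le> t" "(s, t) \<in> I \<Longrightarrow> t \<le> b"
    "disjoint_family_on (\<lambda>(s, t). {s<..<t}) I"
  using assms by (auto simp: intervals_def)

lemma abs_continuous_on_alt:
  "abs_continuous_on a b f \<longleftrightarrow>
     (\<forall>\<epsilon>>0. \<exists>\<delta>>0. \<forall>I. intervals a b I \<and> (\<Sum>(s, t)\<in>I. t - s) < \<delta> \<longrightarrow> (\<Sum>(s, t)\<in>I. dist (f s) (f t)) < \<epsilon>)"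
  unfolding abs_continuous_on_def intervals_def by (simp add: conj_assoc)

lemma abs_continuous_onD:
  assumes "abs_continuous_on a b f" "0 < e"
  obtains d where "0 < d"
    "\<And>I. intervals a b I \<Longrightarrow> (\<Sum>(s, t)\<in>I. t - s) < d \<Longrightarrow> (\<Sum>(s, t)\<in>I. dist (f s) (f t)) < e"
  using assms unfolding abs_continuous_on_alt by metis

lemma intervals_mono: "intervals a b I \<Longrightarrow> c \<le> a \<Longrightarrow> b \<le> d \<Longrightarrow> intervals c d I"
  by (force simp: intervals_def)

lemma intervals_single: "a \<le> s \<Longrightarrow> s \<le> t \<Longrightarrow> t \<le> b \<Longrightarrow> intervals a b {(s, t)}"
  by (auto simp: intervals_def disjoint_family_on_def)

lemma abs_continuous_on_subinterval:
  assumes "abs_continuous_on a b f" "a \<le> c" "d \<le> b"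
  shows "abs_continuous_on c d f"
  unfolding abs_continuous_on_alt
proof (intro allI impI)
  fix e :: real assume "0 < e"
  then obtain \<delta> where "0 < \<delta>"
      "\<And>I. intervals a b I \<Longrightarrow> (\<Sum>(s, t)\<in>I. t - s) < \<delta> \<Longrightarrow> (\<Sum>(s, t)\<in>I. dist (f s) (f t)) < e"
    by (rule abs_continuous_onD[OF assms(1)]) blast
  then show "\<exists>\<delta>>0. \<forall>I. intervals c d I \<and> (\<Sum>(s, t)\<in>I. t - s) < \<delta> \<longrightarrow> (\<Sum>(s, t)\<in>I. dist (f s) (f t)) < e"
    using intervals_mono[OF _ assms(2,3)] by blast
qed

lemma abs_continuous_on_dist_le:
  assumes f: "abs_continuous_on a b f"
    and le: "\<And>s t. a \<le> s \<Longrightarrow> s \<le> t \<Longrightarrow> t \<le> b \<Longrightarrow> dist (g s) (g t) \<le> dist (f s) (f t)"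
  shows "abs_continuous_on a b g"
  unfolding abs_continuous_on_alt
proof (intro allI impI)
  fix e :: real assume "0 < e"
  then obtain \<delta> where d: "0 < \<delta>"
      "\<And>I. intervals a b I \<Longrightarrow> (\<Sum>(s, t)\<in>I. t - s) < \<delta> \<Longrightarrow> (\<Sum>(s, t)\<in>I. dist (f s) (f t)) < e"
    by (rule abs_continuous_onD[OF f]) blast
  have "(\<Sum>(s, t)\<in>I. dist (g s) (g t)) \<le> (\<Sum>(s, t)\<in>I. dist (f s) (f t))" if "intervals a b I" for I
    using intervalsD[OF that] by (intro sum_mono) (auto intro!: le)
  then show "\<exists>\<delta>>0. \<forall>I. intervals a b I \<and> (\<Sum>(s, t)\<in>I. t - s) < \<delta> \<longrightarrow> (\<Sum>(s, t)\<in>I. dist (g s) (g t)) < e"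
    using d by (intro exI[of _ \<delta>]) (meson le_less_trans)
qed

lemma abs_continuous_on_imp_continuous_on:
  assumes "abs_continuous_on a b f"
  shows "continuous_on {a..b} f"
  unfolding continuous_on_iff
proof (intro ballI allI impI)
  fix x e :: real assume x: "x \<in> {a..b}" and e: "0 < e"
  obtain \<delta> where d: "0 < \<delta>"
      "\<And>I. intervals a b I \<Longrightarrow> (\<Sum>(s, t)\<in>I. t - s) < \<delta> \<Longrightarrow> (\<Sum>(s, t)\<in>I. dist (f s) (f t)) < e"
    by (rule abs_continuous_onD[OF assms e]) blast
  have "dist (f y) (f x) < e" if y: "y \<in> {a..b}" "dist y x < \<delta>" for y
  proof (cases "x \<le> y")
    case True
    then show ?thesis using d(2)[OF intervals_single[of a x y b]] x y by (auto simp: dist_real_def dist_commute)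
  next
    case False
    then show ?thesis using d(2)[OF intervals_single[of a y x b]] x y by (auto simp: dist_real_def)
  qed
  then show "\<exists>d>0. \<forall>x'\<in>{a..b}. dist x' x < d \<longrightarrow> dist (f x') (f x) < e" using d(1) by blast
qed

lemma intervals_sum_le_measure:
  assumes I: "intervals a b I" and U: "U \<in> lmeasurable" "\<And>s t. (s, t) \<in> I \<Longrightarrow> {s<..<t} \<subseteq> U"
  shows "(\<Sum>(s, t)\<in>I. t - s) \<le> measure lebesgue U"
proof -
  have "(\<Sum>(s, t)\<in>I. t - s) = (\<Sum>i\<in>I. measure lebesgue (case i of (s, t) \<Rightarrow> {s<..<t}))"
    using intervalsD(3)[OF I] by (intro sum.cong) auto
  also have "\<dots> = measure lebesgue (\<Union>i\<in>I. case i of (s, t) \<Rightarrow> {s<..<t})"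
    using intervalsD(1,3,5)[OF I] by (intro measure_finite_Union[symmetric]) (auto split: prod.splits)
  also have "\<dots> \<le> measure lebesgue U"
    using U by (intro measure_mono_fmeasurable) (auto intro!: sets.finite_UN intervalsD(1)[OF I] split: prod.splits)
  finally show ?thesis .
qed

lemma intervals_sum_le:
  assumes I: "intervals a b I" and "a \<le> b"
  shows "(\<Sum>(s, t)\<in>I. t - s) \<le> b - a"
proof -
  have "(\<Sum>(s, t)\<in>I. t - s) \<le> measure lebesgue {a..b}"
    by (rule intervals_sum_le_measure[OF I]) (use intervalsD[OF I] in fastforce)+
  then show ?thesis using \<open>a \<le> b\<close> by simp
qed

lemma intervals_insert:
  assumes I: "intervals a x I" and "a \<le> x" "x < y"
  shows "intervals a y (insert (x, y) I)" "(x, y) \<notin> I"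
  using assms unfolding intervals_def disjoint_family_on_def by fastforce+

section \<open>Absolutely continuous functions: almost everywhere differentiable, and primitives of
  their derivatives\<close>

text \<open>Jordan decomposition: the variation \<open>V\<close> from \<open>c\<close> grows by at
  least the distance of the values of \<open>f\<close>, so \<open>V\<close> and \<open>V - f\<close>
  are both increasing and \<open>f\<close> is their difference.\<close>

lemma bounded_variation_differentiable_ae:
  fixes f :: "real \<Rightarrow> real"
  assumes B: "\<And>I. intervals c d I \<Longrightarrow> (\<Sum>(s, t)\<in>I. dist (f s) (f t)) \<le> B"
  shows "negligible {x\<in>{c<..<d}. \<not> f differentiable (at x)}"
proof (cases "c < d")
  case cd: True
  define S where "S = (\<lambda>I. \<Sum>(s, t)\<in>I. dist (f s) (f t))"
  define V where "V x = (SUP I\<in>{I. intervals c x I}. S I)" for x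
  have bdd: "bdd_above (S ` {I. intervals c x I})" if "x \<le> d" for x
    using B intervals_mono[OF _ order_refl that] by (auto simp: S_def intro!: bdd_aboveI[of _ B])
  have ne: "{I. intervals c x I} \<noteq> {}" for x
    by (auto simp: intervals_def disjoint_family_on_def intro!: exI[of _ "{}"])
  have V: "V x + dist (f x) (f y) \<le> V y" if xy: "c \<le> x" "x \<le> y" "y \<le> d" for x y
  proof (cases "x = y")
    case False
    then have "x < y" using xy by simp
    have "V x \<le> V y - dist (f x) (f y)"
      unfolding V_def
    proof (rule cSUP_least[OF ne])
      fix I assume "I \<in> {I. intervals c x I}"
      then have I: "intervals c x I" by simp
      have "S I + dist (f x) (f y) = S (insert (x, y) I)"
        using intervals_insert(2)[OF I xy(1) \<open>x < y\<close>] intervalsD(1)[OF I] by (simp add: S_def)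
      also have "\<dots> \<le> (SUP I\<in>{I. intervals c y I}. S I)"
        using intervals_insert(1)[OF I xy(1) \<open>x < y\<close>] by (intro cSUP_upper bdd xy) simp
      finally show "S I \<le> (SUP I\<in>{I. intervals c y I}. S I) - dist (f x) (f y)" by simp
    qed
    then show ?thesis by simp
  qed simp
  \<comment> \<open>Clamping to [c, d] extends both functions monotonically to the whole line and
    changes nothing near interior points.\<close>
  define k where "k x = max c (min d x)" for x
  have k: "c \<le> k x" "k x \<le> d" "x \<le> y \<Longrightarrow> k x \<le> k y" for x y using cd by (auto simp: k_def)
  define g h where "g x = V (k x)" and "h x = V (k x) - f (k x)" for x
  have mono: "mono g" "mono h"
  proof -
    have *: "V (k x) + dist (f (k x)) (f (k y)) \<le> V (k y)" if "x \<le> y" for x y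
      using V k that by simp
    show "mono g" by (rule monoI) (use * zero_le_dist g_def in \<open>smt (verit)\<close>)
    show "mono h" by (rule monoI) (use * in \<open>fastforce simp: h_def dist_real_def\<close>)
  qed
  have "{x\<in>{c<..<d}. \<not> f differentiable (at x)} \<subseteq>
      {x\<in>{c<..<d}. \<not> g differentiable (at x)} \<union> {x\<in>{c<..<d}. \<not> h differentiable (at x)}"
  proof
    fix x assume x: "x \<in> {x\<in>{c<..<d}. \<not> f differentiable (at x)}"
    have "f differentiable (at x)" if "g differentiable (at x)" "h differentiable (at x)"
    proof (rule differentiable_transform_within)
      show "(\<lambda>x. g x - h x) differentiable (at x)" using that by (rule differentiable_diff)
      show "0 < min (x - c) (d - x)" using x by simp
      fix y assume "dist y x < min (x - c) (d - x)"
      then have "k y = y" by (auto simp: k_def dist_real_def)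
      then show "g y - h y = f y" by (simp add: g_def h_def)
    qed simp
    with x show "x \<in> {x\<in>{c<..<d}. \<not> g differentiable (at x)} \<union> {x\<in>{c<..<d}. \<not> h differentiable (at x)}"
      by blast
  qed
  then show ?thesis
    using mono_differentiable_ae[OF mono(1), of c d] mono_differentiable_ae[OF mono(2), of c d]
    by (meson negligible_Un negligible_subset)
qed auto

text \<open>Absolute continuity bounds the variation only over short intervals, so negligibility is
  shown locally. With radius \<delta> / 3 every family inside \<open>{u..v}\<close> has total length
  below \<delta>, hence variation below 1.\<close>

lemma abs_continuous_differentiable_ae_real:
  fixes f :: "real \<Rightarrow> real"
  assumes f: "abs_continuous_on a b f"
  shows "negligible {x\<in>{a<..<b}. \<not> f differentiable (at x)}" (is "negligible ?N")
  unfolding locally_negligible_alt[of ?N]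
proof
  fix x assume x: "x \<in> ?N"
  obtain \<delta> where d: "0 < \<delta>"
      "\<And>I. intervals a b I \<Longrightarrow> (\<Sum>(s, t)\<in>I. t - s) < \<delta> \<Longrightarrow> (\<Sum>(s, t)\<in>I. dist (f s) (f t)) < 1"
    by (rule abs_continuous_onD[OF f zero_less_one]) blast
  define u v where "u = max a (x - \<delta> / 3)" and "v = min b (x + \<delta> / 3)"
  have uv: "a \<le> u" "u < x" "x < v" "v \<le> b" "v - u < \<delta>" using x d(1) by (auto simp: u_def v_def)
  have "negligible {x\<in>{u<..<v}. \<not> f differentiable (at x)}"
  proof (rule bounded_variation_differentiable_ae)
    fix I assume I: "intervals u v I"
    then have "(\<Sum>(s, t)\<in>I. t - s) < \<delta>" using intervals_sum_le[OF I] uv by simp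
    then show "(\<Sum>(s, t)\<in>I. dist (f s) (f t)) \<le> 1"
      using d(2)[OF intervals_mono[OF I uv(1,4)]] by simp
  qed
  then have "negligible (?N \<inter> {u<..<v})" by (rule negligible_subset) auto
  then show "\<exists>U. openin (top_of_set ?N) U \<and> x \<in> U \<and> negligible U"
    using x uv by (intro exI[of _ "?N \<inter> {u<..<v}"]) auto
qed

lemma abs_continuous_differentiable_ae:
  fixes f :: "real \<Rightarrow> 'a::euclidean_space"
  assumes f: "abs_continuous_on a b f"
  shows "negligible {x\<in>{a..b}. \<not> f differentiable (at x)}"
proof -
  have "abs_continuous_on a b (\<lambda>x. f x \<bullet> i)" if "i \<in> Basis" for i
    by (rule abs_continuous_on_dist_le[OF f])
      (simp add: dist_norm inner_diff_left[symmetric] Basis_le_norm[OF that])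
  then have "negligible ({a, b} \<union> (\<Union>i\<in>Basis. {x\<in>{a<..<b}. \<not> (\<lambda>x. f x \<bullet> i) differentiable (at x)}))"
    using abs_continuous_differentiable_ae_real
    by (intro negligible_Un negligible_Union) (auto simp del: greaterThanLessThan_iff)
  then show ?thesis
    by (rule negligible_subset) (auto simp: differentiable_componentwise_within[of f])
qed

text \<open>On the exceptional null set the gauge stays inside an open set of small measure, so that
  absolute continuity absorbs the increments over the intervals tagged there.\<close>

lemma abs_continuous_has_integral:
  fixes f :: "real \<Rightarrow> 'a::euclidean_space"
  assumes ab: "a < b" and f: "abs_continuous_on a b f" and N: "negligible N"
    and f': "\<And>x. x \<in> {a..b} - N \<Longrightarrow> (f has_vector_derivative f' x) (at x within {a..b})"
  shows "(f' has_integral f b - f a) {a..b}"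
proof -
  \<comment> \<open>With value 0 on \<open>N\<close>, intervals tagged there enter the error only
    through increments of \<open>f\<close>.\<close>
  define g where "g x = (if x \<in> N then 0 else f' x)" for x
  have "(g has_integral f b - f a) {a..b}"
    unfolding has_integral_real
  proof (intro allI impI)
    fix e :: real assume e: "0 < e"
    \<comment> \<open>Tags off \<open>N\<close> contribute at most \<open>e' * (b - a)\<close>,
      which is e/4, and those in \<open>N\<close> less than e/4.\<close>
    define e' where "e' = e / (4 * (b - a))"
    have e': "0 < e'" using e ab by (simp add: e'_def)
    obtain \<delta> where d: "0 < \<delta>"
        "\<And>I. intervals a b I \<Longrightarrow> (\<Sum>(s, t)\<in>I. t - s) < \<delta> \<Longrightarrow> (\<Sum>(s, t)\<in>I. dist (f s) (f t)) < e / 4"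
      by (rule abs_continuous_onD[OF f, of "e / 4"]) (use e in auto)
    obtain U where U: "open U" "N \<subseteq> U" "U \<in> lmeasurable" "measure lebesgue U < \<delta>"
      using lmeasurable_outer_open[of N \<delta>] N d(1) by (auto simp: negligible_iff_measure)
    have "\<exists>r>0. if x \<in> N then ball x r \<subseteq> U
        else x \<in> {a..b} \<longrightarrow> (\<forall>y\<in>{a..b}. norm (y - x) < r \<longrightarrow> norm (f y - f x - (y - x) *\<^sub>R f' x) \<le> e' * norm (y - x))" for x
    proof (cases "x \<in> N")
      case True
      then show ?thesis using U(1,2) openE by (metis subsetD)
    next
      case False
      show ?thesis
      proof (cases "x \<in> {a..b}")
        case True
        have "(f has_derivative (\<lambda>h. h *\<^sub>R f' x)) (at x within {a..b})"
          using f'[of x] True False by (simp add: has_vector_derivative_def)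
        then show ?thesis using False e' unfolding has_derivative_within_alt by auto
      qed (use False in \<open>auto intro: exI[of _ 1]\<close>)
    qed
    then obtain r where r: "\<And>x. 0 < r x" and rN: "\<And>x. x \<in> N \<Longrightarrow> ball x (r x) \<subseteq> U"
      and rD: "\<And>x y. x \<notin> N \<Longrightarrow> x \<in> {a..b} \<Longrightarrow> y \<in> {a..b} \<Longrightarrow> norm (y - x) < r x \<Longrightarrow>
        norm (f y - f x - (y - x) *\<^sub>R f' x) \<le> e' * norm (y - x)"
      by metis
    show "\<exists>\<gamma>. gauge \<gamma> \<and> (\<forall>\<D>. \<D> tagged_division_of {a..b} \<and> \<gamma> fine \<D> \<longrightarrow>
        norm ((\<Sum>(x, k)\<in>\<D>. measure lborel k *\<^sub>R g x) - (f b - f a)) < e)"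
    proof (intro exI conjI allI impI)
      show "gauge (\<lambda>x. ball x (r x))" using r by (simp add: gauge_ball_dependent)
      fix p assume "p tagged_division_of {a..b} \<and> (\<lambda>x. ball x (r x)) fine p"
      then have p: "p tagged_division_of {a..b}" and fine: "\<And>x k. (x, k) \<in> p \<Longrightarrow> k \<subseteq> ball x (r x)"
        by (auto simp: fine_def)
      have fin: "finite p" using p by blast
      have k: "\<exists>u v. k = {u..v} \<and> u \<le> x \<and> x \<le> v \<and> a \<le> u \<and> v \<le> b" if xk: "(x, k) \<in> p" for x k
      proof -
        obtain u v where uv: "k = cbox u v" using tagged_division_ofD(4)[OF p xk] by blast
        have "x \<in> k" "k \<subseteq> {a..b}" using tagged_division_ofD(2,3)[OF p xk] by auto
        then show ?thesis using uv by (intro exI[of _ u] exI[of _ v]) auto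
      qed
      let ?D = "\<lambda>k. f (Sup k) - f (Inf k)"
      define q where "q = {(x, k). (x, k) \<in> p \<and> x \<in> N}"
      have q: "q \<subseteq> p" by (auto simp: q_def)
      define h where "h = (\<lambda>(x::real, k::real set). (Inf k, Sup k))"
      have hI: "intervals a b (h ` q)"
        unfolding intervals_def
      proof (intro conjI ballI)
        show "finite (h ` q)" using fin q by (meson finite_imageI finite_subset)
        show "case z of (s, t) \<Rightarrow> a \<le> s \<and> s \<le> t \<and> t \<le> b" if "z \<in> h ` q" for z
          using that k q by (fastforce simp: h_def)
        show "disjoint_family_on (\<lambda>(s, t). {s<..<t}) (h ` q)"
          unfolding disjoint_family_on_def
        proof (intro ballI impI)
          fix z w assume "z \<in> h ` q" "w \<in> h ` q" and ne: "z \<noteq> w"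
          then obtain x k1 y k2 where "(x, k1) \<in> q" "z = h (x, k1)" "(y, k2) \<in> q" "w = h (y, k2)"
            by (metis imageE surj_pair)
          then have *: "(x, k1) \<in> p" "z = h (x, k1)" "(y, k2) \<in> p" "w = h (y, k2)"
            using q by auto
          then have "interior k1 \<inter> interior k2 = {}"
            using tagged_division_ofD(5)[OF p *(1,3)] ne by auto
          moreover obtain u v u' v' where "k1 = {u..v}" "u \<le> v" "k2 = {u'..v'}" "u' \<le> v'"
            using k[OF *(1)] k[OF *(3)] by fastforce
          ultimately show "(case z of (s, t) \<Rightarrow> {s<..<t}) \<inter> (case w of (s, t) \<Rightarrow> {s<..<t}) = {}"
            using * by (simp add: h_def)
        qed
      qed
      have "(\<Sum>(s, t)\<in>h ` q. t - s) \<le> measure lebesgue U"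
      proof (rule intervals_sum_le_measure[OF hI U(3)])
        fix s t assume "(s, t) \<in> h ` q"
        then obtain x l where *: "(x, l) \<in> p" "x \<in> N" "s = Inf l" "t = Sup l" by (auto simp: h_def q_def)
        obtain u v where uv: "l = {u..v}" "u \<le> x" "x \<le> v" using k[OF *(1)] by blast
        have "{s<..<t} \<subseteq> l" using * uv by auto
        then show "{s<..<t} \<subseteq> U" using fine[OF *(1)] rN[OF *(2)] by blast
      qed
      then have small: "(\<Sum>(s, t)\<in>h ` q. dist (f s) (f t)) < e / 4"
        using d(2)[OF hI] U(4) by simp
      have "(\<Sum>(s, t)\<in>h ` q. dist (f s) (f t)) = (\<Sum>z\<in>q. case h z of (s, t) \<Rightarrow> dist (f s) (f t))"
      \<comment> \<open>Two members of the division with equal endpoints have disjoint interiors, so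
        \<open>h\<close> can identify only degenerate intervals, whose increments are 0.\<close>
      proof (rule sum.reindex_nontrivial[unfolded o_def])
        show "finite q" using fin q finite_subset by blast
        fix z w assume zw: "z \<in> q" "w \<in> q" "z \<noteq> w" "h z = h w"
        obtain x k1 y k2 where *: "(x, k1) \<in> p" "z = (x, k1)" "(y, k2) \<in> p" "w = (y, k2)"
          using q zw(1,2) by (cases z, cases w) auto
        obtain u v u' v' where uv: "k1 = {u..v}" "u \<le> v" "k2 = {u'..v'}" "u' \<le> v'"
          using k[OF *(1)] k[OF *(3)] by fastforce
        then have "k1 = k2" using zw(4) * by (simp add: h_def)
        then have "interior k1 = {}" using tagged_division_ofD(5)[OF p *(1,3)] zw(3) * by auto
        then have "u = v" using uv by auto
        then show "(case h z of (s, t) \<Rightarrow> dist (f s) (f t)) = 0" using * uv by (simp add: h_def)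
      qed
      also have "\<dots> = (\<Sum>(x, k)\<in>q. norm (?D k))"
        by (intro sum.cong) (auto simp: h_def dist_norm norm_minus_commute)
      finally have small': "(\<Sum>(x, k)\<in>q. norm (?D k)) < e / 4" using small by simp
      have "(\<Sum>(x, k)\<in>p. measure lborel k *\<^sub>R g x) - (f b - f a) = (\<Sum>(x, k)\<in>p. measure lborel k *\<^sub>R g x - ?D k)"
        using additive_tagged_division_1[OF _ p, of f] ab by (simp add: sum_subtractf split_beta)
      also have "norm \<dots> \<le> (\<Sum>(x, k)\<in>p. norm (measure lborel k *\<^sub>R g x - ?D k))"
        by (rule order_trans[OF norm_sum]) (simp add: split_beta)
      also have "\<dots> \<le> (\<Sum>(x, k)\<in>p. e' * measure lborel k + (if x \<in> N then norm (?D k) else 0))"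
      proof (rule sum_mono)
        fix z assume z: "z \<in> p"
        obtain x l where xl: "z = (x, l)" by (cases z)
        obtain u v where uv: "l = {u..v}" "u \<le> x" "x \<le> v" "a \<le> u" "v \<le> b" using k z xl by blast
        have "norm (measure lborel l *\<^sub>R g x - ?D l) \<le> e' * measure lborel l + (if x \<in> N then norm (?D l) else 0)"
        proof (cases "x \<in> N")
          case True
          then show ?thesis using e' by (simp add: g_def norm_minus_commute)
        next
          case False
          have "u \<in> l" "v \<in> l" using uv by auto
          then have "norm (u - x) < r x" "norm (v - x) < r x"
            using fine[of x l] z xl by (auto simp: dist_norm norm_minus_commute)
          then have 1: "norm (f u - f x - (u - x) *\<^sub>R f' x) \<le> e' * norm (u - x)"
              "norm (f v - f x - (v - x) *\<^sub>R f' x) \<le> e' * norm (v - x)"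
            using rD[OF False, of u] rD[OF False, of v] uv by auto
          \<comment> \<open>The errors at both endpoints are measured from the tag \<open>x\<close>;
            their bounds add up because the tag lies between the endpoints.\<close>
          have "measure lborel l *\<^sub>R g x - ?D l = (f u - f x - (u - x) *\<^sub>R f' x) - (f v - f x - (v - x) *\<^sub>R f' x)"
            using uv False by (simp add: g_def algebra_simps)
          also have "norm \<dots> \<le> e' * norm (u - x) + e' * norm (v - x)"
            using 1 norm_triangle_ineq4 by (smt (verit))
          also have "\<dots> = e' * measure lborel l" using uv by (simp add: algebra_simps)
          finally show ?thesis using False by simp
        qed
        then show "(case z of (x, k) \<Rightarrow> norm (measure lborel k *\<^sub>R g x - ?D k)) \<le>
          (case z of (x, k) \<Rightarrow> e' * measure lborel k + (if x \<in> N then norm (?D k) else 0))" by (simp add: xl)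
      qed
      also have "\<dots> = e' * (\<Sum>(x, k)\<in>p. measure lborel k) + (\<Sum>(x, k)\<in>p. if x \<in> N then norm (?D k) else 0)"
        by (simp add: sum.distrib sum_distrib_left split_beta)
      also have "(\<Sum>(x, k)\<in>p. measure lborel k) = b - a"
        using additive_content_tagged_division[of p a b] p ab by simp
      also have "(\<Sum>(x, k)\<in>p. if x \<in> N then norm (?D k) else 0) = (\<Sum>(x, k)\<in>q. norm (?D k))"
        by (rule sum.mono_neutral_cong_right) (use fin q in \<open>auto simp: q_def split: if_splits\<close>)
      also have "e' * (b - a) + (\<Sum>(x, k)\<in>q. norm (?D k)) < e"
      proof -
        have "e' * (b - a) = e / 4" using ab by (simp add: e'_def field_simps)
        then show ?thesis using small' e by linarith
      qed
      finally show "norm ((\<Sum>(x, k)\<in>p. measure lborel k *\<^sub>R g x) - (f b - f a)) < e" .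
    qed
  qed
  then show ?thesis
    by (rule has_integral_spike[OF N, rotated]) (auto simp: g_def)
qed



subsection \<open>Lifting curves from the torus\<close>

text \<open>Another pair of representatives changes the difference \<open>a - b\<close> by an
  integer vector. If this vector is nonzero, some coordinate moves by at least 1, so the new
  distance exceeds 1/2.\<close>

lemma dist_to_torus_small:
  assumes "dist a b < 1 / 2"
  shows "dist (to_torus a) (to_torus b) = dist a b"
proof (rule antisym[OF dist_to_torus_le])
  have "dist a b \<le> dist a' b'" if a': "to_torus a' = to_torus a" and b': "to_torus b' = to_torus b" for a' b'
  proof (cases "a' - b' = a - b")
    case False
    then obtain i where i: "(a' - b') $ i \<noteq> (a - b) $ i" by (metis vec_eq_iff)
    have "(a' $ i - a $ i) - (b' $ i - b $ i) \<in> \<int>"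
      using a'[unfolded to_torus_eq_iff] b'[unfolded to_torus_eq_iff] by (blast intro: Ints_diff)
    moreover have "(a' $ i - a $ i) - (b' $ i - b $ i) \<noteq> 0" using i by simp
    ultimately have "1 \<le> \<bar>(a' $ i - a $ i) - (b' $ i - b $ i)\<bar>" by (rule Ints_nonzero_abs_ge1)
    moreover have "\<bar>a' $ i - b' $ i\<bar> \<le> dist a' b'" "\<bar>a $ i - b $ i\<bar> \<le> dist a b"
      using component_le_norm_cart[of "a' - b'" i] component_le_norm_cart[of "a - b" i] by (auto simp: dist_norm)
    ultimately show ?thesis using assms by linarith
  qed (simp add: dist_norm)
  then show "dist a b \<le> dist (to_torus a) (to_torus b)"
    unfolding dist_torus_def by (intro cInf_greatest) auto
qed

text \<open>Representatives at distance below 1/2 exist because the infimum is below 1/2; moving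
  both by the integer vector \<open>a - a'\<close> puts the first at \<open>a\<close>, and at such
  distances the infimum is attained.\<close>

lemma near_lift:
  assumes "dist (to_torus a) y < 1 / 2"
  obtains b where "to_torus b = y" "dist a b = dist (to_torus a) y"
proof -
  have ne: "{dist a' b' | a' b'. to_torus a' = to_torus a \<and> to_torus b' = y} \<noteq> {}"
    using to_torus_surj[of y] by auto
  obtain a' b' where *: "to_torus a' = to_torus a" "to_torus b' = y" "dist a' b' < 1 / 2"
    using cInf_lessD[OF ne, of "1 / 2"] assms unfolding dist_torus_def by auto
  define b where "b = b' + (a - a')"
  have b: "to_torus b = y" using *(1)[symmetric] *(2) to_torus_eq_iff[of b b'] to_torus_eq_iff[of a a'] by (simp add: b_def)
  have "dist a b = dist a' b'" by (simp add: b_def dist_norm algebra_simps)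
  then have "dist (to_torus a) (to_torus b) = dist a b" using * by (intro dist_to_torus_small) simp
  with b show thesis by (intro that[of b]) auto
qed

lemma continuous_on_to_torus [continuous_intros]:
  fixes f :: "'a::topological_space \<Rightarrow> real ^ 'n::finite"
  assumes "continuous_on S f"
  shows "continuous_on S (\<lambda>x. to_torus (f x))"
proof -
  have "continuous_on UNIV (to_torus :: real ^ 'n \<Rightarrow> _)"
    by (rule continuous_onI) (use dist_to_torus_le order_trans less_imp_le in blast)
  then show ?thesis using assms by (rule continuous_on_compose2) simp
qed

lemma exp_eq_if_Ints_diff:
  assumes "x - y \<in> \<int>"
  shows "exp (\<i> * of_real (2 * pi * x)) = exp (\<i> * of_real (2 * pi * y))"
proof -
  obtain n :: int where "x - y = of_int n" using assms by (rule Ints_cases)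
  then have "x = y + of_int n" by simp
  then show ?thesis unfolding exp_eq by (intro exI[of _ n]) (simp add: algebra_simps)
qed

text \<open>Unit complex numbers encode a coordinate modulo 1. Along a curve they form a continuous
  nonvanishing function, whose continuous logarithm has 2 pi times a lifted coordinate as imaginary
  part.\<close>

lift_definition torus_exp :: "'n::finite torus \<Rightarrow> 'n \<Rightarrow> complex" is "\<lambda>x i. exp (\<i> * of_real (2 * pi * x $ i))"
  by (auto simp del: of_real_mult intro!: ext exp_eq_if_Ints_diff)

lemma continuous_on_torus_exp: "continuous_on UNIV (\<lambda>x. torus_exp x i)"
  unfolding continuous_on_iff
proof (intro ballI allI impI)
  fix x :: "'a torus" and e :: real assume "0 < e"
  obtain a where a: "to_torus a = x" using to_torus_surj by blast
  have "continuous_on UNIV (\<lambda>a :: real ^ 'a. exp (\<i> * of_real (2 * pi * a $ i)))"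
    by (intro continuous_intros)
  then obtain d where d: "0 < d"
      "\<And>b. dist b a < d \<Longrightarrow> dist (exp (\<i> * of_real (2 * pi * b $ i))) (exp (\<i> * of_real (2 * pi * a $ i))) < e"
    unfolding continuous_on_iff using \<open>0 < e\<close> by (metis UNIV_I)
  show "\<exists>d>0. \<forall>x'\<in>UNIV. dist x' x < d \<longrightarrow> dist (torus_exp x' i) (torus_exp x i) < e"
  proof (intro exI[of _ "min d (1/2)"] conjI ballI impI)
    show "0 < min d (1/2)" using d(1) by simp
    fix y assume y: "dist y x < min d (1/2)"
    obtain b where "to_torus b = y" "dist a b = dist (to_torus a) y"
      by (rule near_lift[of a y]) (use y a in \<open>simp add: dist_commute\<close>)
    then show "dist (torus_exp y i) (torus_exp x i) < e"
      using d(2)[of b] y a by (auto simp: dist_commute torus_exp.abs_eq)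
  qed
qed

lemma torus_lift:
  fixes \<zeta> :: "real \<Rightarrow> 'n::finite torus"
  assumes \<zeta>: "continuous_on {a..b} \<zeta>" and "a \<le> b" and c0: "to_torus c0 = \<zeta> a"
  obtains c where "continuous_on {a..b} c" "\<And>t. t \<in> {a..b} \<Longrightarrow> to_torus (c t) = \<zeta> t" "c a = c0"
proof -
  have "\<exists>g. continuous_on {a..b} g \<and> (\<forall>t\<in>{a..b}. torus_exp (\<zeta> t) i = exp (g t))" for i
  proof -
    have "continuous_on {a..b} (\<lambda>t. torus_exp (\<zeta> t) i)"
      using continuous_on_compose2[OF continuous_on_torus_exp \<zeta>] by auto
    moreover have "contractible {a..b}" by (simp add: convex_imp_contractible)
    moreover have "torus_exp (\<zeta> t) i \<noteq> 0" for t by transfer simp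
    ultimately show ?thesis using continuous_logarithm_on_contractible[of "{a..b}" "\<lambda>t. torus_exp (\<zeta> t) i"] by metis
  qed
  then obtain g where g: "\<And>i. continuous_on {a..b} (g i)"
    "\<And>i t. t \<in> {a..b} \<Longrightarrow> torus_exp (\<zeta> t) i = exp (g i t)" by metis
  define c where "c t = (\<chi> i. Im (g i t) / (2 * pi))" for t
  have cc: "continuous_on {a..b} c" unfolding c_def using g(1) by (intro continuous_intros) auto
  have ct: "to_torus (c t) = \<zeta> t" if t: "t \<in> {a..b}" for t
  proof -
    obtain r where r: "to_torus r = \<zeta> t" using to_torus_surj by blast
    have "c t $ i - r $ i \<in> \<int>" for i
    proof -
      have "exp (g i t) = exp (\<i> * of_real (2 * pi * r $ i))"
        using g(2)[OF t, of i] r by (metis torus_exp.abs_eq)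
      then obtain n :: int where "g i t = \<i> * of_real (2 * pi * r $ i) + (of_int (2 * n) * pi) * \<i>"
        unfolding exp_eq by blast
      then have "Im (g i t) = 2 * pi * r $ i + 2 * pi * of_int n" by simp
      then have "c t $ i - r $ i = of_int n" by (simp add: c_def field_simps)
      then show ?thesis by simp
    qed
    then show ?thesis using r to_torus_eq_iff by metis
  qed
  show thesis
  proof (rule that)
    \<comment> \<open>Both \<open>c0\<close> and \<open>c a\<close> represent the initial point, so
      the shift \<open>c0 - c a\<close> is an integer vector.\<close>
    show "continuous_on {a..b} (\<lambda>t. c t + (c0 - c a))" using cc by (intro continuous_intros)
    have "to_torus c0 = to_torus (c a)" using ct[of a] c0 \<open>a \<le> b\<close> by simp
    then show "to_torus (c t + (c0 - c a)) = \<zeta> t" if "t \<in> {a..b}" for t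
      using ct[OF that] by (auto simp: to_torus_eq_iff[of "c t + (c0 - c a)" "c t"] to_torus_eq_iff[of c0] simp flip: ct[OF that])
  qed simp
qed

lemma unit_lift:
  obtains a where "to_torus a = (x :: 'n::finite torus)" "a \<in> cbox 0 1"
proof -
  obtain r where r: "to_torus r = x" using to_torus_surj by blast
  define a where "a = (\<chi> i. frac (r $ i))"
  have "to_torus a = x" using r by (auto simp: a_def to_torus_eq_iff frac_def)
  moreover have "a \<in> cbox 0 1" by (auto simp: a_def mem_box_cart frac_lt_1 less_imp_le)
  ultimately show thesis by (rule that)
qed

definition lifts :: "real \<Rightarrow> real \<Rightarrow> (real \<Rightarrow> real ^ 'n::finite) \<Rightarrow> (real \<Rightarrow> 'n torus) \<Rightarrow> bool" where
  "lifts a b c \<zeta> \<longleftrightarrow> continuous_on {a..b} c \<and> (\<forall>t\<in>{a..b}. to_torus (c t) = \<zeta> t)"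

text \<open>The start in the unit cube keeps the lifts of a sequence of curves bounded, as the
  compactness argument requires.\<close>

lemma lift_exists:
  fixes \<zeta> :: "real \<Rightarrow> 'n::finite torus"
  assumes "continuous_on {a..b} \<zeta>" "a \<le> b"
  obtains c where "lifts a b c \<zeta>" "c a \<in> cbox 0 1"
proof -
  obtain c0 where c0: "to_torus c0 = \<zeta> a" "c0 \<in> cbox 0 1" by (rule unit_lift)
  obtain c where "continuous_on {a..b} c" "\<And>t. t \<in> {a..b} \<Longrightarrow> to_torus (c t) = \<zeta> t" "c a = c0"
    by (rule torus_lift[OF assms c0(1)]) blast
  then show thesis using c0(2) by (intro that[of c]) (auto simp: lifts_def)
qed

text \<open>Close to \<open>t\<close> the points compared are within 1/2, where torus and Euclidean
  distances agree, so both difference quotients eventually coincide.\<close>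

lemma has_torus_velocity_iff:
  assumes c: "lifts a b c \<zeta>" and t: "t \<in> {a..b}"
  shows "has_torus_velocity \<zeta> q {a..b} t \<longleftrightarrow> (c has_vector_derivative q) (at t within {a..b})"
proof -
  have "((\<lambda>s. dist (c s) (c t + (s - t) *\<^sub>R q)) \<longlongrightarrow> dist (c t) (c t + (t - t) *\<^sub>R q)) (at t within {a..b})"
    using c t by (intro tendsto_intros) (auto simp: lifts_def continuous_on)
  then have "\<forall>\<^sub>F s in at t within {a..b}. dist (c s) (c t + (s - t) *\<^sub>R q) < 1 / 2"
    by (rule order_tendstoD) simp
  moreover have "\<forall>\<^sub>F s in at t within {a..b}. s \<in> {a..b}" by (simp add: eventually_at_filter)
  ultimately have "\<forall>\<^sub>F s in at t within {a..b}.
      dist (\<zeta> s) (torus_translate (\<zeta> t) ((s - t) *\<^sub>R q)) / \<bar>s - t\<bar>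
      = norm ((c s - c t - (s - t) *\<^sub>R q) /\<^sub>R norm (s - t))"
  proof eventually_elim
    case (elim s)
    have "torus_translate (\<zeta> t) ((s - t) *\<^sub>R q) = to_torus (c t + (s - t) *\<^sub>R q)" "\<zeta> s = to_torus (c s)"
      using c t elim(2) by (auto simp: lifts_def torus_translate.abs_eq[symmetric])
    then show ?case using dist_to_torus_small[OF elim(1)]
      by (simp add: dist_norm diff_diff_eq divide_inverse mult.commute)
  qed
  then have "has_torus_velocity \<zeta> q {a..b} t \<longleftrightarrow>
      ((\<lambda>s. norm ((c s - c t - (s - t) *\<^sub>R q) /\<^sub>R norm (s - t))) \<longlongrightarrow> 0) (at t within {a..b})"
    unfolding has_torus_velocity_def by (rule tendsto_cong)
  also have "\<dots> \<longleftrightarrow> (c has_vector_derivative q) (at t within {a..b})"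
    unfolding has_vector_derivative_def has_derivative_at_within tendsto_norm_zero_iff
    by (simp add: bounded_linear_scaleR_left)
  finally show ?thesis .
qed

lemma torus_velocity_eq:
  assumes "a < b" and c: "lifts a b c \<zeta>" and t: "t \<in> {a..b}"
    and q: "(c has_vector_derivative q) (at t within {a..b})"
  shows "torus_velocity \<zeta> {a..b} t = q"
  unfolding torus_velocity_def has_torus_velocity_iff[OF c t]
  using q vector_derivative_unique_within_closed_interval[OF \<open>a < b\<close>, of t c] t by (intro the_equality) auto

text \<open>Projection does not increase distances. Conversely, uniform continuity keeps increments
  of \<open>c\<close> over lengths below \<open>h\<close> under 1/2, where projection preserves
  distances, and every member of a family of total length below \<open>h\<close> is itself that
  short.\<close>

lemma abs_continuous_on_lift:
  assumes c: "lifts a b c \<zeta>"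
  shows "abs_continuous_on a b \<zeta> \<longleftrightarrow> abs_continuous_on a b c"
proof
  assume "abs_continuous_on a b c"
  then show "abs_continuous_on a b \<zeta>"
  proof (rule abs_continuous_on_dist_le)
    fix s t assume "a \<le> s" "s \<le> t" "t \<le> b"
    then have "\<zeta> s = to_torus (c s)" "\<zeta> t = to_torus (c t)" using c by (auto simp: lifts_def)
    then show "dist (\<zeta> s) (\<zeta> t) \<le> dist (c s) (c t)" by (simp add: dist_to_torus_le)
  qed
next
  assume \<zeta>: "abs_continuous_on a b \<zeta>"
  have "uniformly_continuous_on {a..b} c"
    using c by (intro compact_uniformly_continuous) (auto simp: lifts_def)
  then obtain h where h: "0 < h" "\<And>s t. s \<in> {a..b} \<Longrightarrow> t \<in> {a..b} \<Longrightarrow> dist t s < h \<Longrightarrow> dist (c t) (c s) < 1 / 2"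
    unfolding uniformly_continuous_on_def by (metis half_gt_zero zero_less_one)
  show "abs_continuous_on a b c"
    unfolding abs_continuous_on_alt
  proof (intro allI impI)
    fix e :: real assume "0 < e"
    then obtain d where d: "0 < d"
        "\<And>I. intervals a b I \<Longrightarrow> (\<Sum>(s, t)\<in>I. t - s) < d \<Longrightarrow> (\<Sum>(s, t)\<in>I. dist (\<zeta> s) (\<zeta> t)) < e"
      by (rule abs_continuous_onD[OF \<zeta>]) blast
    have "(\<Sum>(s, t)\<in>I. dist (c s) (c t)) < e" if I: "intervals a b I" "(\<Sum>(s, t)\<in>I. t - s) < min d h" for I
    proof -
      have "dist (c s) (c t) = dist (\<zeta> s) (\<zeta> t)" if st: "(s, t) \<in> I" for s t
      proof -
        have "(case (s, t) of (s, t) \<Rightarrow> t - s) \<le> (\<Sum>(s, t)\<in>I. t - s)"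
          using intervalsD[OF I(1)] by (intro member_le_sum[OF st]) auto
        then have "dist s t < h" using I(2) intervalsD(3)[OF I(1) st] by (auto simp: dist_real_def)
        moreover have "s \<in> {a..b}" "t \<in> {a..b}" using intervalsD[OF I(1)] st by fastforce+
        ultimately show ?thesis using h(2)[of t s] c dist_to_torus_small[of "c s" "c t"] by (auto simp: lifts_def)
      qed
      then have "(\<Sum>(s, t)\<in>I. dist (c s) (c t)) = (\<Sum>(s, t)\<in>I. dist (\<zeta> s) (\<zeta> t))"
        by (intro sum.cong) auto
      then show ?thesis using d(2)[OF I(1)] I(2) by simp
    qed
    then show "\<exists>d>0. \<forall>I. intervals a b I \<and> (\<Sum>(s, t)\<in>I. t - s) < d \<longrightarrow> (\<Sum>(s, t)\<in>I. dist (c s) (c t)) < e"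
      using d(1) h(1) by (intro exI[of _ "min d h"]) auto
  qed
qed

text \<open>The pointwise choice of \<open>c'\<close> is automatically continuous: two distances
  below 1/8 to \<open>c\<close> and an increment of \<open>c\<close> below 1/8 total less than 1/2,
  where increments of \<open>c'\<close> and \<eta> have the same size.\<close>

lemma lifts_near:
  assumes c: "lifts a b c \<zeta>" and \<eta>: "continuous_on {a..b} \<eta>"
    and near: "\<And>t. t \<in> {a..b} \<Longrightarrow> dist (\<zeta> t) (\<eta> t) < 1 / 8"
  obtains c' where "lifts a b c' \<eta>" "\<And>t. t \<in> {a..b} \<Longrightarrow> dist (c t) (c' t) = dist (\<zeta> t) (\<eta> t)"
proof -
  have "\<exists>v. t \<in> {a..b} \<longrightarrow> to_torus v = \<eta> t \<and> dist (c t) v = dist (\<zeta> t) (\<eta> t)" for t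
  proof (cases "t \<in> {a..b}")
    case True
    then show ?thesis using near_lift[of "c t" "\<eta> t"] near[OF True] c by (auto simp: lifts_def)
  qed auto
  then obtain c' where c': "\<And>t. t \<in> {a..b} \<Longrightarrow> to_torus (c' t) = \<eta> t"
    "\<And>t. t \<in> {a..b} \<Longrightarrow> dist (c t) (c' t) = dist (\<zeta> t) (\<eta> t)" by metis
  have "continuous_on {a..b} c'"
    unfolding continuous_on_iff
  proof (intro ballI allI impI)
    fix t e :: real assume t: "t \<in> {a..b}" and e: "0 < e"
    obtain d1 where d1: "0 < d1" "\<And>s. s \<in> {a..b} \<Longrightarrow> dist s t < d1 \<Longrightarrow> dist (c s) (c t) < 1 / 8"
      using c t unfolding lifts_def continuous_on_iff by (metis zero_less_divide_1_iff zero_less_numeral)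
    obtain d2 where d2: "0 < d2" "\<And>s. s \<in> {a..b} \<Longrightarrow> dist s t < d2 \<Longrightarrow> dist (\<eta> s) (\<eta> t) < e"
      using \<eta> t e unfolding continuous_on_iff by metis
    have "dist (c' s) (c' t) < e" if s: "s \<in> {a..b}" "dist s t < min d1 d2" for s
    proof -
      have "dist (c' s) (c' t) \<le> dist (c' s) (c s) + dist (c s) (c t) + dist (c t) (c' t)"
        by (smt (verit) dist_triangle)
      then have "dist (c' s) (c' t) < 1 / 2"
        using d1(2)[OF s(1)] s(2) c'(2)[OF s(1)] c'(2)[OF t] near[OF s(1)] near[OF t]
        by (simp add: dist_commute)
      then have "dist (c' s) (c' t) = dist (\<eta> s) (\<eta> t)"
        using dist_to_torus_small c'(1)[OF s(1)] c'(1)[OF t] by metis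
      then show ?thesis using d2(2)[OF s(1)] s(2) by simp
    qed
    then show "\<exists>d>0. \<forall>s\<in>{a..b}. dist s t < d \<longrightarrow> dist (c' s) (c' t) < e"
      using d1(1) d2(1) by (intro exI[of _ "min d1 d2"]) auto
  qed
  then show thesis using c' by (intro that[of c']) (auto simp: lifts_def)
qed



section \<open>Derivatives as integrands and as limits of quotients\<close>

lemma abs_continuous_has_integral_vector_derivative:
  fixes f :: "real \<Rightarrow> 'a::euclidean_space"
  assumes f: "abs_continuous_on a b f" and st: "a \<le> s" "s < t" "t \<le> b"
  shows "((\<lambda>x. vector_derivative f (at x within {a..b})) has_integral f t - f s) {s..t}"
proof (rule abs_continuous_has_integral[OF st(2)])
  show "abs_continuous_on s t f" by (rule abs_continuous_on_subinterval[OF f st(1,3)])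
  show "negligible {x\<in>{a..b}. \<not> f differentiable (at x)}" by (rule abs_continuous_differentiable_ae[OF f])
  fix x assume x: "x \<in> {s..t} - {x\<in>{a..b}. \<not> f differentiable (at x)}"
  then have "f differentiable (at x within {a..b})" using st by (auto intro: differentiable_at_withinI)
  then show "(f has_vector_derivative vector_derivative f (at x within {a..b})) (at x within {s..t})"
    using st by (intro has_vector_derivative_within_subset[where T = "{s..t}"]) (auto simp: vector_derivative_works)
qed

text \<open>The cells of a partition contain \<open>x\<close> without ending there. Both endpoint
  errors are small relative to the distances to \<open>x\<close>, and as \<open>x\<close> lies
  between the endpoints these distances add up to exactly \<open>v n - u n\<close>.\<close>

lemma straddle_quotient_tendsto:
  fixes f :: "real \<Rightarrow> real"
  assumes f: "(f has_vector_derivative f') (at x within S)"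
    and uv: "\<And>n. u n \<in> S" "\<And>n. v n \<in> S" "\<And>n. u n \<le> x" "\<And>n. x \<le> v n" "\<And>n. u n < v n"
    and lim: "(\<lambda>n. v n - u n) \<longlonglongrightarrow> 0"
  shows "(\<lambda>n. (f (v n) - f (u n)) / (v n - u n)) \<longlonglongrightarrow> f'"
proof (rule LIMSEQ_I)
  fix e :: real assume e: "0 < e"
  have "(f has_derivative (\<lambda>h. h *\<^sub>R f')) (at x within S)" using f by (simp add: has_vector_derivative_def)
  then have "\<forall>e>0. \<exists>d>0. \<forall>y\<in>S. norm (y - x) < d \<longrightarrow> norm (f y - f x - (y - x) *\<^sub>R f') \<le> e * norm (y - x)"
    unfolding has_derivative_within_alt by blast
  then obtain d where d: "0 < d"
      "\<And>y. y \<in> S \<Longrightarrow> norm (y - x) < d \<Longrightarrow> norm (f y - f x - (y - x) *\<^sub>R f') \<le> e / 2 * norm (y - x)"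
    using e by (metis half_gt_zero)
  obtain n0 where n0: "\<And>n. n \<ge> n0 \<Longrightarrow> norm (v n - u n - 0) < d" using LIMSEQ_D[OF lim d(1)] by blast
  show "\<exists>n0. \<forall>n\<ge>n0. norm ((f (v n) - f (u n)) / (v n - u n) - f') < e"
  proof (intro exI allI impI)
    fix n assume "n0 \<le> n"
    then have l: "v n - u n < d" using n0[of n] by simp
    have "norm (f (v n) - f x - (v n - x) *\<^sub>R f') \<le> e / 2 * norm (v n - x)"
      "norm (f (u n) - f x - (u n - x) *\<^sub>R f') \<le> e / 2 * norm (u n - x)"
      by (rule d(2); use uv(1-5)[of n] l in auto)+
    moreover have "(f (v n) - f (u n)) - (v n - u n) * f'
        = (f (v n) - f x - (v n - x) *\<^sub>R f') - (f (u n) - f x - (u n - x) *\<^sub>R f')"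
      by (simp add: algebra_simps)
    ultimately have "\<bar>(f (v n) - f (u n)) - (v n - u n) * f'\<bar> \<le> e / 2 * (v n - x) + e / 2 * (x - u n)"
      using uv(3,4)[of n] by (smt (verit) real_norm_def)
    also have "\<dots> = e / 2 * (v n - u n)" by (simp flip: distrib_left)
    finally have *: "\<bar>(f (v n) - f (u n)) - (v n - u n) * f'\<bar> \<le> e / 2 * (v n - u n)" .
    have "(f (v n) - f (u n)) / (v n - u n) - f' = ((f (v n) - f (u n)) - (v n - u n) * f') / (v n - u n)"
      using uv(5)[of n] by (simp add: diff_divide_distrib)
    then have "norm ((f (v n) - f (u n)) / (v n - u n) - f') \<le> e / 2"
      using * uv(5)[of n] by (simp add: pos_divide_le_eq)
    then show "norm ((f (v n) - f (u n)) / (v n - u n) - f') < e" using e by simp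
  qed
qed

subsection \<open>The action as a supremum of continuous functionals\<close>

locale superlinear_hamiltonian =
  fixes H :: "'n::finite torus \<Rightarrow> real \<Rightarrow> real ^ 'n \<Rightarrow> real" and T :: real
  assumes T_pos: "0 < T"
    and cont_H: "continuous_on (UNIV \<times> {0..T} \<times> UNIV) (\<lambda>(x, t, p). H x t p)"
    and superlinear: "\<And>M. \<forall>\<^sub>F p in at_infinity. \<forall>x. \<forall>t\<in>{0..T}. M \<le> H x t p / norm p"
begin

section \<open>The Lagrangian as a Legendre transform\<close>

abbreviation "L \<equiv> lagrangian H"

lemma continuous_on_H:
  assumes "continuous_on S f" "continuous_on S g" "continuous_on S h" "g ` S \<subseteq> {0..T}"
  shows "continuous_on S (\<lambda>s. H (f s) (g s) (h s))"
proof -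
  have "continuous_on S (\<lambda>s. (\<lambda>(x, t, p). H x t p) (f s, g s, h s))"
    by (rule continuous_on_compose2[OF cont_H]) (use assms in \<open>auto intro!: continuous_intros\<close>)
  then show ?thesis by simp
qed

lemma H_bounded:
  obtains C where "0 \<le> C" "\<And>x t p. t \<in> {0..T} \<Longrightarrow> norm p \<le> R \<Longrightarrow> \<bar>H x t p\<bar> \<le> C"
proof -
  let ?S = "cbox (0 :: real ^ 'n) 1 \<times> {0..T} \<times> cball (0 :: real ^ 'n) R"
  have "continuous_on ?S (\<lambda>z. H (to_torus (fst z)) (fst (snd z)) (snd (snd z)))"
    by (intro continuous_on_H continuous_intros) auto
  moreover have "compact ?S" by (intro compact_Times) auto
  ultimately have "bounded ((\<lambda>z. H (to_torus (fst z)) (fst (snd z)) (snd (snd z))) ` ?S)"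
    by (intro compact_imp_bounded compact_continuous_image)
  then obtain C where C: "\<And>z. z \<in> ?S \<Longrightarrow> norm (H (to_torus (fst z)) (fst (snd z)) (snd (snd z))) \<le> C"
    unfolding bounded_iff by blast
  show thesis
  proof (rule that[of "max 0 C"])
    fix x :: "'n torus" and t :: real and p :: "real ^ 'n" assume "t \<in> {0..T}" "norm p \<le> R"
    moreover obtain a :: "real ^ 'n" where "to_torus a = x" "a \<in> cbox 0 1" by (rule unit_lift)
    ultimately show "\<bar>H x t p\<bar> \<le> max 0 C" using C[of "(a, t, p)"] by auto
  qed simp
qed

text \<open>For large \<open>p\<close> superlinearity gives
  \<open>H x t p \<ge> Q * norm p \<ge> p \<bullet> q\<close>, so only a ball of slopes matters, and
  there \<open>H\<close> is bounded. This makes the supremum defining \<open>L\<close>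
  finite.\<close>

lemma fenchel_bounded:
  obtains B where "0 \<le> B" "\<And>x t p q. t \<in> {0..T} \<Longrightarrow> norm q \<le> Q \<Longrightarrow> p \<bullet> q - H x t p \<le> B"
proof -
  obtain r where r: "\<And>p x t. r \<le> norm p \<Longrightarrow> t \<in> {0..T} \<Longrightarrow> Q \<le> H x t p / norm p"
    using superlinear[of Q] unfolding eventually_at_infinity by blast
  obtain C where C: "0 \<le> C" "\<And>x t p. t \<in> {0..T} \<Longrightarrow> norm p \<le> max r 0 \<Longrightarrow> \<bar>H x t p\<bar> \<le> C"
    using H_bounded by blast
  show thesis
  proof (rule that[of "max r 0 * max Q 0 + C"])
    show "0 \<le> max r 0 * max Q 0 + C" using C(1) by simp
    fix x and t :: real and p q :: "real ^ 'n" assume t: "t \<in> {0..T}" and q: "norm q \<le> Q"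
    have Q: "0 \<le> Q" using q norm_ge_zero order_trans by blast
    have pq: "p \<bullet> q \<le> norm p * Q"
      using norm_cauchy_schwarz[of p q] mult_left_mono[OF q norm_ge_zero[of p]] by linarith
    show "p \<bullet> q - H x t p \<le> max r 0 * max Q 0 + C"
    proof (cases "norm p \<le> max r 0")
      case True
      have "norm p * Q \<le> max r 0 * Q" using True Q by (rule mult_right_mono)
      then show ?thesis using pq C(2)[OF t True, of x] Q by (auto simp: max_def)
    next
      case False
      then have "0 < norm p" "r \<le> norm p" by auto
      then have "norm p * Q \<le> H x t p" using r[of p t x] t by (simp add: pos_le_divide_eq mult.commute)
      then have "p \<bullet> q - H x t p \<le> 0" using pq by simp
      also have "0 \<le> max r 0 * max Q 0 + C" using C(1) by simp
      finally show ?thesis .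
    qed
  qed
qed

lemma fenchel_young:
  assumes "t \<in> {0..T}"
  shows "p \<bullet> q - H x t p \<le> L x t q"
proof -
  obtain B where "0 \<le> B" "\<And>x t p' q'. t \<in> {0..T} \<Longrightarrow> norm q' \<le> norm q \<Longrightarrow> p' \<bullet> q' - H x t p' \<le> B"
    using fenchel_bounded by blast
  then have "bdd_above (range (\<lambda>p. p \<bullet> q - H x t p))" using assms by (intro bdd_aboveI[of _ B]) auto
  then show ?thesis unfolding lagrangian_def by (rule cSUP_upper[rotated]) simp
qed

lemma L_bounded:
  obtains B where "0 \<le> B" "\<And>x t q. t \<in> {0..T} \<Longrightarrow> norm q \<le> Q \<Longrightarrow> L x t q \<le> B"
proof -
  obtain B where "0 \<le> B" "\<And>x t p q. t \<in> {0..T} \<Longrightarrow> norm q \<le> Q \<Longrightarrow> p \<bullet> q - H x t p \<le> B"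
    using fenchel_bounded by blast
  then show thesis by (intro that[of B]) (auto simp: lagrangian_def intro!: cSUP_least)
qed

text \<open>Slope 0 in the Fenchel inequality gives L + K \<ge> 0. Adding \<open>K\<close> to the
  integrand therefore opens the action to Fatou's lemma and to additivity over disjoint
  sets.\<close>

definition K :: real where
  "K = (SOME K. 0 \<le> K \<and> (\<forall>x. \<forall>t\<in>{0..T}. H x t 0 \<le> K))"

lemma K: "0 \<le> K" "t \<in> {0..T} \<Longrightarrow> H x t 0 \<le> K"
proof -
  obtain C where C: "0 \<le> C" "\<And>x t p. t \<in> {0..T} \<Longrightarrow> norm p \<le> 0 \<Longrightarrow> \<bar>H x t p\<bar> \<le> C"
    using H_bounded by blast
  have "H x t 0 \<le> C" if "t \<in> {0..T}" for x t using C(2)[OF that, of 0 x] by simp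
  then have "\<exists>K. 0 \<le> K \<and> (\<forall>x. \<forall>t\<in>{0..T}. H x t 0 \<le> K)" using C(1) by blast
  then have "0 \<le> K \<and> (\<forall>x. \<forall>t\<in>{0..T}. H x t 0 \<le> K)" unfolding K_def by (rule someI_ex)
  then show "0 \<le> K" "t \<in> {0..T} \<Longrightarrow> H x t 0 \<le> K" by auto
qed

lemma L_lower: "t \<in> {0..T} \<Longrightarrow> 0 \<le> L x t q + K"
  using fenchel_young[of t 0 q x] K(2)[of t x] by simp

text \<open>Countably many slopes make \<open>L\<close> along a curve measurable as a supremum, and
  among finite initial segments of the sequence a best slope can be picked.\<close>

definition dense_seq :: "nat \<Rightarrow> real ^ 'n" where
  "dense_seq = (SOME d. \<forall>U. open U \<longrightarrow> U \<noteq> {} \<longrightarrow> (\<exists>i. d i \<in> U))"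

lemma dense_seq: "open U \<Longrightarrow> U \<noteq> {} \<Longrightarrow> \<exists>i. dense_seq i \<in> U"
proof -
  obtain D :: "(real ^ 'n) set" where D: "countable D" "\<And>U. open U \<Longrightarrow> U \<noteq> {} \<Longrightarrow> \<exists>d\<in>D. d \<in> U"
    by (rule countable_dense_setE) blast
  have "\<exists>i. from_nat_into D i \<in> U" if U: "open U" "U \<noteq> {}" for U
  proof -
    obtain x where x: "x \<in> D" "x \<in> U" using D(2)[OF U] by blast
    then obtain i where "from_nat_into D i = x" using from_nat_into_surj[OF D(1) x(1)] by blast
    then show ?thesis using x by blast
  qed
  then have "\<exists>d :: nat \<Rightarrow> real ^ 'n. \<forall>U. open U \<longrightarrow> U \<noteq> {} \<longrightarrow> (\<exists>i. d i \<in> U)" by blast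
  then have "\<forall>U. open U \<longrightarrow> U \<noteq> {} \<longrightarrow> (\<exists>i. dense_seq i \<in> U)"
    unfolding dense_seq_def by (rule someI_ex)
  then show "open U \<Longrightarrow> U \<noteq> {} \<Longrightarrow> \<exists>i. dense_seq i \<in> U" by blast
qed

text \<open>The slopes exceeding a given value form an open set, by continuity of \<open>H\<close>
  in \<open>p\<close>, and a nonempty one if the value is below the supremum.\<close>

lemma ennreal_L_eq_SUP:
  assumes t: "t \<in> {0..T}"
  shows "ennreal (L x t q + K) = (SUP i. ennreal (dense_seq i \<bullet> q - (H x t (dense_seq i) - K)))"
proof (rule antisym)
  show "(SUP i. ennreal (dense_seq i \<bullet> q - (H x t (dense_seq i) - K))) \<le> ennreal (L x t q + K)"
  proof (intro SUP_least ennreal_leI)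
    fix i show "dense_seq i \<bullet> q - (H x t (dense_seq i) - K) \<le> L x t q + K"
      using fenchel_young[OF t, of "dense_seq i" q x] by simp
  qed
  show "ennreal (L x t q + K) \<le> (SUP i. ennreal (dense_seq i \<bullet> q - (H x t (dense_seq i) - K)))"
  proof (rule le_SUP_iff[THEN iffD2, rule_format])
    fix y assume y: "y < ennreal (L x t q + K)"
    then have "y \<noteq> \<top>" by auto
    then obtain r where r: "y = ennreal r" "0 \<le> r" by (cases y) auto
    then have less: "r - K < L x t q" using y by (simp add: ennreal_less_iff)
    obtain p where p: "r - K < p \<bullet> q - H x t p"
    proof (rule ccontr)
      assume no: "\<not> thesis"
      have "p \<bullet> q - H x t p \<le> r - K" for p using that no by (meson not_le)
      then have "L x t q \<le> r - K" unfolding lagrangian_def by (intro cSUP_least) auto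
      then show False using less by simp
    qed
    have "continuous_on UNIV (\<lambda>p. p \<bullet> q - H x t p)"
      using t by (intro continuous_intros continuous_on_H) auto
    then have "open {p. r - K < p \<bullet> q - H x t p}" by (rule open_Collect_less[OF continuous_on_const])
    then obtain i where "r - K < dense_seq i \<bullet> q - H x t (dense_seq i)"
      using dense_seq p by blast
    then have "y < ennreal (dense_seq i \<bullet> q - (H x t (dense_seq i) - K))"
      using r by (simp add: ennreal_less_iff)
    then show "\<exists>i\<in>UNIV. y < ennreal (dense_seq i \<bullet> q - (H x t (dense_seq i) - K))" by blast
  qed
qed

section \<open>Energy and its dual description\<close>

definition energy :: "(real \<Rightarrow> real ^ 'n) \<Rightarrow> ennreal" where
  "energy c = (\<integral>\<^sup>+s. ennreal (L (to_torus (c s)) s (vector_derivative c (at s within {0..T})) + K) \<partial>lebesgue_on {0..T})"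

text \<open>By the Fenchel inequality \<open>defect c p s t\<close> is at most the energy of \<open>c\<close> on \<open>{s..t}\<close>, and it
  does not involve the velocity of \<open>c\<close>. Hence \<open>dual_bound c C\<close> passes to pointwise limits; it turns
  out to mean that \<open>c\<close> is absolutely continuous of energy at most \<open>C\<close>. The families of intervals
  need not cover \<open>{0..T}\<close> because of the normalisation by \<open>K\<close>.\<close>

definition defect :: "(real \<Rightarrow> real ^ 'n) \<Rightarrow> real ^ 'n \<Rightarrow> real \<Rightarrow> real \<Rightarrow> real" where
  "defect c p s t = p \<bullet> (c t - c s) - integral {s..t} (\<lambda>\<tau>. H (to_torus (c \<tau>)) \<tau> p - K)"

definition dual_bound :: "(real \<Rightarrow> real ^ 'n) \<Rightarrow> real \<Rightarrow> bool" where
  "dual_bound c C \<longleftrightarrow> (\<forall>I p. intervals 0 T I \<longrightarrow> (\<Sum>(s, t)\<in>I. defect c (p (s, t)) s t) \<le> C)"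

lemma dual_boundD:
  "dual_bound c C \<Longrightarrow> intervals 0 T I \<Longrightarrow> (\<Sum>(s, t)\<in>I. defect c (p (s, t)) s t) \<le> C"
  by (simp add: dual_bound_def)

lemma dual_bound_nonneg: "dual_bound c C \<Longrightarrow> 0 \<le> C"
  using dual_boundD[of c C "{}"] by (simp add: intervals_def disjoint_family_on_def)

lemma continuous_on_H_curve:
  assumes "continuous_on {0..T} c"
  shows "continuous_on {0..T} (\<lambda>\<tau>. H (to_torus (c \<tau>)) \<tau> p - K)"
  by (intro continuous_intros continuous_on_H assms) auto

lemma integrable_H_curve:
  assumes "continuous_on {0..T} c" "0 \<le> s" "t \<le> T"
  shows "(\<lambda>\<tau>. H (to_torus (c \<tau>)) \<tau> p - K) integrable_on {s..t}"
  by (rule integrable_continuous_real, rule continuous_on_subset[OF continuous_on_H_curve[OF assms(1)]])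
    (use assms in auto)

text \<open>The derivative is Henstock-Kurzweil integrable, as the integrand that recovers
  \<open>c\<close>, and this implies Lebesgue measurability.\<close>

lemma measurable_velocity:
  fixes c :: "real \<Rightarrow> real ^ 'n"
  assumes "abs_continuous_on 0 T c"
  shows "(\<lambda>s. vector_derivative c (at s within {0..T})) \<in> borel_measurable (lebesgue_on {0..T})"
  using abs_continuous_has_integral_vector_derivative[OF assms order_refl T_pos order_refl]
  by (intro integrable_imp_measurable) (auto simp: integrable_on_def)

lemma measurable_L:
  assumes c: "abs_continuous_on 0 T c"
  shows "(\<lambda>s. ennreal (L (to_torus (c s)) s (vector_derivative c (at s within {0..T})) + K))
    \<in> borel_measurable (lebesgue_on {0..T})"
proof -
  have cc: "continuous_on {0..T} c" using c by (rule abs_continuous_on_imp_continuous_on)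
  note [measurable] = measurable_velocity[OF c]
  have [measurable]: "(\<lambda>s. H (to_torus (c s)) s p - K) \<in> borel_measurable (lebesgue_on {0..T})" for p
    by (rule continuous_imp_measurable_on_sets_lebesgue[OF continuous_on_H_curve[OF cc]]) auto
  have "(\<lambda>s. SUP i. ennreal (dense_seq i \<bullet> vector_derivative c (at s within {0..T})
      - (H (to_torus (c s)) s (dense_seq i) - K))) \<in> borel_measurable (lebesgue_on {0..T})"
    by measurable
  then show ?thesis
    by (rule measurable_cong[THEN iffD1, rotated]) (simp add: ennreal_L_eq_SUP)
qed

text \<open>This is the Fenchel inequality integrated, with the increment of \<open>c\<close> as the
  integral of its velocity. The energy appears as a measure with a density so that summation over a
  family becomes additivity; the open intervals are the disjoint ones.\<close>

lemma defect_le_energy: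
  assumes c: "abs_continuous_on 0 T c" and st: "0 \<le> s" "s \<le> t" "t \<le> T"
  shows "ennreal (defect c p s t) \<le> emeasure (density (lebesgue_on {0..T})
    (\<lambda>s. ennreal (L (to_torus (c s)) s (vector_derivative c (at s within {0..T})) + K))) {s<..<t}"
    (is "_ \<le> emeasure (density ?M ?l) ?A")
proof (cases "s = t")
  case True
  then show ?thesis by (simp add: defect_def)
next
  case False
  then have "s < t" using st by simp
  have cc: "continuous_on {0..T} c" using c by (rule abs_continuous_on_imp_continuous_on)
  have A: "?A \<in> sets ?M" using st by (auto simp: sets_restrict_space image_iff intro!: bexI[of _ "?A"])
  define l where "l \<tau> = L (to_torus (c \<tau>)) \<tau> (vector_derivative c (at \<tau> within {0..T})) + K" for \<tau>
  define f where "f \<tau> = p \<bullet> vector_derivative c (at \<tau> within {0..T}) - (H (to_torus (c \<tau>)) \<tau> p - K)" for \<tau>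
  define g where "g \<tau> = (if \<tau> \<in> ?A then l \<tau> else 0)" for \<tau>
  note [measurable] = measurable_L[OF c, folded l_def]
  have l_nonneg: "0 \<le> l \<tau>" if "\<tau> \<in> {0..T}" for \<tau> using L_lower[OF that] by (simp add: l_def)
  have em: "emeasure (density ?M ?l) ?A = (\<integral>\<^sup>+\<tau>. ennreal (g \<tau>) \<partial>?M)"
    unfolding emeasure_density[OF measurable_L[OF c] A]
    by (intro nn_integral_cong) (auto simp: g_def l_def indicator_def)
  have "(\<lambda>\<tau>. enn2real (ennreal (l \<tau>))) \<in> borel_measurable ?M" by measurable
  then have ml: "l \<in> borel_measurable ?M"
    by (rule measurable_cong[THEN iffD1, rotated]) (use l_nonneg in auto)
  have mg: "g \<in> borel_measurable ?M"
    unfolding g_def using ml A by (intro measurable_If_set) (auto simp: Int_absorb1)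
  show ?thesis
  proof (cases "(\<integral>\<^sup>+\<tau>. ennreal (g \<tau>) \<partial>?M) = \<infinity>")
    case False
    have g0: "AE \<tau> in ?M. 0 \<le> g \<tau>" using l_nonneg by (auto simp: g_def intro!: AE_I2)
    have ig: "integrable ?M g"
      using mg g0 False by (intro integrableI_nonneg) (auto simp: top.not_eq_extremum)
    have gi: "(g has_integral integral\<^sup>L ?M g) {0..T}"
      using integrable_on_lebesgue_on[OF ig] lebesgue_integral_eq_integral[OF ig] by (simp add: has_integral_integral)
    have "(f has_integral p \<bullet> (c t - c s) - integral {s..t} (\<lambda>\<tau>. H (to_torus (c \<tau>)) \<tau> p - K)) {s..t}"
      unfolding f_def
      by (intro has_integral_diff has_integral_linear[OF abs_continuous_has_integral_vector_derivative[OF c st(1) \<open>s < t\<close> st(3)],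
            unfolded o_def] integrable_integral integrable_H_curve[OF cc st(1,3)] bounded_linear_inner_right)
    then have "(f has_integral defect c p s t) ?A"
      by (simp add: defect_def has_integral_Icc_iff_Ioo)
    then have "((\<lambda>\<tau>. if \<tau> \<in> ?A then f \<tau> else 0) has_integral defect c p s t) {0..T}"
      using st by (subst has_integral_restrict) auto
    then have "defect c p s t \<le> integral\<^sup>L ?M g"
    proof (rule has_integral_le[OF _ gi])
      fix \<tau> assume "\<tau> \<in> {0..T}"
      then show "(if \<tau> \<in> ?A then f \<tau> else 0) \<le> g \<tau>"
        using fenchel_young[of \<tau> p] by (simp add: g_def f_def l_def algebra_simps)
    qed
    then have "ennreal (defect c p s t) \<le> ennreal (integral\<^sup>L ?M g)" by (rule ennreal_leI)
    also have "\<dots> = (\<integral>\<^sup>+\<tau>. ennreal (g \<tau>) \<partial>?M)" by (rule nn_integral_eq_integral[OF ig g0, symmetric])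
    finally show ?thesis by (simp add: em)
  qed (simp add: em)
qed

lemma energy_imp_dual_bound:
  assumes c: "abs_continuous_on 0 T c" and e: "energy c \<le> ennreal C" "0 \<le> C"
  shows "dual_bound c C"
  unfolding dual_bound_def
proof (intro allI impI)
  fix I and p :: "real \<times> real \<Rightarrow> real ^ 'n" assume I: "intervals 0 T I"
  define D where "D = density (lebesgue_on {0..T})
    (\<lambda>s. ennreal (L (to_torus (c s)) s (vector_derivative c (at s within {0..T})) + K))"
  let ?f = "\<lambda>i. case i of (s, t) \<Rightarrow> defect c (p (s, t)) s t"
  let ?A = "\<lambda>i::real \<times> real. case i of (s, t) \<Rightarrow> {s<..<t}"
  have A: "?A i \<in> sets D" if "i \<in> I" for i
  proof -
    obtain s t where i: "i = (s, t)" by (cases i)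
    then have "0 \<le> s" "t \<le> T" using intervalsD(2,4)[OF I] that by auto
    then have "{s<..<t} \<subseteq> {0..T}" by auto
    then show ?thesis by (auto simp: i D_def sets_restrict_space image_iff intro!: bexI[of _ "{s<..<t}"])
  qed
  \<comment> \<open>Negative defects are first raised to 0, since \<open>ennreal\<close> commutes
    with sums only for nonnegative terms.\<close>
  have "ennreal (\<Sum>i\<in>I. ?f i) \<le> ennreal (\<Sum>i\<in>I. max 0 (?f i))"
    by (intro ennreal_leI sum_mono) auto
  also have "\<dots> = (\<Sum>i\<in>I. ennreal (max 0 (?f i)))" by (rule sum_ennreal[symmetric]) auto
  also have "\<dots> \<le> (\<Sum>i\<in>I. emeasure D (?A i))"
  proof (rule sum_mono)
    fix i assume "i \<in> I"
    obtain s t where i: "i = (s, t)" by (cases i)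
    have "ennreal (max 0 (?f i)) = ennreal (defect c (p (s, t)) s t)"
      by (auto simp: i max_def ennreal_neg)
    also have "\<dots> \<le> emeasure D (?A i)"
      using defect_le_energy[OF c, of s t] intervalsD[OF I] \<open>i \<in> I\<close> by (simp add: i D_def)
    finally show "ennreal (max 0 (?f i)) \<le> emeasure D (?A i)" .
  qed
  also have "\<dots> = emeasure D (\<Union>i\<in>I. ?A i)"
    using A intervalsD[OF I] by (intro sum_emeasure) auto
  also have "\<dots> \<le> emeasure D (space D)" by (rule emeasure_space)
  also have "\<dots> = energy c"
    unfolding D_def energy_def by (subst emeasure_density) (auto intro!: measurable_L[OF c] nn_integral_cong simp: indicator_def)
  also have "\<dots> \<le> ennreal C" by (rule e)
  finally show "(\<Sum>i\<in>I. ?f i) \<le> C" using e(2) by (simp add: ennreal_le_iff)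
qed

text \<open>\<open>B\<close> bounds \<open>H\<close> for slopes up to \<open>R\<close>, so it
  depends neither on the curve nor on \<open>C\<close>. A large \<open>R\<close> makes the term in
  \<open>C\<close> small, which is the source of equicontinuity.\<close>

lemma dual_bound_variation:
  assumes R: "0 < R"
  obtains B where "0 \<le> B" "\<And>c C I. continuous_on {0..T} c \<Longrightarrow> dual_bound c C \<Longrightarrow> intervals 0 T I \<Longrightarrow>
     R * (\<Sum>(s, t)\<in>I. dist (c s) (c t)) \<le> C + B * (\<Sum>(s, t)\<in>I. t - s)"
proof -
  obtain B where B: "0 \<le> B" "\<And>x t p. t \<in> {0..T} \<Longrightarrow> norm p \<le> R \<Longrightarrow> \<bar>H x t p\<bar> \<le> B"
    using H_bounded by blast
  have "R * (\<Sum>(s, t)\<in>I. dist (c s) (c t)) \<le> C + B * (\<Sum>(s, t)\<in>I. t - s)"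
    if c: "continuous_on {0..T} c" and db: "dual_bound c C" and I: "intervals 0 T I" for c C I
  proof -
    \<comment> \<open>the slopes \<open>p\<close> of length \<open>R\<close> that turn \<open>defect\<close> into \<open>R\<close> times the variation\<close>
    define p where "p = (\<lambda>(s, t). R *\<^sub>R sgn (c t - c s))"
    have "R * dist (c s) (c t) - B * (t - s) \<le> defect c (p (s, t)) s t" if st: "(s, t) \<in> I" for s t
    proof -
      have st': "0 \<le> s" "s \<le> t" "t \<le> T" using intervalsD[OF I] st by auto
      have "integral {s..t} (\<lambda>\<tau>. H (to_torus (c \<tau>)) \<tau> (p (s, t)) - K) \<le> integral {s..t} (\<lambda>\<tau>. B)"
      proof (rule integral_le[OF integrable_H_curve[OF c st'(1,3)]])
        fix \<tau> assume "\<tau> \<in> {s..t}"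
        then have "\<tau> \<in> {0..T}" using st' by auto
        moreover have "norm (p (s, t)) \<le> R" using R by (simp add: p_def norm_sgn)
        ultimately show "H (to_torus (c \<tau>)) \<tau> (p (s, t)) - K \<le> B" using B(2)[of \<tau> "p (s, t)" "to_torus (c \<tau>)"] K(1) by auto
      qed auto
      moreover have "p (s, t) \<bullet> (c t - c s) = R * dist (c s) (c t)"
      proof (cases "c t = c s")
        case False
        then have "sgn (c t - c s) \<bullet> (c t - c s) = norm (c t - c s)"
          by (simp add: sgn_div_norm power2_norm_eq_inner[symmetric] power2_eq_square)
        then show ?thesis by (simp add: p_def dist_norm norm_minus_commute)
      qed (simp add: p_def)
      ultimately show ?thesis using st' by (simp add: defect_def mult.commute)
    qed
    then have "(\<Sum>(s, t)\<in>I. R * dist (c s) (c t) - B * (t - s)) \<le> (\<Sum>(s, t)\<in>I. defect c (p (s, t)) s t)"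
      by (intro sum_mono) auto
    also have "\<dots> \<le> C" by (rule dual_boundD[OF db I])
    finally have "(\<Sum>(s, t)\<in>I. R * dist (c s) (c t) - B * (t - s)) \<le> C" .
    note le = this
    show "R * (\<Sum>(s, t)\<in>I. dist (c s) (c t)) \<le> C + B * (\<Sum>(s, t)\<in>I. t - s)"
    proof -
      have "(\<Sum>z\<in>I. R * f z - B * g z) = R * sum f I - B * sum g I" for f g :: "real \<times> real \<Rightarrow> real"
        by (simp add: sum_subtractf sum_distrib_left)
      from this[of "\<lambda>(s, t). dist (c s) (c t)" "\<lambda>(s, t). t - s"] le show ?thesis
        by (simp add: split_beta)
    qed
  qed
  with B(1) show thesis by (rule that)
qed

lemma dual_bound_equicontinuous:
  assumes e: "0 < e"
  obtains d where "0 < d" "\<And>c I. continuous_on {0..T} c \<Longrightarrow> dual_bound c C \<Longrightarrow> intervals 0 T I \<Longrightarrow>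
     (\<Sum>(s, t)\<in>I. t - s) < d \<Longrightarrow> (\<Sum>(s, t)\<in>I. dist (c s) (c t)) < e"
proof -
  \<comment> \<open>Chosen so that \<open>\<bar>C\<bar> + 1\<close> is half of \<open>R * e\<close>;
    below, \<open>d\<close> keeps the term in \<open>B\<close> under 1.\<close>
  define R where "R = 2 * (\<bar>C\<bar> + 1) / e"
  have R: "0 < R" using e by (simp add: R_def)
  obtain B where B: "0 \<le> B" "\<And>c C I. continuous_on {0..T} c \<Longrightarrow> dual_bound c C \<Longrightarrow> intervals 0 T I \<Longrightarrow>
     R * (\<Sum>(s, t)\<in>I. dist (c s) (c t)) \<le> C + B * (\<Sum>(s, t)\<in>I. t - s)"
    using dual_bound_variation[OF R] by blast
  define d where "d = 1 / (B + 1)"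
  have d: "0 < d" using B(1) by (simp add: d_def)
  have "(\<Sum>(s, t)\<in>I. dist (c s) (c t)) < e"
    if c: "continuous_on {0..T} c" and db: "dual_bound c C" and I: "intervals 0 T I"
      and small: "(\<Sum>(s, t)\<in>I. t - s) < d" for c I
  proof -
    have "R * (\<Sum>(s, t)\<in>I. dist (c s) (c t)) \<le> C + B * (\<Sum>(s, t)\<in>I. t - s)" by (rule B(2)[OF c db I])
    also have "B * (\<Sum>(s, t)\<in>I. t - s) \<le> B * d" using small B(1) by (intro mult_left_mono) auto
    also have "B * d < 1" using B(1) by (simp add: d_def)
    finally have "R * (\<Sum>(s, t)\<in>I. dist (c s) (c t)) < \<bar>C\<bar> + 1" by simp
    also have "\<dots> < R * e" using e by (simp add: R_def)
    finally show ?thesis using R by simp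
  qed
  with d show thesis by (rule that)
qed

lemma dual_bound_imp_abs_continuous:
  assumes "continuous_on {0..T} c" "dual_bound c C"
  shows "abs_continuous_on 0 T c"
  unfolding abs_continuous_on_alt
proof (intro allI impI)
  fix e :: real assume "0 < e"
  then obtain d where "0 < d" "\<And>c I. continuous_on {0..T} c \<Longrightarrow> dual_bound c C \<Longrightarrow> intervals 0 T I \<Longrightarrow>
     (\<Sum>(s, t)\<in>I. t - s) < d \<Longrightarrow> (\<Sum>(s, t)\<in>I. dist (c s) (c t)) < e"
    using dual_bound_equicontinuous by blast
  then show "\<exists>\<delta>>0. \<forall>I. intervals 0 T I \<and> (\<Sum>(s, t)\<in>I. t - s) < \<delta> \<longrightarrow> (\<Sum>(s, t)\<in>I. dist (c s) (c t)) < e"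
    using assms by blast
qed

end



section \<open>Extended integrals of functions bounded below\<close>

lemma ex_max_atMost: "\<exists>m\<le>n. \<forall>i\<le>n. g i \<le> (g m :: real)" for n :: nat
proof -
  obtain m where "m \<in> {..n}" "\<And>i. i \<in> {..n} \<Longrightarrow> g i \<le> g m"
    using Max_in[of "g ` {..n}"] Max_ge[of "g ` {..n}"] by fastforce
  then show ?thesis by auto
qed

text \<open>Pointwise, f + k plus the negative part of f is the positive part plus k. The negative
  part has integral at most k m, which is finite, so it can be subtracted even when the positive
  part has infinite integral.\<close>

lemma ereal_integral_shift:
  assumes f: "f \<in> borel_measurable M" and lower: "\<And>x. x \<in> space M \<Longrightarrow> ereal (- k) \<le> f x"
    and k: "0 \<le> k" and m: "emeasure M (space M) = ennreal m" "0 \<le> m"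
  shows "ereal_integral M f = enn2ereal (\<integral>\<^sup>+x. e2ennreal (f x + ereal k) \<partial>M) - ereal (k * m)"
proof -
  note [measurable] = f
  define P N S where "P = (\<integral>\<^sup>+x. e2ennreal (f x) \<partial>M)" and "N = (\<integral>\<^sup>+x. e2ennreal (- f x) \<partial>M)"
    and "S = (\<integral>\<^sup>+x. e2ennreal (f x + ereal k) \<partial>M)"
  have pw: "e2ennreal (f x + ereal k) + e2ennreal (- f x) = e2ennreal (f x) + ennreal k" if "x \<in> space M" for x
    using lower[OF that] k
    by (cases "f x"; cases "f x \<ge> 0") (auto simp: ennreal_plus[symmetric] ennreal_neg ennreal_plus_if simp del: ennreal_plus)
  have "S + N = (\<integral>\<^sup>+x. e2ennreal (f x + ereal k) + e2ennreal (- f x) \<partial>M)"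
    unfolding S_def N_def by (rule nn_integral_add[symmetric]) auto
  also have "\<dots> = (\<integral>\<^sup>+x. e2ennreal (f x) + ennreal k \<partial>M)" by (rule nn_integral_cong) (rule pw)
  also have "\<dots> = P + ennreal (k * m)"
    unfolding P_def using k m by (subst nn_integral_add) (auto simp: ennreal_mult')
  finally have SN: "S + N = P + ennreal (k * m)" .
  have "N \<le> (\<integral>\<^sup>+x. ennreal k \<partial>M)"
    unfolding N_def
  proof (rule nn_integral_mono)
    fix x assume "x \<in> space M"
    then have "- f x \<le> ereal k" using lower[of x] by (cases "f x") auto
    then show "e2ennreal (- f x) \<le> ennreal k" using e2ennreal_mono by fastforce
  qed
  also have "\<dots> < \<infinity>" using m k by (simp add: ennreal_mult'[symmetric])
  finally obtain r where r: "N = ennreal r" "0 \<le> r" by (cases N) auto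
  have "enn2ereal P - enn2ereal N = enn2ereal S - ereal (k * m)"
  proof (cases S)
    case (real s)
    then have "P \<noteq> \<top>" using SN r by (metis ennreal_add_eq_top ennreal_neq_top)
    then obtain p where p: "P = ennreal p" "0 \<le> p" by (cases P) auto
    have "ennreal (s + r) = ennreal (p + k * m)" using SN real r p k m by simp
    then have "s + r = p + k * m" using real r p k m by (subst (asm) ennreal_inj) auto
    then show ?thesis using real r p by simp
  next
    case top
    then have "P = \<top>" using SN by (metis ennreal_add_eq_top ennreal_neq_top top_add)
    then show ?thesis using top r by simp
  qed
  then show ?thesis by (simp add: ereal_integral_def P_def N_def S_def)
qed

lemma ereal_integral_cong_AE:
  assumes "AE x in M. f x = g x"
  shows "ereal_integral M f = ereal_integral M g"
proof -
  have "(\<integral>\<^sup>+x. e2ennreal (f x) \<partial>M) = (\<integral>\<^sup>+x. e2ennreal (g x) \<partial>M)"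
    "(\<integral>\<^sup>+x. e2ennreal (- f x) \<partial>M) = (\<integral>\<^sup>+x. e2ennreal (- g x) \<partial>M)"
    using assms by (auto intro!: nn_integral_cong_AE)
  then show ?thesis by (simp add: ereal_integral_def)
qed

lemma AE_lebesgue_on_not_in:
  assumes "N \<in> null_sets lebesgue" "S \<in> sets lebesgue"
  shows "AE x in lebesgue_on S. x \<notin> N"
proof -
  have "AE x in lebesgue. x \<in> S \<longrightarrow> x \<notin> N" using AE_not_in[OF assms(1)] by (rule eventually_mono) simp
  then show ?thesis using assms(2) by (subst AE_restrict_space_iff) auto
qed

section \<open>From the dual bound back to the energy, and passage to limits\<close>

context superlinear_hamiltonian
begin

text \<open>As an increment of one fixed function the defect falls under
  \<open>straddle_quotient_tendsto\<close>.\<close>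

lemma defect_primitive:
  assumes c: "continuous_on {0..T} c" and st: "0 \<le> s" "s \<le> t" "t \<le> T"
  shows "defect c p s t = (p \<bullet> c t - integral {0..t} (\<lambda>\<tau>. H (to_torus (c \<tau>)) \<tau> p - K))
    - (p \<bullet> c s - integral {0..s} (\<lambda>\<tau>. H (to_torus (c \<tau>)) \<tau> p - K))"
  using Henstock_Kurzweil_Integration.integral_combine[OF st(1,2) integrable_H_curve[OF c order_refl st(3), of p]]
  by (simp add: defect_def inner_diff_right)

lemma defect_quotient_tendsto:
  assumes c: "continuous_on {0..T} c" and \<tau>: "\<tau> \<in> {0..T}"
    and q: "(c has_vector_derivative q) (at \<tau> within {0..T})"
    and uv: "\<And>n. u n \<in> {0..T}" "\<And>n. v n \<in> {0..T}" "\<And>n. u n \<le> \<tau>" "\<And>n. \<tau> \<le> v n" "\<And>n. u n < v n"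
    and lim: "(\<lambda>n. v n - u n) \<longlonglongrightarrow> 0"
  shows "(\<lambda>n. defect c p (u n) (v n) / (v n - u n)) \<longlonglongrightarrow> p \<bullet> q - (H (to_torus (c \<tau>)) \<tau> p - K)"
proof -
  have "((\<lambda>x. p \<bullet> c x) has_vector_derivative p \<bullet> q) (at \<tau> within {0..T})"
    by (rule bounded_linear.has_vector_derivative[OF bounded_linear_inner_right q])
  then have "((\<lambda>x. p \<bullet> c x - integral {0..x} (\<lambda>\<tau>. H (to_torus (c \<tau>)) \<tau> p - K)) has_vector_derivative
      p \<bullet> q - (H (to_torus (c \<tau>)) \<tau> p - K)) (at \<tau> within {0..T})"
    by (intro has_vector_derivative_diff integral_has_vector_derivative[OF continuous_on_H_curve[OF c] \<tau>])
  from straddle_quotient_tendsto[OF this uv lim] show ?thesis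
    using uv by (subst defect_primitive[OF c]) (auto intro: less_imp_le)
qed

text \<open>Families need not cover \<open>{0..T}\<close>, so intervals with nonpositive defect may
  be dropped. Hence the bound holds for the sum of positive parts, which is what
  \<open>ennreal\<close> computes.\<close>

lemma dual_bound_choice:
  assumes db: "dual_bound c C" and h: "0 < h" "real n * h = T"
  shows "(\<Sum>j<n. ennreal (defect c (p j) (real j * h) (real (Suc j) * h))) \<le> ennreal C"
proof -
  let ?f = "\<lambda>j. defect c (p j) (real j * h) (real (Suc j) * h)"
  let ?J = "{j. j < n \<and> 0 < ?f j}"
  define i where "i j = (real j * h, real (Suc j) * h)" for j
  have inj: "inj i" using h by (auto simp: i_def inj_on_def)
  \<comment> \<open>\<open>dual_bound\<close> indexes slopes by intervals, so those given by
    position are transported along the injection \<open>i\<close>.\<close>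
  define P where "P z = p (inv i z)" for z
  have I: "intervals 0 T (i ` ?J)"
    unfolding intervals_def
  proof (intro conjI ballI)
    fix z assume "z \<in> i ` ?J"
    then obtain j where j: "z = i j" "j < n" by auto
    have "real (Suc j) * h \<le> real n * h" using h j by (intro mult_right_mono) auto
    then show "case z of (s, t) \<Rightarrow> 0 \<le> s \<and> s \<le> t \<and> t \<le> T" using h j by (simp add: i_def distrib_right)
  next
    have disj: "{real j * h<..<real (Suc j) * h} \<inter> {real j' * h<..<real (Suc j') * h} = {}" if "j < j'" for j j'
    proof -
      have "real (Suc j) * h \<le> real j' * h" using h that by (intro mult_right_mono) auto
      then show ?thesis by fastforce
    qed
    show "disjoint_family_on (\<lambda>(s, t). {s<..<t}) (i ` ?J)"
      unfolding disjoint_family_on_def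
    proof (intro ballI impI)
      fix z w assume "z \<in> i ` ?J" "w \<in> i ` ?J" "z \<noteq> w"
      then obtain j j' where "z = i j" "w = i j'" "j \<noteq> j'" by auto
      then show "(case z of (s, t) \<Rightarrow> {s<..<t}) \<inter> (case w of (s, t) \<Rightarrow> {s<..<t}) = {}"
        using disj[of j j'] disj[of j' j] by (cases "j < j'") (auto simp: i_def simp del: of_nat_Suc)
    qed
  qed auto
  have "(\<Sum>j<n. ennreal (?f j)) = (\<Sum>j\<in>?J. ennreal (?f j))"
    by (rule sum.mono_neutral_right) (auto intro: ennreal_neg)
  also have "\<dots> = ennreal (\<Sum>j\<in>?J. ?f j)" by (rule sum_ennreal) auto
  also have "(\<Sum>j\<in>?J. ?f j) = (\<Sum>(s, t)\<in>i ` ?J. defect c (P (s, t)) s t)"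
  proof (subst sum.reindex)
    show "inj_on i ?J" using inj by (rule inj_on_subset) simp
    show "(\<Sum>j\<in>?J. ?f j) = sum ((\<lambda>(s, t). defect c (P (s, t)) s t) \<circ> i) ?J"
    proof (rule sum.cong)
      fix j
      have "P (i j) = p j" using inj by (simp add: P_def)
      then show "?f j = ((\<lambda>(s, t). defect c (P (s, t)) s t) \<circ> i) j" by (simp add: i_def del: of_nat_Suc)
    qed simp
  qed
  also have "ennreal \<dots> \<le> ennreal C" by (intro ennreal_leI dual_boundD[OF db I])
  finally show ?thesis .
qed

text \<open>The optimal slope on each interval of a uniform partition is chosen among the first members
  of a dense sequence. As the mesh tends to zero, the difference quotients of \<open>c\<close> converge to its
  velocity almost everywhere, and Fatou's lemma applies.\<close>

lemma dual_bound_imp_energy: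
  assumes c: "continuous_on {0..T} c" and db: "dual_bound c C"
  shows "energy c \<le> ennreal C"
proof -
  have ac: "abs_continuous_on 0 T c" by (rule dual_bound_imp_abs_continuous[OF c db])
  define h where "h n = T / real (Suc n)" for n
  have h: "0 < h n" "real (Suc n) * h n = T" for n using T_pos by (simp_all add: h_def)
  let ?f = "\<lambda>n j i. defect c (dense_seq i) (real j * h n) (real (Suc j) * h n)"
  \<comment> \<open>At stage n only slopes up to index n compete, so each cell has a best one; every
    fixed slope takes part from some stage on.\<close>
  have "\<forall>n j. \<exists>m\<le>n. \<forall>i\<le>n. ?f n j i \<le> ?f n j m" by (intro allI ex_max_atMost)
  then obtain m where m: "\<And>n j i. i \<le> n \<Longrightarrow> ?f n j i \<le> ?f n j (m n j)" by metis
  \<comment> \<open>Best average defect on each cell. The cells are half-open, so a time before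
    \<open>T\<close> lies in exactly one of them.\<close>
  define \<psi> where "\<psi> n \<tau> = (\<Sum>j<Suc n. ennreal (?f n j (m n j) / h n) * indicator {real j * h n..<real (Suc j) * h n} \<tau>)" for n \<tau>
  have meas: "{real j * h n..<real (Suc j) * h n} \<in> sets (lebesgue_on {0..T})"
    and em: "emeasure (lebesgue_on {0..T}) {real j * h n..<real (Suc j) * h n} = ennreal (h n)" if "j < Suc n" for j n
  proof -
    have "real (Suc j) * h n \<le> real (Suc n) * h n" using h(1)[of n] that by (intro mult_right_mono) auto
    then have "real (Suc j) * h n \<le> T" "0 \<le> real j * h n" using h[of n] by auto
    then have sub: "{real j * h n..<real (Suc j) * h n} \<subseteq> {0..T}" by fastforce
    show "{real j * h n..<real (Suc j) * h n} \<in> sets (lebesgue_on {0..T})"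
      using sub by (auto simp: sets_restrict_space image_iff intro!: bexI[of _ "{real j * h n..<real (Suc j) * h n}"])
    show "emeasure (lebesgue_on {0..T}) {real j * h n..<real (Suc j) * h n} = ennreal (h n)"
      using sub h(1)[of n] by (subst emeasure_restrict_space) (auto simp: algebra_simps)
  qed
  have meas\<psi>: "\<psi> n \<in> borel_measurable (lebesgue_on {0..T})" for n
    unfolding \<psi>_def by (intro borel_measurable_sum borel_measurable_times_ennreal measurable_const borel_measurable_indicator)
      (auto intro!: meas simp del: of_nat_Suc)
  have int: "(\<integral>\<^sup>+\<tau>. \<psi> n \<tau> \<partial>lebesgue_on {0..T}) \<le> ennreal C" for n
  proof -
    have "(\<integral>\<^sup>+\<tau>. \<psi> n \<tau> \<partial>lebesgue_on {0..T}) = (\<Sum>j<Suc n. ennreal (?f n j (m n j) / h n) * ennreal (h n))"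
      unfolding \<psi>_def using meas em
      by (subst nn_integral_sum) (auto intro!: sum.cong borel_measurable_times_ennreal measurable_const borel_measurable_indicator
        simp: nn_integral_cmult_indicator simp del: of_nat_Suc sum.lessThan_Suc)
    also have "\<dots> = (\<Sum>j<Suc n. ennreal (?f n j (m n j)))"
      using h(1)[of n] by (intro sum.cong refl) (simp add: ennreal_mult''[symmetric] less_imp_le del: of_nat_Suc)
    also have "\<dots> \<le> ennreal C" by (rule dual_bound_choice[OF db h])
    finally show ?thesis .
  qed
  have pw: "ennreal (L (to_torus (c \<tau>)) \<tau> (vector_derivative c (at \<tau> within {0..T})) + K) \<le> liminf (\<lambda>n. \<psi> n \<tau>)"
    if \<tau>: "\<tau> \<in> {0..T}" "\<tau> \<noteq> T" "c differentiable (at \<tau>)" for \<tau>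
  proof -
    let ?q = "vector_derivative c (at \<tau> within {0..T})"
    have q: "(c has_vector_derivative ?q) (at \<tau> within {0..T})"
      using \<tau>(3) by (simp add: vector_derivative_works[symmetric] differentiable_at_withinI)
    \<comment> \<open>Index of the cell containing \<tau>; the final time is excluded because it
      belongs to no half-open cell.\<close>
    define j where "j n = nat \<lfloor>\<tau> / h n\<rfloor>" for n
    have j: "real (j n) * h n \<le> \<tau>" "\<tau> < real (Suc (j n)) * h n" "j n < Suc n" for n
    proof -
      have nn: "0 \<le> \<tau> / h n" using \<tau>(1) h(1)[of n] by simp
      then have jn: "real (j n) \<le> \<tau> / h n" "\<tau> / h n < real (Suc (j n))" by (auto simp: j_def) linarith+
      then show 1: "real (j n) * h n \<le> \<tau>" "\<tau> < real (Suc (j n)) * h n"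
        using h(1)[of n] by (auto simp: pos_le_divide_eq pos_divide_less_eq)
      have "real (j n) * h n < real (Suc n) * h n" using 1 h(2)[of n] \<tau> by simp
      then show "j n < Suc n" using h(1)[of n] by (simp del: of_nat_Suc)
    qed
    show ?thesis
      unfolding ennreal_L_eq_SUP[OF \<tau>(1)]
    proof (rule SUP_least)
      fix i
      let ?u = "\<lambda>n. real (j n) * h n" and ?v = "\<lambda>n. real (Suc (j n)) * h n"
      have vu: "?v n - ?u n = h n" for n by (simp add: algebra_simps)
      have vT: "?v n \<le> T" for n
      proof -
        have "?v n \<le> real (Suc n) * h n" using j(3)[of n] h(1)[of n] by (intro mult_right_mono) auto
        then show ?thesis using h(2)[of n] by simp
      qed
      have "h \<longlonglongrightarrow> 0" unfolding h_def by (rule lim_const_over_n[THEN LIMSEQ_Suc])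
      then have "(\<lambda>n. defect c (dense_seq i) (?u n) (?v n) / (?v n - ?u n))
          \<longlonglongrightarrow> dense_seq i \<bullet> ?q - (H (to_torus (c \<tau>)) \<tau> (dense_seq i) - K)"
      proof (intro defect_quotient_tendsto[OF c \<tau>(1) q])
        fix n
        show "?u n \<le> \<tau>" "\<tau> \<le> ?v n" using j[of n] by auto
        show "?u n < ?v n" using j[of n] by linarith
        show "?v n \<in> {0..T}" using vT[of n] h(1)[of n] by (auto simp del: of_nat_Suc)
        show "?u n \<in> {0..T}" using j(1)[of n] \<tau>(1) h(1)[of n] by auto
      qed (simp only: vu)
      then have "(\<lambda>n. ennreal (?f n (j n) i / h n))
          \<longlonglongrightarrow> ennreal (dense_seq i \<bullet> ?q - (H (to_torus (c \<tau>)) \<tau> (dense_seq i) - K))"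
        unfolding vu by (rule tendsto_ennrealI)
      then have "ennreal (dense_seq i \<bullet> ?q - (H (to_torus (c \<tau>)) \<tau> (dense_seq i) - K))
          = liminf (\<lambda>n. ennreal (?f n (j n) i / h n))"
        by (intro lim_imp_Liminf[symmetric]) auto
      also have "\<dots> \<le> liminf (\<lambda>n. \<psi> n \<tau>)"
      proof (rule Liminf_mono)
        have "ennreal (?f n (j n) i / h n) \<le> \<psi> n \<tau>" if "i \<le> n" for n
        proof -
          have "ennreal (?f n (j n) i / h n) \<le> ennreal (?f n (j n) (m n (j n)) / h n)"
            using m[OF that] h(1)[of n] by (intro ennreal_leI divide_right_mono) auto
          also have "\<dots> = ennreal (?f n (j n) (m n (j n)) / h n) * indicator {?u n..<?v n} \<tau>"
            using j[of n] by simp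
          also have "\<dots> \<le> \<psi> n \<tau>"
            unfolding \<psi>_def using j(3)[of n]
            by (intro member_le_sum[where f = "\<lambda>j. ennreal (?f n j (m n j) / h n) * indicator {real j * h n..<real (Suc j) * h n} \<tau>"]) auto
          finally show ?thesis .
        qed
        then show "\<forall>\<^sub>F n in sequentially. ennreal (?f n (j n) i / h n) \<le> \<psi> n \<tau>"
          unfolding eventually_sequentially by blast
      qed
      finally show "ennreal (dense_seq i \<bullet> ?q - (H (to_torus (c \<tau>)) \<tau> (dense_seq i) - K)) \<le> liminf (\<lambda>n. \<psi> n \<tau>)" .
    qed
  qed
  let ?N = "{\<tau>\<in>{0..T}. \<not> c differentiable (at \<tau>)} \<union> {T}"
  have "?N \<in> null_sets lebesgue"
    using abs_continuous_differentiable_ae[OF ac] by (simp add: negligible_iff_null_sets[symmetric] negligible_Un)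
  then have "AE \<tau> in lebesgue_on {0..T}. \<tau> \<notin> ?N"
    by (rule AE_lebesgue_on_not_in) simp
  then have "AE \<tau> in lebesgue_on {0..T}.
      ennreal (L (to_torus (c \<tau>)) \<tau> (vector_derivative c (at \<tau> within {0..T})) + K) \<le> liminf (\<lambda>n. \<psi> n \<tau>)"
    using AE_space by eventually_elim (use pw in auto)
  then have "energy c \<le> (\<integral>\<^sup>+\<tau>. liminf (\<lambda>n. \<psi> n \<tau>) \<partial>lebesgue_on {0..T})"
    unfolding energy_def by (rule nn_integral_mono_AE)
  also have "\<dots> \<le> liminf (\<lambda>n. \<integral>\<^sup>+\<tau>. \<psi> n \<tau> \<partial>lebesgue_on {0..T})" by (rule nn_integral_liminf[OF meas\<psi>])
  also have "\<dots> \<le> liminf (\<lambda>n. ennreal C)" by (rule Liminf_mono) (use int in simp)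
  also have "\<dots> = ennreal C" by (rule Liminf_const) simp
  finally show ?thesis .
qed

lemma dual_bound_iff:
  assumes "continuous_on {0..T} c"
  shows "dual_bound c C \<longleftrightarrow> abs_continuous_on 0 T c \<and> 0 \<le> C \<and> energy c \<le> ennreal C"
  using dual_bound_imp_abs_continuous[OF assms] dual_bound_imp_energy[OF assms] dual_bound_nonneg
    energy_imp_dual_bound by blast

lemma defect_tendsto:
  assumes c: "\<And>n. continuous_on {0..T} (c n)" and lim: "\<And>t. t \<in> {0..T} \<Longrightarrow> (\<lambda>n. c n t) \<longlonglongrightarrow> c' t"
    and st: "0 \<le> s" "s \<le> t" "t \<le> T"
  shows "(\<lambda>n. defect (c n) p s t) \<longlonglongrightarrow> defect c' p s t"
proof -
  obtain B where B: "0 \<le> B" "\<And>x t p'. t \<in> {0..T} \<Longrightarrow> norm p' \<le> norm p \<Longrightarrow> \<bar>H x t p'\<bar> \<le> B"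
    using H_bounded by blast
  have "(\<lambda>n. integral {s..t} (\<lambda>\<tau>. H (to_torus (c n \<tau>)) \<tau> p - K)) \<longlonglongrightarrow> integral {s..t} (\<lambda>\<tau>. H (to_torus (c' \<tau>)) \<tau> p - K)"
  proof (rule dominated_convergence(2))
    show "(\<lambda>\<tau>. B + K) integrable_on {s..t}" by (rule integrable_const_ivl)
    fix n \<tau> assume "\<tau> \<in> {s..t}"
    then have \<tau>: "\<tau> \<in> {0..T}" using st by auto
    show "norm (H (to_torus (c n \<tau>)) \<tau> p - K) \<le> B + K"
      using B(2)[OF \<tau>, of p "to_torus (c n \<tau>)"] K(1) by auto
    have "continuous_on UNIV (\<lambda>a :: real ^ 'n. H (to_torus a) \<tau> p)"
      using \<tau> by (intro continuous_intros continuous_on_H) auto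
    then show "(\<lambda>n. H (to_torus (c n \<tau>)) \<tau> p - K) \<longlonglongrightarrow> H (to_torus (c' \<tau>)) \<tau> p - K"
      by (intro tendsto_diff tendsto_const continuous_on_tendsto_compose[OF _ lim[OF \<tau>]]) auto
  qed (rule integrable_H_curve[OF c st(1,3)])
  then show ?thesis
    unfolding defect_def using lim st by (intro tendsto_intros) auto
qed

lemma dual_bound_limit:
  assumes c: "\<And>n. continuous_on {0..T} (c n)" and lim: "\<And>t. t \<in> {0..T} \<Longrightarrow> (\<lambda>n. c n t) \<longlonglongrightarrow> c' t"
    and db: "\<forall>\<^sub>F n in sequentially. dual_bound (c n) C"
  shows "dual_bound c' C"
  unfolding dual_bound_def
proof (intro allI impI)
  fix I and p :: "real \<times> real \<Rightarrow> real ^ 'n" assume I: "intervals 0 T I"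
  have "(\<lambda>n. \<Sum>z\<in>I. case z of (s, t) \<Rightarrow> defect (c n) (p (s, t)) s t) \<longlonglongrightarrow>
      (\<Sum>z\<in>I. case z of (s, t) \<Rightarrow> defect c' (p (s, t)) s t)"
  proof (rule tendsto_sum)
    fix z assume z: "z \<in> I"
    obtain s t where st: "z = (s, t)" by (cases z)
    then show "(\<lambda>n. case z of (s, t) \<Rightarrow> defect (c n) (p (s, t)) s t) \<longlonglongrightarrow> (case z of (s, t) \<Rightarrow> defect c' (p (s, t)) s t)"
      using defect_tendsto[OF c lim, of s t "p (s, t)"] intervalsD(2-4)[OF I] z by simp
  qed
  moreover have "\<forall>\<^sub>F n in sequentially. (\<Sum>z\<in>I. case z of (s, t) \<Rightarrow> defect (c n) (p (s, t)) s t) \<le> C"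
    using db by eventually_elim (rule dual_boundD[OF _ I])
  ultimately show "(\<Sum>z\<in>I. case z of (s, t) \<Rightarrow> defect c' (p (s, t)) s t) \<le> C"
    by (rule tendsto_upperbound) simp
qed

section \<open>The action of a curve through its lift\<close>

lemma action_integral_eq_energy:
  assumes c: "lifts 0 T c \<zeta>" and ac: "abs_continuous_on 0 T c"
  shows "action_integral L 0 T \<zeta> = enn2ereal (energy c) - ereal (K * T)"
proof -
  let ?M = "lebesgue_on {0..T}"
  define l where "l s = L (to_torus (c s)) s (vector_derivative c (at s within {0..T}))" for s
  have "{\<tau>\<in>{0..T}. \<not> c differentiable (at \<tau>)} \<in> null_sets lebesgue" (is "?N \<in> _")
    using abs_continuous_differentiable_ae[OF ac] by (simp add: negligible_iff_null_sets)
  then have "AE s in ?M. s \<notin> ?N"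
    by (rule AE_lebesgue_on_not_in) simp
  then have "AE s in ?M. ereal (L (\<zeta> s) s (torus_velocity \<zeta> {0..T} s)) = ereal (l s)"
    using AE_space
  proof eventually_elim
    case (elim s)
    then have "(c has_vector_derivative vector_derivative c (at s within {0..T})) (at s within {0..T})"
      by (simp add: vector_derivative_works[symmetric] differentiable_at_withinI)
    then have "torus_velocity \<zeta> {0..T} s = vector_derivative c (at s within {0..T})"
      using elim by (intro torus_velocity_eq[OF T_pos c]) auto
    then show ?case using elim c by (simp add: l_def lifts_def)
  qed
  then have "action_integral L 0 T \<zeta> = ereal_integral ?M (\<lambda>s. ereal (l s))"
    unfolding action_integral_def by (rule ereal_integral_cong_AE)
  also have "\<dots> = enn2ereal (\<integral>\<^sup>+s. e2ennreal (ereal (l s) + ereal K) \<partial>?M) - ereal (K * T)"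
  proof (rule ereal_integral_shift)
    have "(\<lambda>s. enn2real (ennreal (l s + K)) - K) \<in> borel_measurable ?M"
      using measurable_L[OF ac, folded l_def] by measurable
    then have "l \<in> borel_measurable ?M"
      by (rule measurable_cong[THEN iffD1, rotated]) (use L_lower in \<open>auto simp: l_def\<close>)
    then show "(\<lambda>s. ereal (l s)) \<in> borel_measurable ?M" by measurable
    show "ereal (- K) \<le> ereal (l s)" if "s \<in> space ?M" for s
    proof -
      have "s \<in> {0..T}" using that by simp
      then show ?thesis using L_lower[of s "to_torus (c s)" "vector_derivative c (at s within {0..T})"] by (simp add: l_def)
    qed
    show "emeasure ?M (space ?M) = ennreal T" using T_pos by (simp add: emeasure_restrict_space)
  qed (use K(1) T_pos in auto)
  also have "(\<integral>\<^sup>+s. e2ennreal (ereal (l s) + ereal K) \<partial>?M) = energy c"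
    by (simp add: energy_def l_def)
  finally show ?thesis .
qed

text \<open>The form in which the duality is used from here on. It includes curves of infinite
  action that are not absolutely continuous: for them \<open>dual_bound\<close> fails with every
  constant.\<close>

lemma action_le_iff:
  assumes c: "lifts 0 T c \<zeta>"
  shows "action L T \<zeta> \<le> ereal r \<longleftrightarrow> dual_bound c (r + K * T)"
proof -
  have cc: "continuous_on {0..T} c" using c by (simp add: lifts_def)
  show ?thesis
  proof (cases "abs_continuous_on 0 T c")
    case True
    have "enn2ereal (energy c) - ereal (K * T) \<le> ereal r \<longleftrightarrow> 0 \<le> r + K * T \<and> energy c \<le> ennreal (r + K * T)"
    proof (cases "energy c")
      case (real e)
      then show ?thesis by (auto simp: ennreal_le_iff2)
    qed (auto simp: top_unique)
    then show ?thesis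
      using True abs_continuous_on_lift[OF c] dual_bound_iff[OF cc] action_integral_eq_energy[OF c]
      by (simp add: action_def)
  next
    case False
    then show ?thesis using abs_continuous_on_lift[OF c] dual_bound_iff[OF cc] by (simp add: action_def)
  qed
qed

end



subsection \<open>Compactness and the value function\<close>

context superlinear_hamiltonian
begin

text \<open>Arzela-Ascoli: the case R = 1 of \<open>dual_bound_variation\<close> keeps the lifts
  within a fixed distance of their starts in the unit cube, and equicontinuity is
  \<open>dual_bound_equicontinuous\<close>.\<close>

lemma dual_bound_subsequence:
  assumes c: "\<And>n. continuous_on {0..T} (c n)" and c0: "\<And>n. c n 0 \<in> cbox 0 1"
    and db: "\<And>n. dual_bound (c n) C"
  obtains k c' where "strict_mono (k :: nat \<Rightarrow> nat)" "continuous_on {0..T} c'"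
    "\<And>t. t \<in> {0..T} \<Longrightarrow> (\<lambda>n. c (k n) t) \<longlonglongrightarrow> c' t"
proof -
  obtain B where B: "0 \<le> B" "\<And>c C I. continuous_on {0..T} c \<Longrightarrow> dual_bound c C \<Longrightarrow> intervals 0 T I \<Longrightarrow>
     1 * (\<Sum>(s, t)\<in>I. dist (c s) (c t)) \<le> C + B * (\<Sum>(s, t)\<in>I. t - s)"
    using dual_bound_variation[OF zero_less_one] by blast
  obtain M where M: "\<And>x. x \<in> cbox (0 :: real ^ 'n) 1 \<Longrightarrow> norm x \<le> M"
    using bounded_cbox[of "0 :: real ^ 'n" 1] by (auto simp: bounded_iff)
  have "\<exists>c' k. continuous_on {0..T} c' \<and> strict_mono (k :: nat \<Rightarrow> nat) \<and>
      (\<forall>e>0. \<exists>N. \<forall>n x. n \<ge> N \<and> x \<in> {0..T} \<longrightarrow> norm (c (k n) x - c' x) < e)"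
  proof (rule Arzela_Ascoli[of "{0..T}" c "M + (C + B * T)"])
    fix n t assume t: "t \<in> {0..T}"
    have "dist (c n 0) (c n t) \<le> C + B * t"
      using B(2)[OF c[of n] db[of n], of "{(0, t)}"] t intervals_single[of 0 0 t T] by simp
    also have "\<dots> \<le> C + B * T" using t B(1) by (simp add: mult_left_mono)
    finally show "norm (c n t) \<le> M + (C + B * T)"
      using M[OF c0[of n]] norm_triangle_sub[of "c n t" "c n 0"] by (simp add: dist_norm norm_minus_commute)
  next
    fix x e :: real assume x: "x \<in> {0..T}" and e: "0 < e"
    obtain d where d: "0 < d" "\<And>c I. continuous_on {0..T} c \<Longrightarrow> dual_bound c C \<Longrightarrow> intervals 0 T I \<Longrightarrow>
        (\<Sum>(s, t)\<in>I. t - s) < d \<Longrightarrow> (\<Sum>(s, t)\<in>I. dist (c s) (c t)) < e"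
      using dual_bound_equicontinuous[OF e] by blast
    have "norm (c n x - c n y) < e" if "y \<in> {0..T}" "norm (x - y) < d" for n y
    proof (cases "x \<le> y")
      case True
      then show ?thesis using d(2)[OF c[of n] db[of n], of "{(x, y)}"] intervals_single[of 0 x y T] x that
        by (simp add: dist_norm)
    next
      case False
      then show ?thesis using d(2)[OF c[of n] db[of n], of "{(y, x)}"] intervals_single[of 0 y x T] x that
        by (simp add: dist_norm norm_minus_commute)
    qed
    then show "\<exists>d>0. \<forall>n y. y \<in> {0..T} \<and> norm (x - y) < d \<longrightarrow> norm (c n x - c n y) < e"
      using d(1) by blast
  qed (simp, blast)
  then obtain c' k where c': "continuous_on {0..T} c'" "strict_mono (k :: nat \<Rightarrow> nat)"
      "\<And>e. e > 0 \<Longrightarrow> \<exists>N. \<forall>n x. n \<ge> N \<and> x \<in> {0..T} \<longrightarrow> norm (c (k n) x - c' x) < e" by blast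
  have "(\<lambda>n. c (k n) t) \<longlonglongrightarrow> c' t" if "t \<in> {0..T}" for t
    using c'(3) that by (intro LIMSEQ_I) blast
  with c'(1,2) show thesis by (intro that)
qed

text \<open>A smaller action would satisfy a dual bound with negative constant, against the empty
  family.\<close>

lemma action_lower:
  assumes "continuous_on {0..T} \<zeta>"
  shows "ereal (- (K * T)) \<le> action L T \<zeta>"
proof -
  obtain c where c: "lifts 0 T c \<zeta>" using lift_exists[OF assms less_imp_le[OF T_pos]] by blast
  show ?thesis
  proof (rule ccontr)
    assume "\<not> ?thesis"
    then obtain r where r: "action L T \<zeta> < ereal r" "ereal r < ereal (- (K * T))"
      using ereal_dense2 by (metis not_le)
    then have "dual_bound c (r + K * T)" using action_le_iff[OF c] less_imp_le[OF r(1)] by blast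
    then have "0 \<le> r + K * T" by (rule dual_bound_nonneg)
    with r show False by simp
  qed
qed

text \<open>Constant curves serve as competitors from every point and bound the value function from
  above.\<close>

lemma action_const_bounded:
  obtains B where "\<And>x. action L T (\<lambda>_. x) \<le> ereal B"
proof -
  obtain B where B: "0 \<le> B" "\<And>x t q. t \<in> {0..T} \<Longrightarrow> norm q \<le> 0 \<Longrightarrow> L x t q \<le> B"
    using L_bounded by blast
  show thesis
  proof (rule that)
    fix x :: "'n torus"
    obtain a where a: "to_torus a = x" using to_torus_surj by blast
    have c: "lifts 0 T (\<lambda>_. a) (\<lambda>_. x)" using a by (simp add: lifts_def)
    have "energy (\<lambda>_. a) \<le> (\<integral>\<^sup>+s. ennreal (B + K) \<partial>lebesgue_on {0..T})"
      unfolding energy_def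
    proof (intro nn_integral_mono ennreal_leI)
      fix s assume "s \<in> space (lebesgue_on {0..T})"
      then have s: "s \<in> {0..T}" by simp
      have "vector_derivative (\<lambda>_. a) (at s within {0..T}) = 0"
        by (rule vector_derivative_within_closed_interval[OF T_pos]) (use s in auto)
      then show "L (to_torus a) s (vector_derivative (\<lambda>_. a) (at s within {0..T})) + K \<le> B + K"
        using B(2)[OF s] by simp
    qed
    also have "\<dots> = ennreal (B * T + K * T)"
      using T_pos B(1) K(1) by (simp add: emeasure_restrict_space ennreal_mult'[symmetric] distrib_right del: ennreal_plus)
    finally have "dual_bound (\<lambda>_. a) (B * T + K * T)"
      using B(1) K(1) T_pos by (subst dual_bound_iff) (auto simp: abs_continuous_on_alt intro: exI[of _ 1])
    then show "action L T (\<lambda>_. x) \<le> ereal (B * T)" by (simp add: action_le_iff[OF c])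
  qed
qed

text \<open>Once the curves are within 1/8 of the limit, \<open>lifts_near\<close> supplies lifts of
  the tail that converge pointwise, which is all that \<open>dual_bound_limit\<close> asks
  for.\<close>

lemma action_closed:
  assumes \<eta>: "\<And>n. continuous_on {0..T} (\<eta> n)" and \<zeta>: "continuous_on {0..T} \<zeta>"
    and lim: "\<And>e. 0 < e \<Longrightarrow> \<exists>N::nat. \<forall>n\<ge>N. \<forall>t\<in>{0..T}. dist (\<eta> n t) (\<zeta> t) < e"
    and le: "\<And>n. action L T (\<eta> n) \<le> ereal r"
  shows "action L T \<zeta> \<le> ereal r"
proof -
  obtain c where c: "lifts 0 T c \<zeta>" using lift_exists[OF \<zeta> less_imp_le[OF T_pos]] by blast
  have "\<exists>N. \<forall>n\<ge>N. \<forall>t\<in>{0..T}. dist (\<eta> n t) (\<zeta> t) < 1 / 8" by (rule lim) simp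
  then obtain N where N: "\<And>n t. n \<ge> N \<Longrightarrow> t \<in> {0..T} \<Longrightarrow> dist (\<eta> n t) (\<zeta> t) < 1 / 8" by blast
  have "\<exists>c'. lifts 0 T c' (\<eta> (n + N)) \<and> (\<forall>t\<in>{0..T}. dist (c t) (c' t) = dist (\<zeta> t) (\<eta> (n + N) t))" for n
    by (rule lifts_near[OF c \<eta>, of "n + N"]) (use N[of "n + N"] in \<open>auto simp: dist_commute\<close>)
  then obtain c' where c': "\<And>n. lifts 0 T (c' n) (\<eta> (n + N))"
    "\<And>n t. t \<in> {0..T} \<Longrightarrow> dist (c t) (c' n t) = dist (\<zeta> t) (\<eta> (n + N) t)" by metis
  have "(\<lambda>n. c' n t) \<longlonglongrightarrow> c t" if t: "t \<in> {0..T}" for t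
  proof (rule metric_LIMSEQ_I)
    fix e :: real assume "0 < e"
    then obtain N' where "\<And>n t. n \<ge> N' \<Longrightarrow> t \<in> {0..T} \<Longrightarrow> dist (\<eta> n t) (\<zeta> t) < e"
      using lim[of e] by blast
    then show "\<exists>no. \<forall>n\<ge>no. dist (c' n t) (c t) < e"
      using c'(2)[OF t] t by (intro exI[of _ N']) (auto simp: dist_commute)
  qed
  moreover have "dual_bound (c' n) (r + K * T)" for n using le action_le_iff[OF c'(1)] by blast
  ultimately have "dual_bound c (r + K * T)"
    using c'(1) by (intro dual_bound_limit[of c']) (auto simp: lifts_def)
  then show ?thesis using action_le_iff[OF c] by simp
qed

lemma continuous_torus_bounded:
  fixes g :: "'n torus \<Rightarrow> real"
  assumes "continuous_on UNIV g"
  obtains G where "0 \<le> G" "\<And>x. \<bar>g x\<bar> \<le> G"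
proof -
  have "continuous_on (cbox 0 1) (\<lambda>a :: real ^ 'n. g (to_torus a))"
    by (rule continuous_on_compose2[OF assms]) (auto intro!: continuous_intros)
  then have "bounded ((\<lambda>a :: real ^ 'n. g (to_torus a)) ` cbox 0 1)"
    by (intro compact_imp_bounded compact_continuous_image) auto
  then obtain G where G: "\<And>a :: real ^ 'n. a \<in> cbox 0 1 \<Longrightarrow> \<bar>g (to_torus a)\<bar> \<le> G"
    by (auto simp: bounded_iff)
  have "\<bar>g x\<bar> \<le> max 0 G" for x
    using unit_lift[of x] G by (metis max.coboundedI2)
  then show thesis by (intro that[of "max 0 G"]) auto
qed

text \<open>Serves two purposes: with a fixed start and levels decreasing to the infimum it yields a
  minimizer, and with a fixed level and convergent starts it shows that sublevel sets of the value
  function are closed.\<close>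

lemma value_compactness:
  assumes g: "continuous_on UNIV g" and \<eta>: "\<And>n. continuous_on {0..T} (\<eta> n)"
    and le: "\<And>n. ereal (g (\<eta> n T)) + action L T (\<eta> n) \<le> ereal (a n)"
    and a: "a \<longlonglongrightarrow> \<alpha>" and x: "(\<lambda>n. \<eta> n 0) \<longlonglongrightarrow> x"
  obtains \<zeta> where "\<zeta> \<in> curves T" "\<zeta> 0 = x" "ereal (g (\<zeta> T)) + action L T \<zeta> \<le> ereal \<alpha>"
proof -
  obtain G where G: "\<And>x. \<bar>g x\<bar> \<le> G" using continuous_torus_bounded[OF g] by blast
  obtain A where A: "\<And>n. \<bar>a n\<bar> \<le> A" using convergent_imp_Bseq[of a] a by (auto simp: convergent_def Bseq_def)
  have act: "action L T (\<eta> n) \<le> ereal (a n - g (\<eta> n T))" for n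
    using le[of n] by (cases "action L T (\<eta> n)") auto
  have "\<exists>c. lifts 0 T c (\<eta> n) \<and> c 0 \<in> cbox 0 1" for n
    using lift_exists[OF \<eta>[of n] less_imp_le[OF T_pos]] by blast
  then obtain c where c: "\<And>n. lifts 0 T (c n) (\<eta> n)" "\<And>n. c n 0 \<in> cbox 0 1" by metis
  then have cc: "\<And>n. continuous_on {0..T} (c n)" by (simp add: lifts_def)
  have "dual_bound (c n) (A + G + K * T)" for n
  proof -
    have "a n - g (\<eta> n T) \<le> A + G" using A[of n] G[of "\<eta> n T"] by linarith
    then have "action L T (\<eta> n) \<le> ereal (A + G)" using act[of n] order_trans by fastforce
    then show ?thesis using action_le_iff[OF c(1)] by blast
  qed
  then obtain k c' where k: "strict_mono (k :: nat \<Rightarrow> nat)" "continuous_on {0..T} c'"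
    "\<And>t. t \<in> {0..T} \<Longrightarrow> (\<lambda>n. c (k n) t) \<longlonglongrightarrow> c' t"
    using dual_bound_subsequence[of c, OF cc c(2)] by blast
  \<comment> \<open>Elements of \<open>curves T\<close> are extensional, hence the
    restriction.\<close>
  define \<zeta> where "\<zeta> = restrict (\<lambda>t. to_torus (c' t)) {0..T}"
  have l: "lifts 0 T c' \<zeta>" using k(2) by (simp add: lifts_def \<zeta>_def)
  have cont_torus: "continuous_on UNIV (to_torus :: real ^ 'n \<Rightarrow> _)" by (intro continuous_intros)
  have lim: "(\<lambda>n. \<eta> (k n) t) \<longlonglongrightarrow> \<zeta> t" if t: "t \<in> {0..T}" for t
  proof -
    have "(\<lambda>n. to_torus (c (k n) t)) \<longlonglongrightarrow> to_torus (c' t)"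
      by (rule continuous_on_tendsto_compose[OF cont_torus k(3)[OF t]]) auto
    then show ?thesis using c(1) l t by (simp add: lifts_def)
  qed
  have "continuous_on {0..T} (\<lambda>t. to_torus (c' t))" using k(2) by (intro continuous_intros)
  then have "continuous_on {0..T} \<zeta>" by (rule continuous_on_eq) (simp add: \<zeta>_def)
  then have "\<zeta> \<in> curves T" unfolding mem_curves_iff by (simp add: \<zeta>_def)
  moreover have "\<zeta> 0 = x"
    using LIMSEQ_unique[OF lim[of 0]] LIMSEQ_subseq_LIMSEQ[OF x k(1)] T_pos by (auto simp: o_def)
  moreover have "action L T \<zeta> \<le> ereal (\<alpha> - g (\<zeta> T))"
  \<comment> \<open>The bounds on the actions vary along the sequence, so a common bound holds only
    eventually and up to \<open>e\<close>.\<close>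
  proof (rule ereal_le_epsilon2)
    fix e :: real assume e: "0 < e"
    have "(\<lambda>n. a (k n) - g (\<eta> (k n) T)) \<longlonglongrightarrow> \<alpha> - g (\<zeta> T)"
      using T_pos by (intro tendsto_diff LIMSEQ_subseq_LIMSEQ[OF a k(1), unfolded o_def]
          continuous_on_tendsto_compose[OF g lim]) auto
    then have "\<forall>\<^sub>F n in sequentially. a (k n) - g (\<eta> (k n) T) < \<alpha> - g (\<zeta> T) + e"
      by (rule order_tendstoD) (use e in simp)
    then have "\<forall>\<^sub>F n in sequentially. dual_bound (c (k n)) (\<alpha> - g (\<zeta> T) + e + K * T)"
    proof eventually_elim
      case (elim n)
      then have "action L T (\<eta> (k n)) \<le> ereal (\<alpha> - g (\<zeta> T) + e)"
        using act[of "k n"] order_trans by fastforce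
      then show ?case using action_le_iff[OF c(1)] by blast
    qed
    then have "dual_bound c' (\<alpha> - g (\<zeta> T) + e + K * T)"
      using dual_bound_limit[of "\<lambda>n. c (k n)" c'] cc k(3) by blast
    then show "action L T \<zeta> \<le> ereal (\<alpha> - g (\<zeta> T)) + ereal e" using action_le_iff[OF l] by simp
  qed
  then have "ereal (g (\<zeta> T)) + action L T \<zeta> \<le> ereal \<alpha>"
    by (cases "action L T \<zeta>") auto
  ultimately show thesis by (rule that)
qed

section \<open>The Lax-Oleinik function at time 0\<close>

text \<open>The infimum is finite by \<open>action_lower\<close> and the constant curve, and a
  minimizing sequence has a limit curve by \<open>value_compactness\<close>. Only this attainment
  shows that \<open>LEAST\<close> in the definition denotes the infimum.\<close>

lemma lax_oleinik_attained:
  assumes g: "continuous_on UNIV g"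
  obtains \<zeta> where "\<zeta> \<in> curves T" "\<zeta> 0 = x"
    "ereal (lax_oleinik L T g x 0) = ereal (g (\<zeta> T)) + action L T \<zeta>"
    "\<And>\<eta>. continuous_on {0..T} \<eta> \<Longrightarrow> \<eta> 0 = x \<Longrightarrow>
      ereal (lax_oleinik L T g x 0) \<le> ereal (g (\<eta> T)) + action L T \<eta>"
proof -
  let ?J = "\<lambda>\<eta>. ereal (g (\<eta> T)) + action L T \<eta>"
  \<comment> \<open>All continuous curves compete; those that are not absolutely continuous have
    infinite action and leave the infimum unchanged.\<close>
  define A where "A = {\<eta>. continuous_on {0..T} \<eta> \<and> \<eta> 0 = x}"
  define i where "i = (INF \<eta>\<in>A. ?J \<eta>)"
  obtain G where G: "\<And>x. \<bar>g x\<bar> \<le> G" using continuous_torus_bounded[OF g] by blast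
  obtain B where B: "\<And>x. action L T (\<lambda>_. x) \<le> ereal B" using action_const_bounded by blast
  have constA: "(\<lambda>_. x) \<in> A" by (simp add: A_def)
  have "ereal (- G - K * T) \<le> i"
    unfolding i_def
  proof (rule INF_greatest)
    fix \<eta> assume "\<eta> \<in> A"
    then have "ereal (- (K * T)) \<le> action L T \<eta>" by (intro action_lower) (simp add: A_def)
    moreover have "- G \<le> g (\<eta> T)" using G[of "\<eta> T"] by linarith
    ultimately show "ereal (- G - K * T) \<le> ?J \<eta>" by (cases "action L T \<eta>") auto
  qed
  moreover have "i \<le> ereal (G + B)"
  proof -
    have "i \<le> ?J (\<lambda>_. x)" unfolding i_def by (rule INF_lower[OF constA])
    also have "\<dots> \<le> ereal (G + B)" using B[of x] G[of x] by (cases "action L T (\<lambda>_. x)") auto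
    finally show ?thesis .
  qed
  ultimately obtain v where v: "i = ereal v" by (cases i) auto
  have "\<exists>\<eta>\<in>A. ?J \<eta> \<le> ereal (v + 1 / real (Suc n))" for n
  proof -
    have "i < ereal (v + 1 / real (Suc n))" using v by simp
    then show ?thesis unfolding i_def INF_less_iff using less_imp_le by blast
  qed
  then obtain \<eta> where \<eta>: "\<And>n. \<eta> n \<in> A" "\<And>n. ?J (\<eta> n) \<le> ereal (v + 1 / real (Suc n))" by metis
  have lim: "(\<lambda>n. v + 1 / real (Suc n)) \<longlonglongrightarrow> v"
    using tendsto_add[OF tendsto_const[of v] LIMSEQ_Suc[OF lim_1_over_n]] by simp
  obtain \<zeta> where \<zeta>: "\<zeta> \<in> curves T" "\<zeta> 0 = x" "?J \<zeta> \<le> ereal v"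
    by (rule value_compactness[OF g _ \<eta>(2) lim, where x = x]) (use \<eta>(1) in \<open>auto simp: A_def\<close>)
  have \<zeta>A: "\<zeta> \<in> A" using \<zeta> by (simp add: A_def mem_curves_iff)
  have min: "ereal v \<le> ?J \<eta>" if "\<eta> \<in> A" for \<eta> unfolding v[symmetric] i_def by (rule INF_lower[OF that])
  have eq: "?J \<zeta> = ereal v" using \<zeta>(3) min[OF \<zeta>A] by (rule antisym)
  have ac: "abs_continuous_on 0 T \<zeta>" using eq by (auto simp: action_def split: if_splits)
  have "(LEAST m. m \<in> {ereal (g (\<zeta> T)) + action_integral L 0 T \<zeta> | \<zeta>. abs_continuous_on 0 T \<zeta> \<and> \<zeta> 0 = x}) = ereal v"
  proof (rule Least_equality)
    show "ereal v \<in> {ereal (g (\<zeta> T)) + action_integral L 0 T \<zeta> | \<zeta>. abs_continuous_on 0 T \<zeta> \<and> \<zeta> 0 = x}"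
      using eq ac \<zeta>(2) by (auto simp: action_def intro!: exI[of _ \<zeta>])
    fix m assume "m \<in> {ereal (g (\<zeta> T)) + action_integral L 0 T \<zeta> | \<zeta>. abs_continuous_on 0 T \<zeta> \<and> \<zeta> 0 = x}"
    then obtain \<eta> where "m = ereal (g (\<eta> T)) + action_integral L 0 T \<eta>" "abs_continuous_on 0 T \<eta>" "\<eta> 0 = x" by auto
    then show "ereal v \<le> m"
      using min[of \<eta>] abs_continuous_on_imp_continuous_on by (auto simp: A_def action_def)
  qed
  then have "lax_oleinik L T g x 0 = v" using T_pos by (simp add: lax_oleinik_def)
  then show thesis using \<zeta>(1,2) eq min by (intro that[of \<zeta>]) (auto simp: A_def)
qed

lemma lax_oleinik_le:
  assumes "continuous_on UNIV g" "continuous_on {0..T} \<eta>"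
  shows "ereal (lax_oleinik L T g (\<eta> 0) 0) \<le> ereal (g (\<eta> T)) + action L T \<eta>"
  using lax_oleinik_attained[OF assms(1), of "\<eta> 0"] assms(2) by metis

lemma lax_oleinik_bounded:
  assumes g: "continuous_on UNIV g"
  obtains V where "\<And>x. \<bar>lax_oleinik L T g x 0\<bar> \<le> V"
proof -
  obtain G where G: "\<And>x. \<bar>g x\<bar> \<le> G" using continuous_torus_bounded[OF g] by blast
  obtain B where B: "\<And>x. action L T (\<lambda>_. x) \<le> ereal B" using action_const_bounded by blast
  have "lax_oleinik L T g x 0 \<le> G + B" for x
    using lax_oleinik_le[OF g, of "\<lambda>_. x"] B[of x] G[of x] by (cases "action L T (\<lambda>_. x)") auto
  moreover have "- G - K * T \<le> lax_oleinik L T g x 0" for x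
  proof -
    obtain \<zeta> where \<zeta>: "\<zeta> \<in> curves T" "ereal (lax_oleinik L T g x 0) = ereal (g (\<zeta> T)) + action L T \<zeta>"
      using lax_oleinik_attained[OF g] by metis
    have "ereal (- (K * T)) \<le> action L T \<zeta>" using \<zeta>(1) by (intro action_lower) (simp add: mem_curves_iff)
    then show ?thesis using \<zeta>(2) G[of "\<zeta> T"] by (cases "action L T \<zeta>") auto
  qed
  ultimately show thesis by (intro that[of "\<bar>G + B\<bar> + \<bar>G + K * T\<bar>"]) (smt (verit))
qed

text \<open>Lower semicontinuity suffices: minimizers from convergent starting points have a limit
  curve that competes from the limit point.\<close>

lemma lax_oleinik_borel_measurable:
  assumes g: "continuous_on UNIV g"
  shows "(\<lambda>x. lax_oleinik L T g x 0) \<in> borel_measurable borel"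
  unfolding borel_measurable_iff_le
proof (intro allI)
  fix \<alpha> :: real
  have "closed {x. lax_oleinik L T g x 0 \<le> \<alpha>}"
    unfolding closed_sequential_limits
  proof (intro allI impI, elim conjE)
    fix x l assume x: "\<forall>n. x n \<in> {x. lax_oleinik L T g x 0 \<le> \<alpha>}" and l: "x \<longlonglongrightarrow> l"
    have "\<exists>\<eta>\<in>curves T. \<eta> 0 = x n \<and> ereal (g (\<eta> T)) + action L T \<eta> \<le> ereal \<alpha>" for n
    proof -
      obtain \<eta> where "\<eta> \<in> curves T" "\<eta> 0 = x n"
        "ereal (lax_oleinik L T g (x n) 0) = ereal (g (\<eta> T)) + action L T \<eta>"
        using lax_oleinik_attained[OF g] by metis
      then show ?thesis using x by (intro bexI[of _ \<eta>]) (auto simp flip: \<open>ereal (lax_oleinik L T g (x n) 0) = _\<close>)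
    qed
    then obtain \<eta> where \<eta>: "\<And>n. \<eta> n \<in> curves T" "\<And>n. \<eta> n 0 = x n"
      "\<And>n. ereal (g (\<eta> n T)) + action L T (\<eta> n) \<le> ereal \<alpha>" by metis
    obtain \<zeta> where \<zeta>: "\<zeta> \<in> curves T" "\<zeta> 0 = l" "ereal (g (\<zeta> T)) + action L T \<zeta> \<le> ereal \<alpha>"
      by (rule value_compactness[OF g _ \<eta>(3) tendsto_const, where x = l]) (use \<eta> l in \<open>auto simp: mem_curves_iff\<close>)
    then have "ereal (lax_oleinik L T g l 0) \<le> ereal \<alpha>"
      using order_trans[OF lax_oleinik_le[OF g, of \<zeta>] \<zeta>(3)] by (simp add: mem_curves_iff)
    then show "l \<in> {x. lax_oleinik L T g x 0 \<le> \<alpha>}" by simp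
  qed
  then show "{x \<in> space borel. lax_oleinik L T g x 0 \<le> \<alpha>} \<in> sets borel" by simp
qed

lemma optimal_curve_iff:
  assumes g: "continuous_on UNIV g" and \<zeta>: "\<zeta> \<in> curves T"
  shows "optimal_curve L T g \<zeta> \<longleftrightarrow> action L T \<zeta> = ereal (lax_oleinik L T g (\<zeta> 0) 0 - g (\<zeta> T))"
proof -
  let ?v = "lax_oleinik L T g (\<zeta> 0) 0"
  obtain \<eta> where \<eta>: "\<eta> \<in> curves T" "\<eta> 0 = \<zeta> 0" "ereal ?v = ereal (g (\<eta> T)) + action L T \<eta>"
    using lax_oleinik_attained[OF g] by metis
  have le: "ereal ?v \<le> ereal (g (\<theta> T)) + action L T \<theta>" if "\<theta> \<in> curves T" "\<theta> 0 = \<zeta> 0" for \<theta>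
    using lax_oleinik_le[OF g, of \<theta>] that by (simp add: mem_curves_iff)
  have "optimal_curve L T g \<zeta> \<longleftrightarrow> ereal (g (\<zeta> T)) + action L T \<zeta> = ereal ?v"
    unfolding optimal_curve_def is_arg_min_def
    using \<zeta> \<eta> le by (metis (no_types, lifting) antisym not_le)
  also have "\<dots> \<longleftrightarrow> action L T \<zeta> = ereal (?v - g (\<zeta> T))"
    by (cases "action L T \<zeta>") auto
  finally show ?thesis .
qed

end



subsection \<open>Measurability and optimal measures\<close>

lemma dist_le_mdist_curves:
  assumes "\<zeta> \<in> curves T" "\<eta> \<in> curves T" "t \<in> {0..T}"
  shows "dist (\<zeta> t) (\<eta> t) \<le> mdist (curve_metric T) \<zeta> \<eta>"
  using mdist_cfunspace_imp_mdist_le[OF assms(1,2)[unfolded curve_metric_def] order_refl, of t] assms(3)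
  by (simp add: curve_metric_def)

lemma space_borel_curves: "sets \<xi> = sets (borel_curves T) \<Longrightarrow> space \<xi> = curves T"
  by (drule sets_eq_imp_space_eq) (simp add: borel_curves_def space_measure_of_conv)

lemma sets_borel_curves_openin:
  assumes "openin (mtopology_of (curve_metric T)) U"
  shows "U \<in> sets (borel_curves T)"
proof -
  have "{U. openin (mtopology_of (curve_metric T)) U} \<subseteq> Pow (curves T)"
    using openin_subset by fastforce
  then show ?thesis using assms unfolding borel_curves_def by (subst sets_measure_of) (auto intro: sigma_sets.Basic)
qed

lemma sets_borel_curves_closedin:
  assumes "closedin (mtopology_of (curve_metric T)) U"
  shows "U \<in> sets (borel_curves T)"
proof -
  have U: "U \<subseteq> curves T" using closedin_subset[OF assms] by simp
  have "curves T - U \<in> sets (borel_curves T)"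
    using assms by (intro sets_borel_curves_openin) (simp add: closedin_def)
  then have "space (borel_curves T) - (curves T - U) \<in> sets (borel_curves T)" by (rule sets.compl_sets)
  also have "space (borel_curves T) - (curves T - U) = U"
    using U by (auto simp: space_borel_curves[OF refl])
  finally show ?thesis .
qed

lemma measurable_eval_curves:
  assumes t: "t \<in> {0..T}"
  shows "(\<lambda>\<zeta>. \<zeta> t) \<in> borel_measurable (borel_curves T)"
proof (rule borel_measurableI)
  interpret C: Metric_space "curves T" "mdist (curve_metric T)" by (rule Metric_space_mspace_mdist)
  fix S :: "'a torus set" assume S: "open S"
  have "openin C.mtopology ((\<lambda>\<zeta>. \<zeta> t) -` S \<inter> curves T)"
    unfolding C.openin_mtopology
  proof (intro conjI allI impI)
    fix \<zeta> assume \<zeta>: "\<zeta> \<in> (\<lambda>\<zeta>. \<zeta> t) -` S \<inter> curves T"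
    then obtain r where r: "0 < r" "ball (\<zeta> t) r \<subseteq> S" using S openE by blast
    have "C.mball \<zeta> r \<subseteq> (\<lambda>\<zeta>. \<zeta> t) -` S \<inter> curves T"
    proof
      fix \<eta> assume "\<eta> \<in> C.mball \<zeta> r"
      then have "\<eta> \<in> curves T" "mdist (curve_metric T) \<zeta> \<eta> < r" by auto
      then show "\<eta> \<in> (\<lambda>\<zeta>. \<zeta> t) -` S \<inter> curves T"
        using dist_le_mdist_curves[of \<zeta> T \<eta> t] t \<zeta> r by (auto simp: subset_iff)
    qed
    then show "\<exists>r>0. C.mball \<zeta> r \<subseteq> (\<lambda>\<zeta>. \<zeta> t) -` S \<inter> curves T" using r(1) by blast
  qed simp
  then show "(\<lambda>\<zeta>. \<zeta> t) -` S \<inter> space (borel_curves T) \<in> sets (borel_curves T)"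
    unfolding space_borel_curves[OF refl] by (intro sets_borel_curves_openin) (simp add: mtopology_of_def)
qed

section \<open>Comparing integrals on a probability space\<close>

lemma (in prob_space) ereal_integral_bounded:
  fixes w :: "'a \<Rightarrow> real"
  assumes w: "w \<in> borel_measurable M" and bound: "\<And>x. x \<in> space M \<Longrightarrow> \<bar>w x\<bar> \<le> k" and k: "0 \<le> k"
  shows "integrable M w" "ereal_integral M (\<lambda>x. ereal (w x)) = ereal (integral\<^sup>L M w)"
    "(\<integral>\<^sup>+x. ennreal (w x + k) \<partial>M) = ennreal (integral\<^sup>L M w + k)" "0 \<le> integral\<^sup>L M w + k"
proof -
  show int: "integrable M w" by (rule integrable_const_bound[of _ k]) (use w bound in auto)
  have nn: "AE x in M. 0 \<le> w x + k" using bound by (intro AE_I2) (smt (verit))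
  have sum: "integral\<^sup>L M (\<lambda>x. w x + k) = integral\<^sup>L M w + k" using int by (simp add: prob_space)
  have "integrable M (\<lambda>x. w x + k)" using int by simp
  then show nnint: "(\<integral>\<^sup>+x. ennreal (w x + k) \<partial>M) = ennreal (integral\<^sup>L M w + k)"
    using nn_integral_eq_integral[OF _ nn] sum by simp
  show nonneg: "0 \<le> integral\<^sup>L M w + k" using integral_nonneg_AE[OF nn] sum by simp
  have "ereal_integral M (\<lambda>x. ereal (w x)) = enn2ereal (\<integral>\<^sup>+x. e2ennreal (ereal (w x) + ereal k) \<partial>M) - ereal (k * 1)"
  proof (rule ereal_integral_shift)
    show "ereal (- k) \<le> ereal (w x)" if "x \<in> space M" for x using bound[OF that] by simp
  qed (use w k emeasure_space_1 in auto)
  then show "ereal_integral M (\<lambda>x. ereal (w x)) = ereal (integral\<^sup>L M w)"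
    using nnint nonneg by simp
qed

text \<open>A nonnegative function with integral 0 vanishes almost everywhere. The shift by
  \<open>k\<close> makes both functions nonnegative, so the difference can be formed in
  \<open>ennreal\<close>, where the finite integral of \<open>w\<close> may be subtracted.\<close>

lemma (in prob_space) ereal_integral_eq_imp_AE:
  assumes f: "f \<in> borel_measurable M" and w: "w \<in> borel_measurable M"
    and bound: "\<And>x. x \<in> space M \<Longrightarrow> \<bar>w x\<bar> \<le> k" and le: "\<And>x. x \<in> space M \<Longrightarrow> ereal (w x) \<le> f x"
    and eq: "ereal_integral M f = ereal (integral\<^sup>L M w)"
  shows "AE x in M. f x = ereal (w x)"
proof -
  have k: "0 \<le> k" using bound not_empty by (metis abs_ge_zero all_not_in_conv order_trans)
  note w_int = ereal_integral_bounded[OF w bound k]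
  have "ereal_integral M f = enn2ereal (\<integral>\<^sup>+x. e2ennreal (f x + ereal k) \<partial>M) - ereal (k * 1)"
  proof (rule ereal_integral_shift)
    show "ereal (- k) \<le> f x" if "x \<in> space M" for x
      using bound[OF that] by (intro order_trans[OF _ le[OF that]]) simp
  qed (use f k emeasure_space_1 in auto)
  then have "enn2ereal (\<integral>\<^sup>+x. e2ennreal (f x + ereal k) \<partial>M) = ereal (integral\<^sup>L M w + k)"
    using eq by (cases "\<integral>\<^sup>+x. e2ennreal (f x + ereal k) \<partial>M") auto
  then have F: "(\<integral>\<^sup>+x. e2ennreal (f x + ereal k) \<partial>M) = ennreal (integral\<^sup>L M w + k)"
    by (metis e2ennreal_enn2ereal e2ennreal_ereal)
  have mono: "ennreal (w x + k) \<le> e2ennreal (f x + ereal k)" if "x \<in> space M" for x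
    using e2ennreal_mono[OF add_right_mono[OF le[OF that], of "ereal k"]] by simp
  have "(\<integral>\<^sup>+x. e2ennreal (f x + ereal k) - ennreal (w x + k) \<partial>M)
      = (\<integral>\<^sup>+x. e2ennreal (f x + ereal k) \<partial>M) - (\<integral>\<^sup>+x. ennreal (w x + k) \<partial>M)"
    using f w mono w_int(3) by (intro nn_integral_diff) auto
  also have "\<dots> = 0" using F w_int(3) by simp
  finally have "AE x in M. e2ennreal (f x + ereal k) - ennreal (w x + k) = 0"
    using f w by (subst (asm) nn_integral_0_iff_AE) auto
  then show ?thesis
    using AE_space
  proof eventually_elim
    case (elim x)
    have wk: "0 \<le> w x + k" using bound[OF elim(2)] by linarith
    have "e2ennreal (f x + ereal k) \<le> ennreal (w x + k)" using elim(1) by (simp add: diff_eq_0_iff_ennreal)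
    then have "f x \<le> ereal (w x)" using wk le[OF elim(2)]
      by (cases "f x") (auto simp: ennreal_le_iff top_unique)
    then show ?case using le[OF elim(2)] by simp
  qed
qed

lemma (in superlinear_hamiltonian) action_measurable:
  "action L T \<in> borel_measurable (borel_curves T)"
  unfolding borel_measurable_iff_Iic_ereal
proof
  interpret C: Metric_space "curves T :: (real \<Rightarrow> 'n torus) set" "mdist (curve_metric T)"
    by (rule Metric_space_mspace_mdist)
  fix a :: ereal
  show "action L T -` {..a} \<inter> space (borel_curves T) \<in> sets (borel_curves T)"
  proof (cases a)
    case (real r)
    have "closedin C.mtopology (action L T -` {..ereal r} \<inter> curves T)"
      unfolding C.metric_closedin_iff_sequentially_closed
    proof (intro conjI allI impI, simp, elim conjE)
      fix \<eta> \<zeta> assume \<eta>: "range \<eta> \<subseteq> action L T -` {..ereal r} \<inter> curves T" and lim: "limitin C.mtopology \<eta> \<zeta> sequentially"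
      have \<eta>n: "\<eta> n \<in> curves T" "action L T (\<eta> n) \<le> ereal r" for n
        using subsetD[OF \<eta> rangeI[of \<eta> n]] by auto
      have \<zeta>: "\<zeta> \<in> curves T" and *: "\<And>e. 0 < e \<Longrightarrow> \<exists>N. \<forall>n\<ge>N. \<eta> n \<in> curves T \<and> mdist (curve_metric T) (\<eta> n) \<zeta> < e"
        using lim unfolding C.limit_metric_sequentially by auto
      have "action L T \<zeta> \<le> ereal r"
      proof (rule action_closed)
        show "continuous_on {0..T} (\<eta> n)" for n using \<eta>n(1) by (simp add: mem_curves_iff)
        show "continuous_on {0..T} \<zeta>" using \<zeta> by (simp add: mem_curves_iff)
        show "action L T (\<eta> n) \<le> ereal r" for n by (rule \<eta>n(2))
        fix e :: real assume "0 < e"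
        then obtain N where N: "\<And>n. n \<ge> N \<Longrightarrow> \<eta> n \<in> curves T \<and> mdist (curve_metric T) (\<eta> n) \<zeta> < e"
          using * by blast
        have "dist (\<eta> n t) (\<zeta> t) < e" if "n \<ge> N" "t \<in> {0..T}" for n t
          using dist_le_mdist_curves[of "\<eta> n" T \<zeta> t] N[OF that(1)] \<zeta> that(2) by linarith
        then show "\<exists>N. \<forall>n\<ge>N. \<forall>t\<in>{0..T}. dist (\<eta> n t) (\<zeta> t) < e" by blast
      qed
      then show "\<zeta> \<in> action L T -` {..ereal r} \<inter> curves T" using \<zeta> by simp
    qed
    then show ?thesis
      unfolding space_borel_curves[OF refl] real
      by (intro sets_borel_curves_closedin) (simp add: mtopology_of_def)
  next
    case MInf
    have "action L T \<zeta> \<noteq> -\<infinity>" if "\<zeta> \<in> curves T" for \<zeta>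
      using action_lower[of \<zeta>] that by (auto simp: mem_curves_iff)
    then have "action L T -` {..a} \<inter> space (borel_curves T) = {}"
      using MInf by (auto simp: space_borel_curves[OF refl])
    then show ?thesis by simp
  next
    case PInf
    then have "action L T -` {..a} \<inter> space (borel_curves T) = space (borel_curves T)" by auto
    then show ?thesis by simp
  qed
qed

lemma (in superlinear_hamiltonian) optimal_measure_iff:
  assumes \<xi>: "prob_space \<xi>" "sets \<xi> = sets (borel_curves T)" and g: "continuous_on UNIV g"
  shows "optimal_measure L T g \<xi> \<longleftrightarrow> ereal_integral \<xi> (action L T) =
    ereal (integral\<^sup>L (marginal \<xi> 0) (\<lambda>x. lax_oleinik L T g x 0) - integral\<^sup>L (marginal \<xi> T) g)"
proof -
  interpret prob_space \<xi> by fact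
  have sp: "space \<xi> = curves T" by (rule space_borel_curves[OF \<xi>(2)])
  obtain G where G: "\<And>x. \<bar>g x\<bar> \<le> G" using continuous_torus_bounded[OF g] by blast
  obtain V where V: "\<And>x. \<bar>lax_oleinik L T g x 0\<bar> \<le> V" using lax_oleinik_bounded[OF g] by blast
  have ev: "(\<lambda>\<zeta>. \<zeta> t) \<in> borel_measurable \<xi>" if "t \<in> {0..T}" for t
    using measurable_eval_curves[OF that] \<xi>(2) by (simp cong: measurable_cong_sets)
  have ev0 [measurable]: "(\<lambda>\<zeta>. \<zeta> 0) \<in> borel_measurable \<xi>" and evT [measurable]: "(\<lambda>\<zeta>. \<zeta> T) \<in> borel_measurable \<xi>"
    using ev T_pos by auto
  have mv [measurable]: "(\<lambda>x. lax_oleinik L T g x 0) \<in> borel_measurable borel" by (rule lax_oleinik_borel_measurable[OF g])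
  have mg [measurable]: "g \<in> borel_measurable borel" by (rule borel_measurable_continuous_onI[OF g])
  \<comment> \<open>Boundedness of both terms makes \<open>w\<close> integrable, so its integral
    splits into the two marginal integrals and is a real number even where the action may be
    infinite.\<close>
  define w where "w \<zeta> = lax_oleinik L T g (\<zeta> 0) 0 - g (\<zeta> T)" for \<zeta>
  have mw: "w \<in> borel_measurable \<xi>" unfolding w_def by measurable
  have bw: "\<bar>w \<zeta>\<bar> \<le> V + G" for \<zeta> using V[of "\<zeta> 0"] G[of "\<zeta> T"] by (auto simp: w_def)
  have k: "0 \<le> V + G" using bw abs_ge_zero order_trans by blast
  have act: "action L T \<in> borel_measurable \<xi>"
    using action_measurable \<xi>(2) by (simp cong: measurable_cong_sets)
  have le: "ereal (w \<zeta>) \<le> action L T \<zeta>" if "\<zeta> \<in> space \<xi>" for \<zeta>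
    using lax_oleinik_le[OF g, of \<zeta>] that by (cases "action L T \<zeta>") (auto simp: sp mem_curves_iff w_def)
  have "integral\<^sup>L \<xi> w = integral\<^sup>L \<xi> (\<lambda>\<zeta>. lax_oleinik L T g (\<zeta> 0) 0) - integral\<^sup>L \<xi> (\<lambda>\<zeta>. g (\<zeta> T))"
    unfolding w_def using V G
    by (intro Bochner_Integration.integral_diff integrable_const_bound[of _ V] integrable_const_bound[of _ G]) auto
  also have "\<dots> = integral\<^sup>L (marginal \<xi> 0) (\<lambda>x. lax_oleinik L T g x 0) - integral\<^sup>L (marginal \<xi> T) g"
    unfolding marginal_def by (simp add: integral_distr)
  finally have iw: "integral\<^sup>L (marginal \<xi> 0) (\<lambda>x. lax_oleinik L T g x 0) - integral\<^sup>L (marginal \<xi> T) g = integral\<^sup>L \<xi> w" ..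
  have "optimal_measure L T g \<xi> \<longleftrightarrow> (AE \<zeta> in \<xi>. action L T \<zeta> = ereal (w \<zeta>))"
    unfolding optimal_measure_def w_def
    by (rule AE_cong) (simp add: sp optimal_curve_iff[OF g])
  also have "\<dots> \<longleftrightarrow> ereal_integral \<xi> (action L T) = ereal (integral\<^sup>L \<xi> w)"
    using ereal_integral_cong_AE[of "action L T" "\<lambda>\<zeta>. ereal (w \<zeta>)" \<xi>] ereal_integral_bounded(2)[OF mw bw k]
      ereal_integral_eq_imp_AE[OF act mw bw le] by auto
  finally show ?thesis unfolding iw .
qed

theorem proposition4p13:
  fixes H\<^sub>0 :: "'n::finite torus \<Rightarrow> real \<Rightarrow> real ^ 'n \<Rightarrow> real"
    and T :: real
    and \<xi> :: "(real \<Rightarrow> 'n torus) measure"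
  assumes "T > 0"
    and "continuous_on (UNIV \<times> {0..T} \<times> UNIV) (\<lambda>(x, t, p). H\<^sub>0 x t p)"
    and "\<And>x t. t \<in> {0..T} \<Longrightarrow> convex_on UNIV (H\<^sub>0 x t)"
    and "\<And>M. \<forall>\<^sub>F p in at_infinity. \<forall>x. \<forall>t\<in>{0..T}. M \<le> H\<^sub>0 x t p / norm p"
    and "prob_space \<xi>"
    and "sets \<xi> = sets (borel_curves T)"
  shows "(\<exists>g\<^sub>0. continuous_on UNIV g\<^sub>0 \<and> optimal_measure (lagrangian H\<^sub>0) T g\<^sub>0 \<xi>) \<longleftrightarrow>
         (\<exists>g\<^sub>0. continuous_on UNIV g\<^sub>0 \<and>
            ereal_integral \<xi> (action (lagrangian H\<^sub>0) T) =
              ereal (integral\<^sup>L (marginal \<xi> 0) (\<lambda>x. lax_oleinik (lagrangian H\<^sub>0) T g\<^sub>0 x 0)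
                - integral\<^sup>L (marginal \<xi> T) g\<^sub>0))"
proof -
  interpret superlinear_hamiltonian H\<^sub>0 T by unfold_locales (use assms in auto)
  show ?thesis using optimal_measure_iff[OF assms(5,6)] by blast
qed


end
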